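(* Assume that $(\mathcal X,\sim)$, $d$, $m$, $R$, $(R^k)_{k\ge1}$ satisfy the standing assumptions listed in the context. For any $x,y\in\mathcal X$ such that $E_{R^{xy}}(\ell)<\infty$, the sequence $(R^{k,xy})_{k\ge1}$ of $xy$-bridges of $(R^k)_{k\ge1}$ is convergent (narrowly in $\mathrm P(\Omega)$) and $$\lim_{k\to\infty}R^{k,xy}=G^{xy}.$$
   Context: **Graph and paths.** $\mathcal X$ is a countable set (discrete topology) with an undirected graph structure $\sim$ which is irreducible (connected), has no loop and is locally finite. $\Omega$ is the set of all right-continuous, left-limited, piecewise constant paths $\omega:[0,1]\to\mathcal X$ with finitely many jumps, left-continuous at $t=1$, such that $\omega_{t^-}\ne\omega_t$ implies $\omega_{t^-}\sim\omega_t$. It carries the Skorokhod topology and the $\sigma$-field generated by the canonical process $X_t(\omega)=\omega_t$. $\mathrm P(\Omega)$, $\mathrm M_+(\Omega)$ are the sets of probability and positive measures on $\Omega$. For $Q\in\mathrm M_+(\Omega)$, the $xy$-bridge is $Q^{xy}=Q(\cdot\mid X_0=x,X_1=y)$; $R^{k,xy}:=(R^k)^{xy}$. **Standing assumptions.** - $d$ is a distance on $\mathcal X$ with $d(x,y)\ge1$ for $x\ne y$ and $d(x,y)=\inf\{\ell(\omega):\omega\in\Omega,\omega_0=x,\omega_1=y\}$, where $\ell(\omega)=\sum_{0<t<1}d(\omega_{t^-},\omega_t)$. - $R\in\mathrm M_+(\Omega)$ is Markov with forward jump kernel $J_{t,x}=\sum_{y\sim x}J_{t,x}(y)\delta_y$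 (generator $L_tu(x)=\sum_{y\sim x}J_{t,x}(y)[u(y)-u(x)]$), where $J_{t,x}(y)>0$ for all $t\in[0,1]$ if and only if $x\sim y$ (and $J_{t,x}(y)=0$ for non-neighbours), and $\sup_{t,x}J_{t,x}(\mathcal X)<\infty$. - For $k\ge1$, $R^k\in\mathrm M_+(\Omega)$ is the Markov measure with forward jump kernel $J^k_{t,x}=\sum_{y\sim x}k^{-d(x,y)}J_{t,x}(y)\delta_y$ and initial measure $R^k_0=m\in\mathrm M_+(\mathcal X)$, $m_x>0$ for all $x$; $R=R^1$. **Geodesic measure.** $\Gamma^{xy}=\{\omega\in\Omega:\omega_0=x,\omega_1=y,\ell(\omega)=d(x,y)\}$, $\Gamma=\bigcup_{x,y}\Gamma^{xy}$, and $G=\mathbf 1_\Gamma\exp\big(\int_0^1J_{t,X_t}(\mathcal X)\,dt\big)R\in\mathrm M_+(\Omega)$. *)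

theory Defs
  imports "HOL-Probability.Probability"
begin

section \<open>Graphs and paths\<close>

definition admissible_graph :: "('a \<Rightarrow> 'a \<Rightarrow> bool) \<Rightarrow> bool" where
  "admissible_graph E \<longleftrightarrow>
     symp E \<and> irreflp E \<and> (\<forall>x y. E\<^sup>*\<^sup>* x y) \<and> (\<forall>x. finite {y. E x y})"

text \<open>The state space is discrete, so having limit \<open>c\<close> means being eventually equal to \<open>c\<close>.\<close>

definition left_lim :: "(real \<Rightarrow> 'a) \<Rightarrow> real \<Rightarrow> 'a" where
  "left_lim \<omega> t = (THE c. \<forall>\<^sub>F s in at_left t. \<omega> s = c)"

definition jump_times :: "(real \<Rightarrow> 'a) \<Rightarrow> real set" where
  "jump_times \<omega> = {t \<in> {0<..<1}. left_lim \<omega> t \<noteq> \<omega> t}"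

text \<open>Paths are functions on \<open>[0,1]\<close>, made unique as functions on the reals by extensionality.
  Right-continuity, left limits and finiteness of the set of jumps make them piecewise constant.\<close>

definition paths :: "('a \<Rightarrow> 'a \<Rightarrow> bool) \<Rightarrow> (real \<Rightarrow> 'a) set" where
  "paths E = {\<omega> \<in> extensional {0..1}.
     (\<forall>t\<in>{0..<1}. \<forall>\<^sub>F s in at_right t. \<omega> s = \<omega> t) \<and>
     (\<forall>t\<in>{0<..1}. \<exists>c. \<forall>\<^sub>F s in at_left t. \<omega> s = c) \<and>
     finite (jump_times \<omega>) \<and>
     left_lim \<omega> 1 = \<omega> 1 \<and>
     (\<forall>t\<in>jump_times \<omega>. E (left_lim \<omega> t) (\<omega> t))}"

definition path_length :: "('a \<Rightarrow> 'a \<Rightarrow> real) \<Rightarrow> (real \<Rightarrow> 'a) \<Rightarrow> real" where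
  "path_length d \<omega> = (\<Sum>t\<in>jump_times \<omega>. d (left_lim \<omega> t) (\<omega> t))"

definition paths_between :: "('a \<Rightarrow> 'a \<Rightarrow> bool) \<Rightarrow> 'a \<Rightarrow> 'a \<Rightarrow> (real \<Rightarrow> 'a) set" where
  "paths_between E x y = {\<omega> \<in> paths E. \<omega> 0 = x \<and> \<omega> 1 = y}"

definition admissible_distance :: "('a \<Rightarrow> 'a \<Rightarrow> bool) \<Rightarrow> ('a \<Rightarrow> 'a \<Rightarrow> real) \<Rightarrow> bool" where
  "admissible_distance E d \<longleftrightarrow>
     Metric_space UNIV d \<and>
     (\<forall>x y. x \<noteq> y \<longrightarrow> d x y \<ge> 1) \<and>
     (\<forall>x y. d x y = (INF \<omega>\<in>paths_between E x y. path_length d \<omega>))"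

definition geodesics_between ::
  "('a \<Rightarrow> 'a \<Rightarrow> bool) \<Rightarrow> ('a \<Rightarrow> 'a \<Rightarrow> real) \<Rightarrow> 'a \<Rightarrow> 'a \<Rightarrow> (real \<Rightarrow> 'a) set" where
  "geodesics_between E d x y = {\<omega> \<in> paths_between E x y. path_length d \<omega> = d x y}"

definition geodesics ::
  "('a \<Rightarrow> 'a \<Rightarrow> bool) \<Rightarrow> ('a \<Rightarrow> 'a \<Rightarrow> real) \<Rightarrow> (real \<Rightarrow> 'a) set" where
  "geodesics E d = (\<Union>x y. geodesics_between E d x y)"

section \<open>Measurable and topological structure of the path space\<close>

text \<open>\<open>path_field E I\<close> carries the \<open>\<sigma>\<close>-field generated by \<open>X\<^sub>s\<close> with \<open>s \<in> I\<close>. Its measure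
  component is irrelevant. Singletons suffice as generators when the state space is countable.\<close>

definition path_field :: "('a \<Rightarrow> 'a \<Rightarrow> bool) \<Rightarrow> real set \<Rightarrow> (real \<Rightarrow> 'a) measure" where
  "path_field E I = sigma (paths E) {{\<omega> \<in> paths E. \<omega> s = a} | s a. s \<in> I}"

text \<open>The Skorokhod topology is defined by the usual metric
  \<open>inf\<^sub>\<theta> max (sup\<^sub>t \<bar>\<theta> t - t\<bar>) (sup\<^sub>t \<rho> (\<omega> t) (\<eta> (\<theta> t)))\<close>, where \<open>\<rho>\<close> is the 0-1 metric of the
  discrete state space and \<open>\<theta>\<close> ranges over increasing bijections of \<open>[0,1]\<close> (which are
  automatically homeomorphisms).\<close>

definition time_changes :: "(real \<Rightarrow> real) set" where
  "time_changes = {\<theta>. strict_mono_on {0..1} \<theta> \<and> \<theta> ` {0..1} = {0..1}}"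

definition skorokhod_dist :: "(real \<Rightarrow> 'a) \<Rightarrow> (real \<Rightarrow> 'a) \<Rightarrow> real" where
  "skorokhod_dist \<omega> \<eta> =
     (INF \<theta>\<in>time_changes.
        max (SUP t\<in>{0..1}. \<bar>\<theta> t - t\<bar>)
            (SUP t\<in>{0..1}. if \<omega> t = \<eta> (\<theta> t) then 0 else 1))"

definition skorokhod_topology :: "('a \<Rightarrow> 'a \<Rightarrow> bool) \<Rightarrow> (real \<Rightarrow> 'a) topology" where
  "skorokhod_topology E = Metric_space.mtopology (paths E) skorokhod_dist"

definition path_measure :: "('a \<Rightarrow> 'a \<Rightarrow> bool) \<Rightarrow> (real \<Rightarrow> 'a) measure \<Rightarrow> bool" where
  "path_measure E Q \<longleftrightarrow> sets Q = sets (path_field E {0..1})"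

text \<open>Narrow convergence of probability measures on the path space. The Borel \<open>\<sigma>\<close>-field of the
  Skorokhod topology is the one generated by the canonical process, so all test functions are
  measurable and the integrals are meaningful.\<close>

definition narrowly_converges ::
  "('a \<Rightarrow> 'a \<Rightarrow> bool) \<Rightarrow> (nat \<Rightarrow> (real \<Rightarrow> 'a) measure) \<Rightarrow> (real \<Rightarrow> 'a) measure \<Rightarrow> bool" where
  "narrowly_converges E P Q \<longleftrightarrow>
     (\<forall>f. continuous_map (skorokhod_topology E) euclideanreal f \<and> bounded (f ` paths E) \<longrightarrow>
        (\<lambda>k. \<integral>\<omega>. f \<omega> \<partial>P k) \<longlonglongrightarrow> (\<integral>\<omega>. f \<omega> \<partial>Q))"

section \<open>Markov measures with a jump kernel\<close>

text \<open>\<open>J t x y\<close> is the rate \<open>J\<^bsub>t,x\<^esub>(y)\<close>, \<open>total_rate E J t x\<close> is \<open>J\<^bsub>t,x\<^esub>(\<X>)\<close>.\<close>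

definition total_rate ::
  "('a \<Rightarrow> 'a \<Rightarrow> bool) \<Rightarrow> (real \<Rightarrow> 'a \<Rightarrow> 'a \<Rightarrow> real) \<Rightarrow> real \<Rightarrow> 'a \<Rightarrow> real" where
  "total_rate E J t x = (\<Sum>y\<in>{y. E x y}. J t x y)"

definition admissible_kernel ::
  "('a \<Rightarrow> 'a \<Rightarrow> bool) \<Rightarrow> (real \<Rightarrow> 'a \<Rightarrow> 'a \<Rightarrow> real) \<Rightarrow> bool" where
  "admissible_kernel E J \<longleftrightarrow>
     (\<forall>x y. set_borel_measurable borel {0..1} (\<lambda>t. J t x y)) \<and>
     (\<forall>t\<in>{0..1}. \<forall>x y. if E x y then J t x y > 0 else J t x y = 0) \<and>
     (\<exists>C. \<forall>t\<in>{0..1}. \<forall>x. total_rate E J t x \<le> C)"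

definition slowed_kernel ::
  "('a \<Rightarrow> 'a \<Rightarrow> real) \<Rightarrow> (real \<Rightarrow> 'a \<Rightarrow> 'a \<Rightarrow> real) \<Rightarrow> nat \<Rightarrow> real \<Rightarrow> 'a \<Rightarrow> 'a \<Rightarrow> real" where
  "slowed_kernel d J k t x y = real k powr (- d x y) * J t x y"

definition generator ::
  "('a \<Rightarrow> 'a \<Rightarrow> bool) \<Rightarrow> (real \<Rightarrow> 'a \<Rightarrow> 'a \<Rightarrow> real) \<Rightarrow> real \<Rightarrow> ('a \<Rightarrow> real) \<Rightarrow> 'a \<Rightarrow> real" where
  "generator E J t u x = (\<Sum>y\<in>{y. E x y}. J t x y * (u y - u x))"

text \<open>The conditional probability of a future event \<open>B\<close> given the past \<open>X\<^bsub>[0,t]\<^esub>\<close> is a function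
  \<open>p\<close> of \<open>X\<^sub>t\<close>. In this form the marginal of \<open>Q\<close> at time \<open>t\<close> need not be \<open>\<sigma>\<close>-finite.\<close>

definition markov_property :: "('a \<Rightarrow> 'a \<Rightarrow> bool) \<Rightarrow> (real \<Rightarrow> 'a) measure \<Rightarrow> bool" where
  "markov_property E Q \<longleftrightarrow>
     (\<forall>t\<in>{0..1}. \<forall>B\<in>sets (path_field E {t..1}). \<exists>p :: 'a \<Rightarrow> ennreal.
        \<forall>A\<in>sets (path_field E {0..t}). emeasure Q (A \<inter> B) = (\<integral>\<^sup>+\<omega>\<in>A. p (\<omega> t) \<partial>Q))"

text \<open>Martingale problem: for every bounded \<open>u\<close>, the process
  \<open>u(X\<^sub>t) - u(X\<^sub>0) - \<integral>\<^sub>0\<^sup>t L\<^sub>r u(X\<^sub>r) dr\<close> is a \<open>Q\<close>-martingale. As \<open>Q\<close> may be infinite, the martingale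
  identity is tested on past events of finite measure.\<close>

definition has_generator ::
  "('a \<Rightarrow> 'a \<Rightarrow> bool) \<Rightarrow> (real \<Rightarrow> 'a \<Rightarrow> 'a \<Rightarrow> real) \<Rightarrow> (real \<Rightarrow> 'a) measure \<Rightarrow> bool" where
  "has_generator E J Q \<longleftrightarrow>
     (\<forall>u :: 'a \<Rightarrow> real. \<forall>s t. \<forall>A\<in>sets (path_field E {0..s}).
        bounded (range u) \<and> 0 \<le> s \<and> s \<le> t \<and> t \<le> 1 \<and> emeasure Q A < \<infinity> \<longrightarrow>
        (LINT \<omega>:A|Q. u (\<omega> t) - u (\<omega> s)) =
        (LINT \<omega>:A|Q. (LINT r:{s..t}|lborel. generator E J r u (\<omega> r))))"

definition markov_with_kernel ::
  "('a \<Rightarrow> 'a \<Rightarrow> bool) \<Rightarrow> (real \<Rightarrow> 'a \<Rightarrow> 'a \<Rightarrow> real) \<Rightarrow> 'a measure \<Rightarrow> (real \<Rightarrow> 'a) measure \<Rightarrow> bool"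
  where
  "markov_with_kernel E J m Q \<longleftrightarrow>
     path_measure E Q \<and> markov_property E Q \<and> has_generator E J Q \<and>
     distr Q (count_space UNIV) (\<lambda>\<omega>. \<omega> 0) = m"

definition bridge :: "(real \<Rightarrow> 'a) measure \<Rightarrow> 'a \<Rightarrow> 'a \<Rightarrow> (real \<Rightarrow> 'a) measure" where
  "bridge Q x y = uniform_measure Q {\<omega> \<in> space Q. \<omega> 0 = x \<and> \<omega> 1 = y}"

definition geodesic_measure ::
  "('a \<Rightarrow> 'a \<Rightarrow> bool) \<Rightarrow> ('a \<Rightarrow> 'a \<Rightarrow> real) \<Rightarrow> (real \<Rightarrow> 'a \<Rightarrow> 'a \<Rightarrow> real) \<Rightarrow>
   (real \<Rightarrow> 'a) measure \<Rightarrow> (real \<Rightarrow> 'a) measure" where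
  "geodesic_measure E d J R =
     density R (\<lambda>\<omega>. ennreal (indicator (geodesics E d) \<omega> *
       exp (LINT t:{0..1}|lborel. total_rate E J t (\<omega> t))))"

end

theory Submission
  imports Defs
begin

text \<open>
  By Girsanov's formula \<open>R\<^sup>k\<close> has on \<open>{X\<^sub>0 = x}\<close> the density
  \<open>Z\<^sub>k = k powr (- length) * exp (\<integral> (J - J\<^sup>k) (X\<^sub>t) dt)\<close> with respect to \<open>R\<close>. On paths from
  \<open>x\<close> to \<open>y\<close> the length is at least \<open>d x y\<close>, so \<open>k powr (d x y) * Z\<^sub>k\<close> is bounded and converges
  to the density of \<open>G\<close>; dominated convergence and normalisation give the limit, even in total
  variation.

  Girsanov's formula is obtained without stochastic calculus. The martingale problem gives the mean
  of a function of two successive grid points up to the square of the step size, and the chain \<open>R\<close>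
  with the weights \<open>k powr (- d a b) * exp (\<integral> (J - J\<^sup>k) (a) dt)\<close> on its steps has the same first-order
  means as the chain \<open>R\<^sup>k\<close>. Telescoping over a dyadic grid of mesh \<open>h\<close> leaves an error of order \<open>h\<close>
  on every cylinder event, and along each path the product of the weights converges to \<open>Z\<^sub>k\<close>.

  The limit has positive mass because \<open>R\<^sup>k\<close> sends mass at least \<open>c * k powr (- L)\<close> along a walk of
  length \<open>L\<close>, with \<open>c\<close> independent of \<open>k\<close>, and because only finitely many walks from \<open>x\<close> are shorter
  than a given bound, so that \<open>d x y\<close> is the length of a walk.
\<close>

section \<open>Paths on the dyadic grid\<close>

text \<open>The proof is shaped by \<open>has_generator\<close>, which gives only means of
  \<open>u (\<omega> t) - u (\<omega> s)\<close> over past events of finite mass, while the measures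
  themselves may be infinite. Conditioning is therefore replaced by splitting an event over
  countably many states, and all estimates are linear in \<open>measure Q A\<close>. The telescoping
  rests on a single function, the backward recursion built from the first-order means of
  \<open>Rk k\<close>: under both measures the product of the weights is compared with it, each step
  costs the square of the mesh, and \<open>2 ^ n\<close> steps leave one power. Dyadic times serve
  because their grids are nested and right-continuity recovers all other times. The short-time
  constants depend on the kernel only through \<open>C\<close>, which slowing down does not
  increase; this gives uniformity in \<open>k\<close>. No path following a prescribed walk is built
  by hand: paths from \<open>x\<close> to \<open>y\<close>, and finally geodesics of positive
  weight, exist because mass bounded from below must sit somewhere.\<close>

lemma left_lim_eqI:
  assumes "\<forall>\<^sub>F s in at_left t. \<omega> s = c"
  shows "left_lim \<omega> (t::real) = c"
  unfolding left_lim_def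
proof (rule the_equality)
  fix c' assume "\<forall>\<^sub>F s in at_left t. \<omega> s = c'"
  with assms have "\<forall>\<^sub>F s in at_left t. c' = c" by eventually_elim simp
  then show "c' = c" by simp
qed (fact assms)

lemma path_at_left:
  assumes "\<omega> \<in> paths E" "0 < t" "t \<le> 1"
  shows "\<forall>\<^sub>F s in at_left t. \<omega> s = left_lim \<omega> t"
proof -
  have "\<exists>c. \<forall>\<^sub>F s in at_left t. \<omega> s = c"
    using assms by (simp add: paths_def)
  then obtain c where c: "\<forall>\<^sub>F s in at_left t. \<omega> s = c" ..
  with left_lim_eqI[OF c] show ?thesis by simp
qed

lemma path_at_left_no_jump:
  assumes "\<omega> \<in> paths E" "0 < t" "t \<le> 1" "t \<notin> jump_times \<omega>"
  shows "\<forall>\<^sub>F s in at_left t. \<omega> s = \<omega> t"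
proof -
  \<comment> \<open>Jump times lie in the open interval, so \<open>t = 1\<close> relies on the
    separate clause of \<open>paths\<close> that rules out a jump at the end.\<close>
  have "left_lim \<omega> t = \<omega> t"
    using assms by (cases "t = 1") (auto simp: paths_def jump_times_def)
  with path_at_left[OF assms(1-3)] show ?thesis by simp
qed

lemma path_at_right:
  assumes "\<omega> \<in> paths E" "0 \<le> t" "t < 1"
  shows "\<forall>\<^sub>F s in at_right t. \<omega> s = \<omega> t"
  using assms by (auto simp: paths_def)

text \<open>States are coded as reals through \<open>to_nat\<close>, so that local constancy becomes
  continuity with zero derivative and the mean value theorem applies. A jump at \<open>s\<close>
  itself is harmless, because only right-continuity is used there.\<close>

lemma path_const:
  fixes \<omega> :: "real \<Rightarrow> 'a::countable"
  assumes \<omega>: "\<omega> \<in> paths E" and st: "0 \<le> s" "s \<le> t" "t \<le> 1"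
    and nj: "{s<..t} \<inter> jump_times \<omega> = {}"
  shows "\<omega> t = \<omega> s"
proof (cases "s = t")
  case False
  with st have lt: "s < t" by simp
  define g where "g = (\<lambda>r. real (to_nat (\<omega> r)))"
  have L: "\<forall>\<^sub>F q in at_left r. g q = g r" if "s < r" "r \<le> t" for r
  proof -
    have "r \<notin> jump_times \<omega>" using nj that by auto
    then show ?thesis using path_at_left_no_jump[OF \<omega>, of r] that st
      unfolding g_def by (auto elim: eventually_mono)
  qed
  have Rt: "\<forall>\<^sub>F q in at_right r. g q = g r" if "s \<le> r" "r < t" for r
    using path_at_right[OF \<omega>, of r] that st
    unfolding g_def by (auto elim: eventually_mono)
  have "continuous_on {s..t} g"
    unfolding continuous_on_def
  proof
    fix r assume r: "r \<in> {s..t}"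
    have "\<forall>\<^sub>F q in at r within {s..t}. g q = g r"
    proof -
      consider "r = s" | "r = t" | "s < r" "r < t" using r by force
      then show ?thesis
      proof cases
        case 1 then show ?thesis using Rt[of s] lt by (simp add: at_within_Icc_at_right)
      next
        case 2 then show ?thesis using L[of t] lt by (simp add: at_within_Icc_at_left)
      next
        case 3
        then show ?thesis using L[of r] Rt[of r]
          by (simp add: at_within_Icc_at eventually_at_split)
      qed
    qed
    then show "(g \<longlongrightarrow> g r) (at r within {s..t})" by (rule tendsto_eventually)
  qed
  moreover have "(g has_real_derivative 0) (at r)" if "s < r" "r < t" for r
  proof -
    have "\<forall>\<^sub>F q in nhds r. g q = g r"
      using L[of r] Rt[of r] that by (simp add: eventually_nhds_conv_at eventually_at_split)
    then show ?thesis by (subst DERIV_cong_ev[OF refl _ refl, of _ "\<lambda>_. g r"]) auto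
  qed
  ultimately have "g t = g s" by (intro DERIV_isconst_end[OF lt])
  then show ?thesis by (simp add: g_def)
qed simp

lemma path_single_jump:
  fixes \<omega> :: "real \<Rightarrow> 'a::countable"
  assumes \<omega>: "\<omega> \<in> paths E" and st: "0 \<le> s" "s \<le> t" "t \<le> 1"
    and j: "{s<..t} \<inter> jump_times \<omega> = {\<tau>}"
  shows "\<omega> s = left_lim \<omega> \<tau>" "\<omega> t = \<omega> \<tau>"
proof -
  have \<tau>: "s < \<tau>" "\<tau> \<le> t" using j by auto
  have "{\<tau><..t} \<inter> jump_times \<omega> = {}" using j \<tau> by fastforce
  then show "\<omega> t = \<omega> \<tau>" using \<tau> st by (intro path_const[OF \<omega>]) auto
  have "\<omega> r = \<omega> s" if "s < r" "r < \<tau>" for r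
  proof -
    have "{s<..r} \<inter> jump_times \<omega> \<subseteq> {s<..t} \<inter> jump_times \<omega> - {\<tau>}" using \<tau> that by auto
    with j have "{s<..r} \<inter> jump_times \<omega> = {}" by simp
    then show ?thesis using \<tau> st that by (intro path_const[OF \<omega>]) auto
  qed
  then have "\<forall>\<^sub>F r in at_left \<tau>. \<omega> r = \<omega> s"
    using \<tau> by (auto simp: eventually_at_left_field)
  then show "\<omega> s = left_lim \<omega> \<tau>" by (simp add: left_lim_eqI)
qed

text \<open>The mesh is dyadic so that the grids are nested: events on two levels can be read on the
  finer one (\<open>grid_subset\<close>).\<close>

definition grid :: "nat \<Rightarrow> nat \<Rightarrow> real" where
  "grid n i = real i / 2 ^ n"

lemma grid_0 [simp]: "grid n 0 = 0" and grid_last [simp]: "grid n (2 ^ n) = 1"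
  by (simp_all add: grid_def)

lemma grid_mono: "i \<le> j \<Longrightarrow> grid n i \<le> grid n j"
  by (simp add: grid_def divide_right_mono)

lemma grid_bounds: "i \<le> 2 ^ n \<Longrightarrow> 0 \<le> grid n i \<and> grid n i \<le> 1"
  using grid_mono[of i "2 ^ n" n] by (simp add: grid_def)

lemma grid_Suc: "grid n (Suc i) = grid n i + 1 / 2 ^ n"
  by (simp add: grid_def field_simps)

text \<open>The half-open cells tile \<open>{0<..1}\<close>, so every point of \<open>T\<close> is
  counted exactly once, including points that lie on the grid.\<close>

lemma sum_grid_cells:
  assumes "finite T" "T \<subseteq> {0<..1}"
  shows "(\<Sum>i<2 ^ n. \<Sum>\<tau>\<in>{grid n i<..grid n (Suc i)} \<inter> T. f \<tau>) = (\<Sum>\<tau>\<in>T. f \<tau> :: real)"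
proof -
  have "(\<Sum>i<m. \<Sum>\<tau>\<in>{grid n i<..grid n (Suc i)} \<inter> T. f \<tau>) = (\<Sum>\<tau>\<in>{0<..grid n m} \<inter> T. f \<tau>)" for m
  proof (induction m)
    case (Suc m)
    have "{0<..grid n (Suc m)} \<inter> T = ({0<..grid n m} \<inter> T) \<union> ({grid n m<..grid n (Suc m)} \<inter> T)"
      using grid_mono[of m "Suc m" n] grid_mono[of 0 m n] by auto
    then show ?case using Suc assms(1)
      by (simp add: sum.union_disjoint Int_assoc[symmetric] disjoint_iff)
  qed simp
  from this[of "2 ^ n"] assms(2) show ?thesis by (simp add: Int_absorb1)
qed

lemma eventually_grid_separates:
  assumes "finite T"
  shows "\<forall>\<^sub>F n in sequentially. \<forall>i. \<forall>p\<in>{grid n i<..grid n (Suc i)} \<inter> T.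
    \<forall>q\<in>{grid n i<..grid n (Suc i)} \<inter> T. p = q"
proof -
  \<comment> \<open>The extra element 1 keeps \<open>S\<close> nonempty when \<open>T\<close> has at
    most one point, so that \<open>Min S\<close> is meaningful.\<close>
  define S where "S = insert 1 ((\<lambda>(p, q). \<bar>p - q\<bar>) ` {(p, q). p \<in> T \<and> q \<in> T \<and> p \<noteq> q})"
  have "{(p, q). p \<in> T \<and> q \<in> T \<and> p \<noteq> q} \<subseteq> T \<times> T" by auto
  then have fin: "finite S" unfolding S_def
    using assms finite_subset[of _ "T \<times> T"] by blast
  define e where "e = Min S"
  have e: "e > 0" unfolding e_def using fin by (subst Min_gr_iff) (auto simp: S_def)
  have gap: "e \<le> \<bar>p - q\<bar>" if "p \<in> T" "q \<in> T" "p \<noteq> q" for p q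
    unfolding e_def by (rule Min_le[OF fin]) (use that in \<open>auto simp: S_def\<close>)
  have "(\<lambda>n. (1/2) ^ n :: real) \<longlonglongrightarrow> 0" by (rule LIMSEQ_realpow_zero) auto
  then have "\<forall>\<^sub>F n in sequentially. (1/2) ^ n < e" using e by (rule order_tendstoD)
  then show ?thesis
  proof eventually_elim
    case (elim n)
    show ?case
    proof (intro allI ballI)
      fix i p q assume pq: "p \<in> {grid n i<..grid n (Suc i)} \<inter> T" "q \<in> {grid n i<..grid n (Suc i)} \<inter> T"
      then have "\<bar>p - q\<bar> < (1/2) ^ n" by (auto simp: grid_Suc power_one_over)
      with elim gap[of p q] pq show "p = q" by force
    qed
  qed
qed

lemma jump_times_subset: "jump_times \<omega> \<subseteq> {0<..1}"
  by (auto simp: jump_times_def)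

lemma path_jump_times:
  assumes "\<omega> \<in> paths E"
  shows "finite (jump_times \<omega>)" "\<tau> \<in> jump_times \<omega> \<Longrightarrow> E (left_lim \<omega> \<tau>) (\<omega> \<tau>)"
  using assms by (auto simp: paths_def)

text \<open>Once each cell contains at most one jump, a grid step either stays put or is precisely
  the jump in its cell. The condition \<open>g a a = 0\<close> makes cells without a jump contribute
  nothing.\<close>

lemma eventually_grid_step:
  fixes \<omega> :: "real \<Rightarrow> 'a::countable"
  assumes \<omega>: "\<omega> \<in> paths E" and g: "\<And>a. g a a = (0::real)"
  shows "\<forall>\<^sub>F n in sequentially. \<forall>i<2^n.
     (\<omega> (grid n (Suc i)) = \<omega> (grid n i) \<or> E (\<omega> (grid n i)) (\<omega> (grid n (Suc i)))) \<and>
     g (\<omega> (grid n i)) (\<omega> (grid n (Suc i))) =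
       (\<Sum>\<tau>\<in>{grid n i<..grid n (Suc i)} \<inter> jump_times \<omega>. g (left_lim \<omega> \<tau>) (\<omega> \<tau>))"
  using eventually_grid_separates[OF path_jump_times(1)[OF \<omega>]]
proof eventually_elim
  case (elim n)
  show ?case
  proof (intro allI impI)
    fix i :: nat assume i: "i < 2 ^ n"
    let ?S = "{grid n i<..grid n (Suc i)} \<inter> jump_times \<omega>"
    have b: "0 \<le> grid n i" "grid n i \<le> grid n (Suc i)" "grid n (Suc i) \<le> 1"
      using grid_bounds[of i n] grid_bounds[of "Suc i" n] grid_mono[of i "Suc i" n] i by auto
    show "(\<omega> (grid n (Suc i)) = \<omega> (grid n i) \<or> E (\<omega> (grid n i)) (\<omega> (grid n (Suc i)))) \<and>
      g (\<omega> (grid n i)) (\<omega> (grid n (Suc i))) = (\<Sum>\<tau>\<in>?S. g (left_lim \<omega> \<tau>) (\<omega> \<tau>))"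
    proof (cases "?S = {}")
      case True
      then show ?thesis using path_const[OF \<omega> b True] by (simp add: g)
    next
      case False
      then obtain \<tau> where \<tau>: "?S = {\<tau>}" using elim by blast
      then have "\<tau> \<in> jump_times \<omega>" by blast
      then show ?thesis unfolding \<tau> path_single_jump[OF \<omega> b \<tau>]
        using path_jump_times[OF \<omega>] by simp
    qed
  qed
qed

text \<open>The grid sums reach the length exactly at a finite level, not only in the limit;
  \<open>path_walk\<close> needs this exactness.\<close>

lemma eventually_path_length_grid:
  fixes \<omega> :: "real \<Rightarrow> 'a::countable"
  assumes \<omega>: "\<omega> \<in> paths E" and g: "\<And>a. d a a = (0::real)"
  shows "\<forall>\<^sub>F n in sequentially. (\<Sum>i<2^n. d (\<omega> (grid n i)) (\<omega> (grid n (Suc i)))) = path_length d \<omega>"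
  using eventually_grid_step[where g = d, OF \<omega> g]
proof eventually_elim
  case (elim n)
  then have "(\<Sum>i<2^n. d (\<omega> (grid n i)) (\<omega> (grid n (Suc i)))) =
    (\<Sum>i<2^n. \<Sum>\<tau>\<in>{grid n i<..grid n (Suc i)} \<inter> jump_times \<omega>. d (left_lim \<omega> \<tau>) (\<omega> \<tau>))"
    by (intro sum.cong) auto
  also have "\<dots> = path_length d \<omega>" unfolding path_length_def
    using path_jump_times[OF \<omega>] jump_times_subset by (intro sum_grid_cells)
  finally show ?case .
qed

section \<open>Measurability on the path space\<close>

lemma space_path_field: "space (path_field E I) = paths E"
  unfolding path_field_def by (rule space_measure_of) auto

lemma sets_path_field:
  "sets (path_field E I) = sigma_sets (paths E) {{\<omega> \<in> paths E. \<omega> s = a} | s a. s \<in> I}"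
  unfolding path_field_def by (rule sets_measure_of) auto

lemma sets_path_field_mono: "I \<subseteq> I' \<Longrightarrow> sets (path_field E I) \<subseteq> sets (path_field E I')"
  unfolding sets_path_field by (rule sigma_sets_mono') auto

lemma path_field_coordinate: "s \<in> I \<Longrightarrow> {\<omega> \<in> paths E. \<omega> s = a} \<in> sets (path_field E I)"
  unfolding sets_path_field by (rule sigma_sets.Basic) auto

lemma measurable_coordinate:
  fixes E :: "'a::countable \<Rightarrow> 'a \<Rightarrow> bool"
  assumes "s \<in> I"
  shows "(\<lambda>\<omega>. \<omega> s) \<in> measurable (path_field E I) (count_space UNIV)"
proof -
  have "(\<lambda>\<omega>. \<omega> s) -` {a} \<inter> space (path_field E I) \<in> sets (path_field E I)" for a
    using path_field_coordinate[OF assms, of E a]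
    by (simp add: space_path_field vimage_def Int_def conj_commute)
  then show ?thesis by (subst measurable_count_space_eq_countable) auto
qed

text \<open>Outside \<open>[0,1]\<close> extensionality fixes the value \<open>undefined\<close>, so
  that no side condition on the time has to be carried along.\<close>

lemma measurable_coordinate_any:
  fixes E :: "'a::countable \<Rightarrow> 'a \<Rightarrow> bool"
  shows "(\<lambda>\<omega>. \<omega> s) \<in> measurable (path_field E {0..1}) (count_space UNIV)"
proof (cases "s \<in> {0..1}")
  case False
  have "\<omega> s = undefined" if "\<omega> \<in> space (path_field E {0..1})" for \<omega>
    using that False by (simp add: space_path_field paths_def extensional_def)
  then show ?thesis
    by (subst measurable_cong[where g = "\<lambda>_. undefined"]) auto
qed (rule measurable_coordinate)

text \<open>For \<open>r \<ge> 0\<close> this is the index of the first grid point strictly to the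
  right of \<open>r\<close>. Strictness is what allows right-continuity to be applied along
  \<open>at_right r\<close>.\<close>

definition next_grid :: "nat \<Rightarrow> real \<Rightarrow> nat" where
  "next_grid n r = nat \<lfloor>r * 2 ^ n\<rfloor> + 1"

lemma next_grid_at_right:
  assumes "0 \<le> r"
  shows "filterlim (\<lambda>n. grid n (next_grid n r)) (at_right r) sequentially"
proof (rule tendsto_imp_filterlim_at_right)
  have fl: "real (nat \<lfloor>r * 2 ^ n\<rfloor>) = of_int \<lfloor>r * 2 ^ n\<rfloor>" for n using assms by simp
  have gr: "r < grid n (next_grid n r)" for n
    using floor_correct[of "r * 2 ^ n"] unfolding grid_def next_grid_def
    by (simp add: fl field_simps del: of_nat_nat)
  have le: "grid n (next_grid n r) \<le> r + (1/2) ^ n" for n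
    using floor_correct[of "r * 2 ^ n"] unfolding grid_def next_grid_def
    by (simp add: fl field_simps power_one_over del: of_nat_nat)
  have "(\<lambda>n. r + (1/2) ^ n) \<longlonglongrightarrow> r + 0"
    by (intro tendsto_intros LIMSEQ_realpow_zero) auto
  then have lim: "(\<lambda>n. r + (1/2) ^ n) \<longlonglongrightarrow> r" by simp
  show "(\<lambda>n. grid n (next_grid n r)) \<longlonglongrightarrow> r"
    by (rule tendsto_sandwich[OF _ _ tendsto_const lim])
      (auto intro!: always_eventually less_imp_le[OF gr] le)
  show "\<forall>\<^sub>F n in sequentially. r < grid n (next_grid n r)"
    using gr by simp
qed

lemma next_grid_le: "0 \<le> r \<Longrightarrow> r < 1 \<Longrightarrow> next_grid n r \<le> 2 ^ n"
proof -
  assume r: "0 \<le> r" "r < 1"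
  then have "r * 2 ^ n < real_of_int (2 ^ n)" by simp
  then have "\<lfloor>r * 2 ^ n\<rfloor> < 2 ^ n" by (simp only: floor_less_iff)
  then show ?thesis using r unfolding next_grid_def
    by (simp add: nat_less_iff Suc_le_eq)
qed

lemma eventually_next_grid:
  assumes "\<omega> \<in> paths E" "0 \<le> r" "r < 1"
  shows "\<forall>\<^sub>F n in sequentially. \<omega> (grid n (next_grid n r)) = \<omega> r"
  using path_at_right[OF assms] next_grid_at_right[OF assms(2)]
  by (auto simp: filterlim_iff)

text \<open>The path is approximated by its value at the next grid point; at time 1 there is none to
  the right, so that value is taken directly. To pass to the limit states are coded as reals by
  \<open>to_nat\<close>, and \<open>from_nat\<close> of the floor decodes the result.\<close>

lemma measurable_joint:
  fixes E :: "'a::countable \<Rightarrow> 'a \<Rightarrow> bool"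
  shows "(\<lambda>p. fst p (snd p)) \<in>
    measurable (path_field E {0..1} \<Otimes>\<^sub>M (borel :: real measure)) (count_space UNIV)"
proof -
  let ?M = "path_field E {0..1} \<Otimes>\<^sub>M (borel :: real measure)"
  define X where "X = (\<lambda>n (p :: (real \<Rightarrow> 'a) \<times> real).
     if 0 \<le> snd p \<and> snd p < 1 then fst p (grid n (next_grid n (snd p)))
     else if snd p = 1 then fst p 1 else undefined)"
  note [measurable] = measurable_coordinate_any[of _ E]
  have [measurable]: "(\<lambda>p. fst p s) \<in> measurable ?M (count_space UNIV)" for s
    by (rule measurable_compose[OF measurable_fst measurable_coordinate_any])
  have ng: "(\<lambda>p. next_grid n (snd p)) \<in> measurable ?M (count_space UNIV)" for n
    unfolding next_grid_def by measurable
  have [measurable]: "(\<lambda>p. fst p (grid n (next_grid n (snd p)))) \<in> measurable ?M (count_space UNIV)" for n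
    by (rule measurable_compose_countable[OF _ ng]) measurable
  have X [measurable]: "X n \<in> measurable ?M (count_space UNIV)" for n
    unfolding X_def by measurable
  have "(\<lambda>p. real (to_nat (fst p (snd p)))) \<in> borel_measurable ?M"
  proof (rule borel_measurable_LIMSEQ_real)
    show "(\<lambda>p. real (to_nat (X n p))) \<in> borel_measurable ?M" for n by measurable
    fix p :: "(real \<Rightarrow> 'a) \<times> real" assume "p \<in> space ?M"
    then have p: "fst p \<in> paths E" by (auto simp: space_pair_measure space_path_field)
    have "\<forall>\<^sub>F n in sequentially. X n p = fst p (snd p)"
    proof (cases "0 \<le> snd p \<and> snd p < 1")
      case True
      then show ?thesis using eventually_next_grid[OF p, of "snd p"] by (simp add: X_def)
    next
      case False
      then have "X n p = fst p (snd p)" for n using p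
        by (auto simp: X_def paths_def extensional_def)
      then show ?thesis by simp
    qed
    then show "(\<lambda>n. real (to_nat (X n p))) \<longlonglongrightarrow> real (to_nat (fst p (snd p)))"
      by (intro tendsto_eventually) (auto elim: eventually_mono)
  qed
  then have "(\<lambda>p. from_nat (nat \<lfloor>real (to_nat (fst p (snd p)))\<rfloor>) :: 'a) \<in>
      measurable ?M (count_space UNIV)"
    by (rule measurable_compose[where N = borel and g = "\<lambda>x. from_nat (nat \<lfloor>x\<rfloor>)"])
      (rule measurable_compose[OF measurable_real_floor], simp)
  then show ?thesis by simp
qed

text \<open>All times lie on one dyadic level because the grid comparison sees no others.
  Constraints are sets rather than points, so that intersections stay in the family, and
  \<open>T = {}\<close> yields the whole path space.\<close>

definition cylinders :: "('a \<Rightarrow> 'a \<Rightarrow> bool) \<Rightarrow> (real \<Rightarrow> 'a) set set" where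
  "cylinders E = {{\<omega> \<in> paths E. \<forall>t\<in>T. \<omega> t \<in> F t} | T F.
     finite T \<and> (\<exists>n. T \<subseteq> grid n ` {..2 ^ n})}"

lemma cylindersI:
  "finite T \<Longrightarrow> T \<subseteq> grid n ` {..2 ^ n} \<Longrightarrow> {\<omega> \<in> paths E. \<forall>t\<in>T. \<omega> t \<in> F t} \<in> cylinders E"
  unfolding cylinders_def by (rule CollectI, rule exI[of _ T], rule exI[of _ F]) blast

lemma cylindersE:
  assumes "A \<in> cylinders E"
  obtains T F n where "A = {\<omega> \<in> paths E. \<forall>t\<in>T. \<omega> t \<in> F t}" "finite T" "T \<subseteq> grid n ` {..2 ^ n}"
  using CollectD[OF assms[unfolded cylinders_def]] that by (elim exE conjE)

lemma grid_subset: "n \<le> m \<Longrightarrow> grid n ` {..2 ^ n} \<subseteq> grid m ` {..2 ^ m}"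
proof safe
  fix i :: nat assume nm: "n \<le> m" and i: "i \<le> 2 ^ n"
  have e: "(2::nat) ^ m = 2 ^ n * 2 ^ (m - n)" "(2::real) ^ m = 2 ^ n * 2 ^ (m - n)"
    using nm by (simp_all flip: power_add)
  have "grid n i = grid m (i * 2 ^ (m - n))" unfolding grid_def e by simp
  moreover have "i * 2 ^ (m - n) \<le> 2 ^ m" unfolding e using i by simp
  ultimately show "grid n i \<in> grid m ` {..2 ^ m}" by blast
qed

lemma Int_stable_cylinders: "Int_stable (cylinders E)"
proof (rule Int_stableI)
  fix A B assume AB: "A \<in> cylinders E" "B \<in> cylinders E"
  obtain T F n where A: "A = {\<omega> \<in> paths E. \<forall>t\<in>T. \<omega> t \<in> F t}" "finite T" "T \<subseteq> grid n ` {..2 ^ n}"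
    using cylindersE[OF AB(1)] .
  obtain T' F' n' where B: "B = {\<omega> \<in> paths E. \<forall>t\<in>T'. \<omega> t \<in> F' t}" "finite T'" "T' \<subseteq> grid n' ` {..2 ^ n'}"
    using cylindersE[OF AB(2)] .
  note * = A B
  let ?H = "\<lambda>t. {a. (t \<in> T \<longrightarrow> a \<in> F t) \<and> (t \<in> T' \<longrightarrow> a \<in> F' t)}"
  have "A \<inter> B = {\<omega> \<in> paths E. \<forall>t\<in>T \<union> T'. \<omega> t \<in> ?H t}" using * by auto
  moreover have "T \<union> T' \<subseteq> grid (max n n') ` {..2 ^ max n n'}"
    using order_trans[OF *(3) grid_subset[of n "max n n'"]]
      order_trans[OF *(6) grid_subset[of n' "max n n'"]] by simp
  ultimately show "A \<inter> B \<in> cylinders E"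
    using cylindersI[of "T \<union> T'" "max n n'" E ?H] *(2,5) by simp
qed

text \<open>By right-continuity, \<open>\<omega> s = a\<close> with \<open>s < 1\<close> holds iff
  the values at the next grid points are eventually \<open>a\<close>; this writes a coordinate event
  as a countable union of countable intersections of cylinders. The time 1 is itself a grid
  point.\<close>

lemma sets_path_field_cylinders:
  fixes E :: "'a::countable \<Rightarrow> 'a \<Rightarrow> bool"
  shows "sets (path_field E {0..1}) = sigma_sets (paths E) (cylinders E)"
proof (rule antisym)
  interpret S: sigma_algebra "paths E" "sigma_sets (paths E) (cylinders E)"
    by (rule sigma_algebra_sigma_sets) (auto simp: cylinders_def)
  have grd: "{\<omega> \<in> paths E. \<omega> (grid n i) = a} \<in> sigma_sets (paths E) (cylinders E)" if "i \<le> 2 ^ n" for n i a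
  proof (rule sigma_sets.Basic)
    show "{\<omega> \<in> paths E. \<omega> (grid n i) = a} \<in> cylinders E"
      using cylindersI[of "{grid n i}" n E "\<lambda>_. {a}"] that by simp
  qed
  have "{\<omega> \<in> paths E. \<omega> s = a} \<in> sigma_sets (paths E) (cylinders E)" if s: "s \<in> {0..1}" for s a
  proof (cases "s = 1")
    case True
    then show ?thesis using grd[of 1 0 a] by (simp add: grid_def)
  next
    case False
    then have s: "0 \<le> s" "s < 1" using s by auto
    define H where "H = (\<lambda>m. {\<omega> \<in> paths E. \<omega> (grid m (next_grid m s)) = a})"
    have H: "H m \<in> sigma_sets (paths E) (cylinders E)" for m
      unfolding H_def by (rule grd[OF next_grid_le[OF s]])
    have eq: "\<omega> s = a \<longleftrightarrow> (\<exists>n. \<forall>m. \<omega> \<in> H (n + m))" if \<omega>: "\<omega> \<in> paths E" for \<omega>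
    proof -
      obtain k where k: "\<And>m. m \<ge> k \<Longrightarrow> \<omega> (grid m (next_grid m s)) = \<omega> s"
        using eventually_next_grid[OF \<omega> s] by (auto simp: eventually_sequentially)
      show ?thesis
      proof
        assume "\<omega> s = a"
        then have "\<forall>m. \<omega> \<in> H (k + m)" using k \<omega> by (simp add: H_def)
        then show "\<exists>n. \<forall>m. \<omega> \<in> H (n + m)" ..
      next
        assume "\<exists>n. \<forall>m. \<omega> \<in> H (n + m)"
        then obtain n where "\<omega> \<in> H (n + k)" by blast
        then show "\<omega> s = a" using k[of "n + k"] by (simp add: H_def)
      qed
    qed
    have "{\<omega> \<in> paths E. \<omega> s = a} = (\<Union>n. \<Inter>m. H (n + m))"
    proof (rule set_eqI)
      fix \<omega>
      have "\<omega> \<notin> H m" if "\<omega> \<notin> paths E" for m using that by (simp add: H_def)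
      then show "\<omega> \<in> {\<omega> \<in> paths E. \<omega> s = a} \<longleftrightarrow> \<omega> \<in> (\<Union>n. \<Inter>m. H (n + m))"
        by (cases "\<omega> \<in> paths E") (simp_all add: eq)
    qed
    moreover have "(\<Union>n. \<Inter>m. H (n + m)) \<in> sigma_sets (paths E) (cylinders E)"
    proof (rule S.countable_UN, rule image_subsetI)
      show "(\<Inter>m. H (n + m)) \<in> sigma_sets (paths E) (cylinders E)" for n
        by (rule S.countable_INT) (auto intro: H)
    qed
    ultimately show ?thesis by (simp only:)
  qed
  then show "sets (path_field E {0..1}) \<subseteq> sigma_sets (paths E) (cylinders E)"
    unfolding sets_path_field by (intro S.sigma_sets_subset subsetI) (elim CollectE exE conjE, simp)
next
  have "A \<in> sets (path_field E {0..1})" if cyl: "A \<in> cylinders E" for A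
  proof -
    obtain T F n where A: "A = {\<omega> \<in> paths E. \<forall>t\<in>T. \<omega> t \<in> F t}" "finite T" "T \<subseteq> grid n ` {..2 ^ n}"
      using cylindersE[OF cyl] .
    have "{\<omega> \<in> space (path_field E {0..1}). \<omega> t \<in> F t} \<in> sets (path_field E {0..1})" for t
      using measurable_sets[OF measurable_coordinate_any[of t E], of "F t"]
      by (simp add: vimage_def Int_def conj_commute)
    from sets.sets_Collect_finite_All[OF this A(2)]
    show ?thesis by (simp add: A space_path_field)
  qed
  then have "cylinders E \<subseteq> sets (path_field E {0..1})" by blast
  from sets.sigma_sets_subset[OF this]
  show "sigma_sets (paths E) (cylinders E) \<subseteq> sets (path_field E {0..1})"
    by (simp add: space_path_field)
qed

section \<open>Integrals over events of finite measure\<close>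

lemma set_integrable_bounded:
  fixes f :: "'b \<Rightarrow> real"
  assumes "A \<in> sets M" "emeasure M A < \<infinity>" "f \<in> borel_measurable M"
    and "\<And>x. x \<in> A \<Longrightarrow> \<bar>f x\<bar> \<le> K"
  shows "set_integrable M A f"
  unfolding set_integrable_def
proof (rule Bochner_Integration.integrable_bound)
  show "integrable M (\<lambda>x. indicator A x * \<bar>K\<bar>)"
    using assms(1,2) by (intro integrable_mult_left) (auto simp: integrable_indicator_iff)
  show "AE x in M. norm (indicator A x *\<^sub>R f x) \<le> norm (indicat_real A x * \<bar>K\<bar>)"
    using assms(4) by (intro AE_I2) (force simp: indicator_def)
qed (use assms(1,3) in measurable)

lemma set_integrable_sum:
  fixes f :: "'i \<Rightarrow> 'b \<Rightarrow> real"
  assumes "\<And>i. i \<in> I \<Longrightarrow> set_integrable M A (f i)"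
  shows "set_integrable M A (\<lambda>x. \<Sum>i\<in>I. f i x)"
  using assms unfolding set_integrable_def scaleR_sum_right
  by (intro Bochner_Integration.integrable_sum)

lemma set_integral_abs_le:
  fixes f g :: "'b \<Rightarrow> real"
  assumes "set_integrable M A f" "set_integrable M A g" "\<And>x. x \<in> A \<Longrightarrow> \<bar>f x\<bar> \<le> g x"
  shows "\<bar>LINT x:A|M. f x\<bar> \<le> (LINT x:A|M. g x)"
proof -
  have le: "f x \<le> g x" "- g x \<le> f x" if "x \<in> A" for x using assms(3)[OF that] by auto
  have "(LINT x:A|M. f x) \<le> (LINT x:A|M. g x)"
    using assms(1,2) le by (intro set_integral_mono)
  moreover have "(LINT x:A|M. - g x) \<le> (LINT x:A|M. f x)"
    using assms(1,2) le by (intro set_integral_mono) (auto simp: set_integrable_def)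
  ultimately show ?thesis using set_integral_uminus[OF assms(2)] by simp
qed

lemma set_integral_const_finite:
  fixes c :: real
  assumes "A \<in> sets M" "emeasure M A < \<infinity>"
  shows "(LINT x:A|M. c) = c * measure M A"
  using assms by (simp add: set_lebesgue_integral_def mult.commute)

text \<open>The integral of a non-integrable function is \<open>0\<close>, so the bound covers these as well.\<close>

lemma set_integral_bound:
  fixes f :: "'b \<Rightarrow> real"
  assumes A: "A \<in> sets M" "emeasure M A < \<infinity>" and K: "\<And>x. x \<in> A \<Longrightarrow> \<bar>f x\<bar> \<le> K"
  shows "\<bar>LINT x:A|M. f x\<bar> \<le> K * measure M A"
proof (cases "set_integrable M A f")
  case True
  show ?thesis
    unfolding set_integral_const_finite[OF A, symmetric]
    by (rule set_integral_abs_le[OF True _ K])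
      (intro set_integrable_bounded[OF A, where K = "\<bar>K\<bar>"]; simp)
next
  case False
  then have 0: "(LINT x:A|M. f x) = 0"
    by (simp add: set_integrable_def set_lebesgue_integral_def not_integrable_integral_eq)
  have "0 \<le> K * measure M A"
  proof (cases "A = {}")
    case False
    then obtain x where "x \<in> A" by blast
    with K[of x] show ?thesis by simp
  qed simp
  with 0 show ?thesis by simp
qed

text \<open>This takes the place of conditioning on a variable with countably many values. Finitely
  many fibres are added up by the triangle inequality, and continuity of the integral along
  increasing sets gives the rest.\<close>

lemma set_integral_partition_le:
  fixes f g :: "'b \<Rightarrow> real" and Y :: "'b \<Rightarrow> 'c::countable"
  assumes A: "A \<in> sets M" and Y [measurable]: "Y \<in> measurable M (count_space UNIV)"
    and f: "set_integrable M A f" and g: "set_integrable M A g"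
    and le: "\<And>c. \<bar>LINT x:A \<inter> {x \<in> space M. Y x = c}|M. f x\<bar> \<le>
       (LINT x:A \<inter> {x \<in> space M. Y x = c}|M. g x)"
  shows "\<bar>LINT x:A|M. f x\<bar> \<le> (LINT x:A|M. g x)"
proof -
  define B where "B = (\<lambda>n. A \<inter> {x \<in> space M. to_nat (Y x) < n})"
  have [measurable]: "A \<in> sets M" by (rule A)
  have B [measurable]: "B n \<in> sets M" for n unfolding B_def by measurable
  have sub: "B n \<subseteq> A" for n by (auto simp: B_def)
  have int: "set_integrable M C f" "set_integrable M C g" if "C \<in> sets M" "C \<subseteq> A" for C
    using f g that set_integrable_subset by blast+
  have un: "(\<Union>n. B n) = A" using sets.sets_into_space[OF A] by (auto simp: B_def)
  have inc: "incseq B" by (rule incseq_SucI) (auto simp: B_def)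
  have ineq: "\<bar>LINT x:B n|M. f x\<bar> \<le> (LINT x:B n|M. g x)" for n
  proof (induction n)
    case 0 then show ?case by (simp add: B_def set_lebesgue_integral_def)
  next
    case (Suc n)
    let ?C = "A \<inter> {x \<in> space M. to_nat (Y x) = n}"
    have C: "?C \<in> sets M" by measurable
    have "B (Suc n) = B n \<union> ?C" "B n \<inter> ?C = {}" by (auto simp: B_def)
    then have *: "(LINT x:B (Suc n)|M. h x) = (LINT x:B n|M. h x) + (LINT x:?C|M. h x)"
      if "set_integrable M (B n) h" "set_integrable M ?C h" for h :: "'b \<Rightarrow> real"
      using that by (simp add: set_integral_Un)
    have "\<bar>LINT x:?C|M. f x\<bar> \<le> (LINT x:?C|M. g x)"
    proof (cases "\<exists>c. to_nat (c :: 'c) = n")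
      case True
      then obtain c :: 'c where "to_nat c = n" ..
      then have "?C = A \<inter> {x \<in> space M. Y x = c}" by auto
      then show ?thesis using le[of c] by simp
    next
      \<comment> \<open>Numbers outside the range of \<open>to_nat\<close> correspond to no value of
        \<open>Y\<close>, so their piece is empty.\<close>
      case False
      then have "?C = {}" by auto
      then show ?thesis by (simp add: set_lebesgue_integral_def)
    qed
    then show ?case using Suc by (subst (1 2) *) (auto intro!: int B C sub)
  qed
  have "(\<lambda>n. LINT x:B n|M. f x) \<longlonglongrightarrow> (LINT x:A|M. f x)"
    using set_integral_cont_up[of B M f] B inc f un by simp
  moreover have "(\<lambda>n. LINT x:B n|M. g x) \<longlonglongrightarrow> (LINT x:A|M. g x)"
    using set_integral_cont_up[of B M g] B inc g un by simp
  ultimately show ?thesis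
    using ineq by (intro LIMSEQ_le[OF tendsto_rabs]) auto
qed

text \<open>Since \<open>M\<close> may fail to be sigma-finite, Fubini is applied to the
  restrictions to \<open>A\<close> and to \<open>{s..t}\<close>. Both are finite, and there the
  bounded integrand is integrable.\<close>

lemma set_integral_Fubini:
  fixes f :: "'b \<Rightarrow> real \<Rightarrow> real"
  assumes A: "A \<in> sets M" "emeasure M A < \<infinity>"
    and f: "(\<lambda>p. f (fst p) (snd p)) \<in> borel_measurable (M \<Otimes>\<^sub>M borel)"
    and K: "\<And>x r. x \<in> A \<Longrightarrow> s \<le> r \<Longrightarrow> r \<le> t \<Longrightarrow> \<bar>f x r\<bar> \<le> K"
  shows "(LINT x:A|M. LINT r:{s..t}|lborel. f x r) = (LINT r:{s..t}|lborel. LINT x:A|M. f x r)"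
proof -
  let ?M = "restrict_space M A" and ?N = "restrict_space lborel {s..t}"
  have As: "A \<subseteq> space M" using A sets.sets_into_space by auto
  interpret M: finite_measure ?M
    using A As by (intro finite_measureI) (simp add: space_restrict_space Int_absorb2 emeasure_restrict_space)
  interpret N: finite_measure ?N
    by (intro finite_measureI) (cases "s \<le> t"; simp add: space_restrict_space emeasure_restrict_space)
  interpret MN: finite_measure "?M \<Otimes>\<^sub>M ?N"
    by (intro finite_measure_pair_measure M.finite_measure_axioms N.finite_measure_axioms)
  interpret P: pair_sigma_finite ?M ?N ..
  have id1: "(\<lambda>x. x) \<in> measurable ?M M" and id2: "(\<lambda>x. x) \<in> measurable ?N borel"
    by (auto intro: measurable_restrict_space1)
  have "(\<lambda>p. (fst p, snd p)) \<in> measurable (?M \<Otimes>\<^sub>M ?N) (M \<Otimes>\<^sub>M borel)"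
    by (intro measurable_Pair measurable_compose[OF measurable_fst id1]
        measurable_compose[OF measurable_snd id2])
  from measurable_compose[OF this f]
  have m: "(\<lambda>p. f (fst p) (snd p)) \<in> borel_measurable (?M \<Otimes>\<^sub>M ?N)" by simp
  have "integrable (?M \<Otimes>\<^sub>M ?N) (\<lambda>p. f (fst p) (snd p))"
    using K by (intro MN.integrable_const_bound[where B = K] AE_I2 m)
      (auto simp: space_pair_measure space_restrict_space)
  then have "integrable (?M \<Otimes>\<^sub>M ?N) (case_prod f)" by (simp add: case_prod_beta')
  from P.Fubini_integral[OF this]
  have "(\<integral>x. (\<integral>r. f x r \<partial>?N) \<partial>?M) = (\<integral>r. (\<integral>x. f x r \<partial>?M) \<partial>?N)" by simp
  then show ?thesis using A As
    by (simp add: integral_restrict_space set_lebesgue_integral_def Int_absorb2)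
qed

section \<open>Short-time estimates from the martingale problem\<close>

text \<open>All properties listed here pass from \<open>J\<close> to the slowed kernels with the
  same \<open>C\<close> (\<open>jump_kernel_slowed\<close>). Constants built from \<open>C\<close>
  alone are thus uniform in \<open>k\<close>.\<close>

locale jump_kernel =
  fixes E :: "'a::countable \<Rightarrow> 'a \<Rightarrow> bool" and J :: "real \<Rightarrow> 'a \<Rightarrow> 'a \<Rightarrow> real" and C :: real
  assumes finite_nbrs: "finite {b. E a b}"
    and kernel_measurable: "set_borel_measurable borel {0..1} (\<lambda>t. J t a b)"
    and kernel_nonneg: "t \<in> {0..1} \<Longrightarrow> E a b \<Longrightarrow> 0 \<le> J t a b"
    and rate_le: "t \<in> {0..1} \<Longrightarrow> total_rate E J t a \<le> C"
begin

lemma rate_nonneg: "t \<in> {0..1} \<Longrightarrow> 0 \<le> total_rate E J t a"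
  unfolding total_rate_def by (intro sum_nonneg) (auto intro: kernel_nonneg)

lemma C_nonneg: "0 \<le> C"
  using order_trans[OF rate_nonneg[of 0 undefined] rate_le[of 0 undefined]] by simp

lemma kernel_le: "t \<in> {0..1} \<Longrightarrow> E a b \<Longrightarrow> J t a b \<le> C"
proof -
  assume t: "t \<in> {0..1}" and "E a b"
  then have "J t a b \<le> total_rate E J t a"
    unfolding total_rate_def by (intro member_le_sum finite_nbrs) (auto intro: kernel_nonneg)
  with rate_le[OF t, of a] show ?thesis by simp
qed

lemma generator_bound:
  assumes t: "t \<in> {0..1}" and u: "\<And>b. \<bar>u b\<bar> \<le> B"
  shows "\<bar>generator E J t u a\<bar> \<le> 2 * B * C"
proof -
  have B: "0 \<le> B" using u[of a] by simp
  have "\<bar>generator E J t u a\<bar> \<le> (\<Sum>b\<in>{b. E a b}. \<bar>J t a b * (u b - u a)\<bar>)"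
    unfolding generator_def by (rule sum_abs)
  also have "\<dots> \<le> (\<Sum>b\<in>{b. E a b}. J t a b * (2 * B))"
  proof (rule sum_mono)
    fix b assume "b \<in> {b. E a b}"
    then have "0 \<le> J t a b" using kernel_nonneg t by simp
    then show "\<bar>J t a b * (u b - u a)\<bar> \<le> J t a b * (2 * B)"
      using u[of a] u[of b] by (auto simp: abs_mult intro!: mult_left_mono)
  qed
  also have "\<dots> = total_rate E J t a * (2 * B)"
    by (simp add: total_rate_def sum_distrib_right)
  also have "\<dots> \<le> C * (2 * B)" using rate_le[OF t] B by (intro mult_right_mono) auto
  finally show ?thesis by (simp add: mult_ac)
qed

lemma kernel_measurable_on:
  assumes "0 \<le> s" "t \<le> 1"
  shows "(\<lambda>r. indicator {s..t} r * J r a b) \<in> borel_measurable borel"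
proof -
  have "(\<lambda>r. indicat_real {0..1} r * J r a b) \<in> borel_measurable borel"
    using kernel_measurable[of a b] by (simp add: set_borel_measurable_def)
  then have "(\<lambda>r. indicat_real {s..t} r * (indicator {0..1} r * J r a b)) \<in> borel_measurable borel"
    by measurable
  also have "(\<lambda>r. indicat_real {s..t} r * (indicator {0..1} r * J r a b)) =
      (\<lambda>r. indicator {s..t} r * J r a b)"
    using assms by (auto simp: indicator_def)
  finally show ?thesis .
qed

lemma kernel_integrable:
  assumes "0 \<le> s" "t \<le> 1" "E a b"
  shows "set_integrable lborel {s..t} (\<lambda>r. J r a b)"
proof -
  have "set_integrable lborel {s..t} (\<lambda>r. indicator {s..t} r * J r a b)"
    using kernel_measurable_on[OF assms(1,2)] assms
    by (intro set_integrable_bounded[where K = C])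
      (auto simp: emeasure_lborel_Icc_eq kernel_nonneg kernel_le abs_le_iff intro!: order_trans[OF _ C_nonneg])
  then show ?thesis
    by (subst set_integrable_cong[OF refl, where f' = "\<lambda>r. indicator {s..t} r * J r a b"]) auto
qed

lemma rate_integrable:
  assumes "0 \<le> s" "t \<le> 1"
  shows "set_integrable lborel {s..t} (\<lambda>r. total_rate E J r a)"
  unfolding total_rate_def using assms
  by (intro set_integrable_sum) (auto intro: kernel_integrable)

lemma generator_integrable:
  assumes "0 \<le> s" "t \<le> 1"
  shows "set_integrable lborel {s..t} (\<lambda>r. generator E J r u a)"
  unfolding generator_def using assms
  by (intro set_integrable_sum set_integrable_mult_left) (auto intro: kernel_integrable)

lemma generator_measurable:
  "(\<lambda>r. indicator {0..1} r * generator E J r u a) \<in> borel_measurable borel"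
  unfolding generator_def sum_distrib_left mult.assoc[symmetric]
  by (intro borel_measurable_sum borel_measurable_times kernel_measurable_on borel_measurable_const) auto

lemma rate_measurable:
  "(\<lambda>r. indicator {0..1} r * total_rate E J r a) \<in> borel_measurable borel"
  unfolding total_rate_def sum_distrib_left
  by (intro borel_measurable_sum kernel_measurable_on) auto

lemma rate_integral_eq:
  assumes "0 \<le> s" "t \<le> 1"
  shows "(LINT r:{s..t}|lborel. total_rate E J r a) = (\<Sum>b\<in>{b. E a b}. LINT r:{s..t}|lborel. J r a b)"
  unfolding set_lebesgue_integral_def total_rate_def scaleR_sum_right
  by (intro Bochner_Integration.integral_sum)
    (use kernel_integrable[OF assms] in \<open>auto simp: set_integrable_def\<close>)

lemma kernel_integral_nonneg:
  assumes "0 \<le> s" "t \<le> 1" "E a b"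
  shows "0 \<le> (LINT r:{s..t}|lborel. J r a b)"
  unfolding set_lebesgue_integral_def
  by (intro Bochner_Integration.integral_nonneg) (use assms in \<open>auto simp: indicator_def intro!: kernel_nonneg\<close>)

lemma rate_integral_bounds:
  assumes "0 \<le> s" "s \<le> t" "t \<le> 1"
  shows "0 \<le> (LINT r:{s..t}|lborel. total_rate E J r a)"
    and "(LINT r:{s..t}|lborel. total_rate E J r a) \<le> C * (t - s)"
proof -
  show "0 \<le> (LINT r:{s..t}|lborel. total_rate E J r a)"
    unfolding rate_integral_eq[OF assms(1,3)] using assms by (intro sum_nonneg kernel_integral_nonneg) auto
  have "\<bar>LINT r:{s..t}|lborel. total_rate E J r a\<bar> \<le> C * measure lborel {s..t}"
    using assms rate_nonneg rate_le by (intro set_integral_bound) (auto simp: emeasure_lborel_Icc_eq)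
  then show "(LINT r:{s..t}|lborel. total_rate E J r a) \<le> C * (t - s)" using assms by simp
qed

lemma generator_eq:
  "generator E J r u a = (\<Sum>b\<in>{b. E a b}. J r a b * u b) - total_rate E J r a * u a"
  by (simp add: generator_def total_rate_def algebra_simps sum_subtractf sum_distrib_left)

text \<open>First-order prediction for the mean of \<open>u (\<omega> s) (\<omega> t)\<close> given
  \<open>\<omega> s = a\<close>: the generator formula with the path frozen at \<open>a\<close>
  during \<open>{s..t}\<close>.\<close>

definition mean_step :: "real \<Rightarrow> real \<Rightarrow> ('a \<Rightarrow> 'a \<Rightarrow> real) \<Rightarrow> 'a \<Rightarrow> real" where
  "mean_step s t u a = u a a + (LINT r:{s..t}|lborel. generator E J r (u a) a)"

text \<open>Separates the contribution of staying from those of the jumps. In this form the means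
  for two kernels can be compared term by term, as in \<open>mean_step_defect\<close>.\<close>

lemma mean_step_eq:
  assumes "0 \<le> s" "t \<le> 1"
  shows "mean_step s t u a = u a a * (1 - (LINT r:{s..t}|lborel. total_rate E J r a)) +
    (\<Sum>b\<in>{b. E a b}. (LINT r:{s..t}|lborel. J r a b) * u a b)"
proof -
  have i: "set_integrable lborel {s..t} (\<lambda>r. J r a b * u a b)" if "E a b" for b
    using kernel_integrable[OF assms that] by (intro set_integrable_mult_left)
  have "(LINT r:{s..t}|lborel. generator E J r (u a) a) =
      (LINT r:{s..t}|lborel. \<Sum>b\<in>{b. E a b}. J r a b * u a b) -
      (LINT r:{s..t}|lborel. total_rate E J r a * u a a)"
    unfolding generator_eq
    by (intro set_integral_diff set_integrable_sum set_integrable_mult_left[OF rate_integrable] assms)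
      (simp add: i)
  also have "(LINT r:{s..t}|lborel. \<Sum>b\<in>{b. E a b}. J r a b * u a b) =
      (\<Sum>b\<in>{b. E a b}. LINT r:{s..t}|lborel. J r a b * u a b)"
    unfolding set_lebesgue_integral_def scaleR_sum_right
    by (intro Bochner_Integration.integral_sum) (use i in \<open>auto simp: set_integrable_def\<close>)
  finally show ?thesis unfolding mean_step_def by (simp add: algebra_simps)
qed

lemma mean_step_bound:
  assumes st: "0 \<le> s" "s \<le> t" "t \<le> 1" and u: "\<And>b. \<bar>u a b\<bar> \<le> B"
  shows "\<bar>mean_step s t u a\<bar> \<le> B * (1 + 2 * C * (t - s))"
proof -
  have "\<bar>LINT r:{s..t}|lborel. generator E J r (u a) a\<bar> \<le> (2 * B * C) * measure lborel {s..t}"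
    using st by (intro set_integral_bound generator_bound u) (auto simp: emeasure_lborel_Icc_eq)
  then show ?thesis using u[of a] st unfolding mean_step_def by (simp add: algebra_simps)
qed

end

section \<open>Processes solving the martingale problem: one-step expansion\<close>

locale jump_process = jump_kernel E J C
  for E :: "'a::countable \<Rightarrow> 'a \<Rightarrow> bool" and J C +
  fixes Q :: "(real \<Rightarrow> 'a) measure"
  assumes sets_Q: "sets Q = sets (path_field E {0..1})" and gen: "has_generator E J Q"
begin

lemma space_Q: "space Q = paths E"
  using sets_eq_imp_space_eq[OF sets_Q] by (simp add: space_path_field)

lemma measurable_X [measurable]: "(\<lambda>\<omega>. \<omega> r) \<in> measurable Q (count_space UNIV)"
  using measurable_coordinate_any[of r E] by (simp add: measurable_cong_sets[OF sets_Q refl])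

lemma past_sets: "A \<in> sets (path_field E {0..s}) \<Longrightarrow> s \<le> 1 \<Longrightarrow> A \<in> sets Q"
  unfolding sets_Q using sets_path_field_mono[of "{0..s}" "{0..1}" E] by auto

lemma past_Int:
  assumes "A \<in> sets (path_field E {0..s})" "0 \<le> r" "r \<le> s" "s \<le> t"
  shows "A \<inter> {\<omega> \<in> space Q. \<omega> r = a} \<in> sets (path_field E {0..t})"
  using assms sets_path_field_mono[of "{0..s}" "{0..t}" E] path_field_coordinate[of r "{0..t}" E a]
  by (auto simp: space_Q)

text \<open>For each fixed state the integrand is measurable in time; countability of the states and
  joint measurability of the path allow the state to be replaced by
  \<open>\<omega> r\<close>.\<close>

lemma measurable_along_path:
  fixes g :: "real \<Rightarrow> 'a \<Rightarrow> real"
  assumes "\<And>a. (\<lambda>r. indicator {0..1} r * g r a) \<in> borel_measurable borel"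
  shows "(\<lambda>p. indicator {0..1} (snd p) * g (snd p) (fst p (snd p)))
     \<in> borel_measurable (Q \<Otimes>\<^sub>M (borel :: real measure))"
proof -
  have X: "(\<lambda>p. fst p (snd p)) \<in> measurable (Q \<Otimes>\<^sub>M (borel :: real measure)) (count_space UNIV)"
    using measurable_joint[of E]
    by (subst measurable_cong_sets[OF sets_pair_measure_cong[OF sets_Q refl] refl])
  have "(\<lambda>p. indicator {0..1} (snd p) * g (snd p) a)
      \<in> borel_measurable (Q \<Otimes>\<^sub>M (borel :: real measure))" for a
    by (rule measurable_compose[OF measurable_snd assms])
  from measurable_compose_countable[OF this X] show ?thesis by simp
qed

lemma integrable_along_path:
  fixes g :: "real \<Rightarrow> 'a \<Rightarrow> real"
  assumes g: "\<And>a. (\<lambda>r. indicator {0..1} r * g r a) \<in> borel_measurable borel"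
    and \<omega>: "\<omega> \<in> space Q" and st: "0 \<le> s" "t \<le> 1"
    and K: "\<And>r a. r \<in> {0..1} \<Longrightarrow> \<bar>g r a\<bar> \<le> K"
  shows "set_integrable lborel {s..t} (\<lambda>r. g r (\<omega> r))"
proof -
  have "(\<lambda>r. indicator {0..1} r * g r (\<omega> r)) \<in> borel_measurable borel"
    using measurable_compose[OF measurable_Pair1'[OF \<omega>] measurable_along_path[OF g]] by simp
  then have "set_integrable lborel {s..t} (\<lambda>r. indicator {0..1} r * g r (\<omega> r))"
    using st K by (intro set_integrable_bounded[where K = K]) (auto simp: emeasure_lborel_Icc_eq)
  then show ?thesis using st
    by (subst set_integrable_cong[OF refl, where f' = "\<lambda>r. indicator {0..1} r * g r (\<omega> r)"])
      auto
qed

lemma measurable_integral_along_path: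
  fixes g :: "real \<Rightarrow> 'a \<Rightarrow> real"
  assumes g: "\<And>a. (\<lambda>r. indicator {0..1} r * g r a) \<in> borel_measurable borel"
    and st: "0 \<le> s" "t \<le> 1"
  shows "(\<lambda>\<omega>. LINT r:{s..t}|lborel. g r (\<omega> r)) \<in> borel_measurable Q"
proof -
  have "(\<lambda>p. indicat_real {s..t} (snd p) * (indicator {0..1} (snd p) * g (snd p) (fst p (snd p))))
     \<in> borel_measurable (Q \<Otimes>\<^sub>M lborel)"
    using measurable_along_path[OF g] by measurable
  then have "(\<lambda>\<omega>. LINT r|lborel. indicat_real {s..t} r * (indicator {0..1} r * g r (\<omega> r)))
     \<in> borel_measurable Q"
    by (intro lborel.borel_measurable_lebesgue_integral) (simp add: case_prod_beta')
  also have "(\<lambda>\<omega>. LINT r|lborel. indicat_real {s..t} r * (indicator {0..1} r * g r (\<omega> r))) =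
    (\<lambda>\<omega>. LINT r:{s..t}|lborel. g r (\<omega> r))"
    unfolding set_lebesgue_integral_def using st
    by (intro ext Bochner_Integration.integral_cong) (auto simp: indicator_def)
  finally show ?thesis .
qed

lemmas measurable_generator =
  measurable_along_path[where g = "\<lambda>r. generator E J r u" for u, OF generator_measurable]
lemmas measurable_generator_integral =
  measurable_integral_along_path[where g = "\<lambda>r. generator E J r u" for u, OF generator_measurable]

lemma generator_path_integrable:
  assumes "\<omega> \<in> space Q" "0 \<le> s" "t \<le> 1" "\<And>b. \<bar>u b\<bar> \<le> B"
  shows "set_integrable lborel {s..t} (\<lambda>r. generator E J r u (\<omega> r))"
  by (rule integrable_along_path[where g = "\<lambda>r. generator E J r u" and K = "2 * B * C",
      OF generator_measurable assms(1-3)]) (rule generator_bound[OF _ assms(4)])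

lemma generator_formula:
  assumes "A \<in> sets (path_field E {0..s})" "emeasure Q A < \<infinity>"
    "0 \<le> s" "s \<le> t" "t \<le> 1" "\<And>b. \<bar>u b\<bar> \<le> B"
  shows "(LINT \<omega>:A|Q. u (\<omega> t) - u (\<omega> s)) =
    (LINT \<omega>:A|Q. (LINT r:{s..t}|lborel. generator E J r u (\<omega> r)))"
proof -
  have "bounded (range u)" using assms(6) by (auto simp: bounded_iff)
  then show ?thesis using gen assms unfolding has_generator_def by blast
qed

lemma integral_indicator_X:
  assumes "A \<in> sets Q" "emeasure Q A < \<infinity>"
  shows "(LINT \<omega>:A|Q. indicator S (\<omega> t)) = measure Q (A \<inter> {\<omega> \<in> space Q. \<omega> t \<in> S})"
proof -
  have "(LINT \<omega>:A|Q. indicator S (\<omega> t)) = (LINT \<omega>|Q. indicator (A \<inter> {\<omega> \<in> space Q. \<omega> t \<in> S}) \<omega>)"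
    unfolding set_lebesgue_integral_def using sets.sets_into_space[OF assms(1)]
    by (intro Bochner_Integration.integral_cong) (auto simp: indicator_def)
  also have "\<dots> = measure Q (A \<inter> {\<omega> \<in> space Q. \<omega> t \<in> S})"
    by (auto simp: Int_absorb2 intro!: arg_cong[where f = "measure Q"])
  finally show ?thesis .
qed

text \<open>This is the martingale identity for the indicator of the complement of \<open>a\<close>,
  which vanishes at time \<open>s\<close> on \<open>A\<close> and whose generator is at most
  \<open>2 * C\<close> in absolute value.\<close>

lemma leave_bound:
  assumes A: "A \<in> sets (path_field E {0..s})" "emeasure Q A < \<infinity>" "\<And>\<omega>. \<omega> \<in> A \<Longrightarrow> \<omega> s = a"
    and st: "0 \<le> s" "s \<le> t" "t \<le> 1"
  shows "measure Q (A \<inter> {\<omega> \<in> space Q. \<omega> t \<noteq> a}) \<le> 2 * C * (t - s) * measure Q A"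
proof -
  let ?u = "indicat_real (- {a})"
  have AQ: "A \<in> sets Q" using past_sets A st by simp
  have u: "\<bar>?u b\<bar> \<le> 1" for b by (simp add: indicator_def)
  have in01: "r \<in> {0..1}" if "r \<in> {s..t}" for r using that st by simp
  have "measure Q (A \<inter> {\<omega> \<in> space Q. \<omega> t \<noteq> a}) = (LINT \<omega>:A|Q. ?u (\<omega> t))"
    using integral_indicator_X[OF AQ A(2), of "- {a}" t] by simp
  also have "\<dots> = (LINT \<omega>:A|Q. ?u (\<omega> t) - ?u (\<omega> s))"
    using A(3) AQ by (intro set_lebesgue_integral_cong) auto
  also have "\<dots> = (LINT \<omega>:A|Q. (LINT r:{s..t}|lborel. generator E J r ?u (\<omega> r)))"
    by (rule generator_formula[OF A(1,2) st u])
  also have "\<dots> \<le> \<bar>\<dots>\<bar>" by simp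
  also have "\<dots> \<le> ((2 * 1 * C) * measure lborel {s..t}) * measure Q A"
  proof (rule set_integral_bound[OF AQ A(2)])
    fix \<omega> :: "real \<Rightarrow> 'a"
    show "\<bar>LINT r:{s..t}|lborel. generator E J r ?u (\<omega> r)\<bar> \<le> 2 * 1 * C * measure lborel {s..t}"
      using u by (intro set_integral_bound generator_bound in01) (auto simp: emeasure_lborel_Icc_eq)
  qed
  finally show ?thesis using st by simp
qed

text \<open>Freezing the path at \<open>a\<close> in the generator changes the integrand only where
  \<open>\<omega> r \<noteq> a\<close>, and there by at most \<open>4 * B * C\<close>. By
  \<open>leave_bound\<close> that event carries a fraction of the mass of order
  \<open>t - s\<close>; integrating over \<open>{s..t}\<close> gives the second power.\<close>

lemma one_step_fixed:
  assumes A: "A \<in> sets (path_field E {0..s})" "emeasure Q A < \<infinity>" "\<And>\<omega>. \<omega> \<in> A \<Longrightarrow> \<omega> s = a"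
    and st: "0 \<le> s" "s \<le> t" "t \<le> 1" and u: "\<And>b. \<bar>u b\<bar> \<le> B"
  shows "\<bar>LINT \<omega>:A|Q. u (\<omega> t) - (u a + (LINT r:{s..t}|lborel. generator E J r u a))\<bar>
    \<le> 8 * B * C\<^sup>2 * (t - s)\<^sup>2 * measure Q A"
proof -
  define c where "c = (LINT r:{s..t}|lborel. generator E J r u a)"
  \<comment> \<open>The indicators make \<open>D\<close> measurable on the whole time axis, as
    Fubini demands, while the kernel is known to be measurable only on \<open>[0,1]\<close>.\<close>
  define D where "D = (\<lambda>(\<omega> :: real \<Rightarrow> 'a) r. indicator {0..1} r * generator E J r u (\<omega> r) - indicator {0..1} r * generator E J r u a)"
  have B: "0 \<le> B" using u[of a] by simp
  have AQ: "A \<in> sets Q" using past_sets A st by simp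
  have sp: "\<omega> \<in> space Q" if "\<omega> \<in> A" for \<omega> using sets.sets_into_space[OF AQ] that by blast
  have in01: "r \<in> {0..1}" if "r \<in> {s..t}" for r using that st by simp
  have gb: "\<bar>generator E J r u b\<bar> \<le> 2 * B * C" if "r \<in> {0..1}" for r b
    by (rule generator_bound[OF that u])
  have uX: "(\<lambda>\<omega>. u (\<omega> r)) \<in> borel_measurable Q" for r by measurable
  have I: "set_integrable Q A (\<lambda>\<omega>. u (\<omega> t) - u (\<omega> s))"
    by (intro set_integral_diff set_integrable_bounded[where K = B] AQ A uX u)
  have I2: "set_integrable Q A (\<lambda>\<omega>. LINT r:{s..t}|lborel. generator E J r u (\<omega> r))"
    using st by (intro set_integrable_bounded[where K = "2 * B * C * measure lborel {s..t}"] AQ A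
      measurable_generator_integral set_integral_bound generator_bound u in01)
      (auto simp: emeasure_lborel_Icc_eq)
  have Ic: "set_integrable Q A (\<lambda>\<omega>. c)"
    by (intro set_integrable_bounded[where K = "\<bar>c\<bar>"] AQ A) auto
  have "(LINT \<omega>:A|Q. u (\<omega> t) - (u a + c)) = (LINT \<omega>:A|Q. (u (\<omega> t) - u (\<omega> s)) - c)"
    using A(3) AQ by (intro set_lebesgue_integral_cong) auto
  also have "\<dots> = (LINT \<omega>:A|Q. u (\<omega> t) - u (\<omega> s)) - (LINT \<omega>:A|Q. c)"
    using I Ic by simp
  also have "(LINT \<omega>:A|Q. u (\<omega> t) - u (\<omega> s)) =
      (LINT \<omega>:A|Q. LINT r:{s..t}|lborel. generator E J r u (\<omega> r))"
    by (rule generator_formula[OF A(1,2) st u])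
  also have "\<dots> - (LINT \<omega>:A|Q. c) = (LINT \<omega>:A|Q. (LINT r:{s..t}|lborel. generator E J r u (\<omega> r)) - c)"
    using I2 Ic by simp
  also have "\<dots> = (LINT \<omega>:A|Q. LINT r:{s..t}|lborel. D \<omega> r)"
  proof (intro set_lebesgue_integral_cong AQ allI impI)
    fix \<omega> assume "\<omega> \<in> A"
    have "(LINT r:{s..t}|lborel. generator E J r u (\<omega> r)) - c =
       (LINT r:{s..t}|lborel. generator E J r u (\<omega> r) - generator E J r u a)"
      unfolding c_def using st sp[OF \<open>\<omega> \<in> A\<close>] u
      by (intro set_integral_diff(2)[symmetric] generator_integrable generator_path_integrable) auto
    also have "\<dots> = (LINT r:{s..t}|lborel. D \<omega> r)"
      using st by (intro set_lebesgue_integral_cong) (auto simp: D_def)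
    finally show "(LINT r:{s..t}|lborel. generator E J r u (\<omega> r)) - c = (LINT r:{s..t}|lborel. D \<omega> r)" .
  qed
  also have "\<dots> = (LINT r:{s..t}|lborel. LINT \<omega>:A|Q. D \<omega> r)"
  proof (rule set_integral_Fubini[OF AQ A(2)])
    from measurable_compose[OF measurable_snd generator_measurable[where u = u and a = a]]
    show "(\<lambda>p. D (fst p) (snd p)) \<in> borel_measurable (Q \<Otimes>\<^sub>M borel)"
      unfolding D_def using measurable_generator[where u = u] by measurable
    show "\<bar>D \<omega> r\<bar> \<le> 4 * B * C" if "s \<le> r" "r \<le> t" for \<omega> r
      using gb[OF in01[of r], of "\<omega> r"] gb[OF in01[of r], of a] that st
      by (simp add: D_def)
  qed
  also have "\<bar>\<dots>\<bar> \<le> (4 * B * C * (2 * C * (t - s) * measure Q A)) * measure lborel {s..t}"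
  proof (rule set_integral_bound)
    fix r assume r: "r \<in> {s..t}"
    \<comment> \<open>The integrand vanishes when \<open>\<omega> r = a\<close>; otherwise both
      generators contribute at most \<open>2 * B * C\<close>.\<close>
    have Dr: "\<bar>D \<omega> r\<bar> \<le> 4 * B * C * indicator (- {a}) (\<omega> r)" for \<omega>
      using gb[OF in01[OF r], of "\<omega> r"] gb[OF in01[OF r], of a] in01[OF r]
      by (cases "\<omega> r = a") (auto simp: D_def)
    have "(\<lambda>\<omega>. generator E J r u (\<omega> r)) \<in> borel_measurable Q" by measurable
    then have "(\<lambda>\<omega>. D \<omega> r) \<in> borel_measurable Q" unfolding D_def by measurable
    moreover have "\<bar>D \<omega> r\<bar> \<le> 4 * B * C" for \<omega>
      using order_trans[OF Dr] B C_nonneg by (auto simp: indicator_def)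
    ultimately have "\<bar>LINT \<omega>:A|Q. D \<omega> r\<bar> \<le> (LINT \<omega>:A|Q. 4 * B * C * indicator (- {a}) (\<omega> r))"
      using B C_nonneg
      by (intro set_integral_abs_le set_integrable_bounded[where K = "4 * B * C"] AQ A Dr)
        (auto simp: indicator_def)
    also have "\<dots> = 4 * B * C * measure Q (A \<inter> {\<omega> \<in> space Q. \<omega> r \<noteq> a})"
      using integral_indicator_X[OF AQ A(2), of "- {a}" r] by simp
    also have "\<dots> \<le> 4 * B * C * (2 * C * (t - s) * measure Q A)"
    proof (rule mult_left_mono)
      have "measure Q (A \<inter> {\<omega> \<in> space Q. \<omega> r \<noteq> a}) \<le> 2 * C * (r - s) * measure Q A"
        using r st by (intro leave_bound A) auto
      also have "\<dots> \<le> 2 * C * (t - s) * measure Q A"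
        using r C_nonneg by (intro mult_right_mono mult_left_mono) auto
      finally show "measure Q (A \<inter> {\<omega> \<in> space Q. \<omega> r \<noteq> a}) \<le> 2 * C * (t - s) * measure Q A" .
    qed (use B C_nonneg in auto)
    finally show "\<bar>LINT \<omega>:A|Q. D \<omega> r\<bar> \<le> 4 * B * C * (2 * C * (t - s) * measure Q A)" .
  qed (auto simp: emeasure_lborel_Icc_eq)
  finally show ?thesis using st unfolding c_def by (simp add: power2_eq_square mult_ac)
qed

text \<open>Splitting \<open>A\<close> by the state at time \<open>s\<close> reduces to
  \<open>one_step_fixed\<close>, whose error is proportional to the mass and therefore adds
  up.\<close>

lemma one_step:
  assumes A: "A \<in> sets (path_field E {0..s})" "emeasure Q A < \<infinity>"
    and st: "0 \<le> s" "s \<le> t" "t \<le> 1" and u: "\<And>a b. \<bar>u a b\<bar> \<le> B"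
  shows "\<bar>LINT \<omega>:A|Q. u (\<omega> s) (\<omega> t) - mean_step s t u (\<omega> s)\<bar>
    \<le> 8 * B * C\<^sup>2 * (t - s)\<^sup>2 * measure Q A"
proof -
  have AQ: "A \<in> sets Q" using past_sets A st by simp
  have B: "0 \<le> B" using u[of undefined undefined] by simp
  let ?K = "8 * B * C\<^sup>2 * (t - s)\<^sup>2"
  have "\<bar>LINT \<omega>:A|Q. u (\<omega> s) (\<omega> t) - mean_step s t u (\<omega> s)\<bar> \<le> (LINT \<omega>:A|Q. ?K)"
  proof (rule set_integral_partition_le[OF AQ measurable_X[of s]])
    have m: "(\<lambda>\<omega>. u (\<omega> s) (\<omega> t)) \<in> borel_measurable Q"
      by (rule measurable_compose_countable[OF _ measurable_X[of s]]) measurable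
    have m2: "(\<lambda>\<omega>. mean_step s t u (\<omega> s)) \<in> borel_measurable Q" by measurable
    show "set_integrable Q A (\<lambda>\<omega>. u (\<omega> s) (\<omega> t) - mean_step s t u (\<omega> s))"
    proof (rule set_integral_diff)
      show "set_integrable Q A (\<lambda>\<omega>. u (\<omega> s) (\<omega> t))"
        by (rule set_integrable_bounded[OF AQ A(2) m u])
      show "set_integrable Q A (\<lambda>\<omega>. mean_step s t u (\<omega> s))"
        by (rule set_integrable_bounded[OF AQ A(2) m2 mean_step_bound[OF st u]])
    qed
    show "set_integrable Q A (\<lambda>\<omega>. ?K)"
      by (intro set_integrable_bounded[where K = "\<bar>?K\<bar>"] AQ A) auto
    fix c
    let ?A = "A \<inter> {\<omega> \<in> space Q. \<omega> s = c}"
    have Ac: "?A \<in> sets (path_field E {0..s})" using past_Int[OF A(1), of s s c] st by simp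
    have Acf: "emeasure Q ?A < \<infinity>"
      using emeasure_mono[of ?A A Q] AQ A(2) by (auto simp: less_top[symmetric] top_unique)
    have AcQ: "?A \<in> sets Q" using past_sets Ac st by simp
    have "(LINT \<omega>:?A|Q. u (\<omega> s) (\<omega> t) - mean_step s t u (\<omega> s)) =
      (LINT \<omega>:?A|Q. u c (\<omega> t) - (u c c + (LINT r:{s..t}|lborel. generator E J r (u c) c)))"
      using AcQ by (intro set_lebesgue_integral_cong) (auto simp: mean_step_def)
    also have "\<bar>\<dots>\<bar> \<le> ?K * measure Q ?A"
      using Ac Acf st u by (intro one_step_fixed) auto
    also have "\<dots> = (LINT \<omega>:?A|Q. ?K)" using set_integral_const_finite[OF AcQ Acf] by simp
    finally show "\<bar>LINT \<omega>:?A|Q. u (\<omega> s) (\<omega> t) - mean_step s t u (\<omega> s)\<bar> \<le> (LINT \<omega>:?A|Q. ?K)" .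
  qed
  also have "\<dots> = ?K * measure Q A" by (rule set_integral_const_finite[OF AQ A(2)])
  finally show ?thesis .
qed

end

section \<open>Telescoping products of weights along the grid\<close>

context jump_process
begin

lemma measurable_X2:
  fixes f :: "'a \<Rightarrow> 'a \<Rightarrow> real"
  shows "(\<lambda>\<omega>. f (\<omega> r) (\<omega> s)) \<in> borel_measurable Q"
  by (rule measurable_compose_countable[OF _ measurable_X[of r]]) measurable

text \<open>\<open>U i a\<close> stands for the mean of the remaining product of weights given state
  \<open>a\<close> at grid time \<open>i\<close>. Each step adds the defect \<open>\<eta>\<close> of
  the recursion and the error of \<open>one_step\<close>, and carrying the errors of later steps
  through a weight costs a factor \<open>\<beta>\<close>; hence
  \<open>real k * \<beta> ^ k\<close>.\<close>

lemma grid_expansion: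
  fixes w :: "nat \<Rightarrow> 'a \<Rightarrow> 'a \<Rightarrow> real" and U :: "nat \<Rightarrow> 'a \<Rightarrow> real"
  assumes w: "\<And>i a b. i < 2 ^ n \<Longrightarrow> \<bar>w i a b\<bar> \<le> \<beta>" and \<beta>: "1 \<le> \<beta>"
    and U: "\<And>i a. \<bar>U i a\<bar> \<le> B" and U1: "\<And>a. U (2 ^ n) a = 1"
    and defect: "\<And>i a. i < 2 ^ n \<Longrightarrow>
      \<bar>mean_step (grid n i) (grid n (Suc i)) (\<lambda>a b. w i a b * U (Suc i) b) a - U i a\<bar> \<le> \<eta>"
    and "i + k = 2 ^ n" "A \<in> sets (path_field E {0..grid n i})" "emeasure Q A < \<infinity>"
  shows "\<bar>LINT \<omega>:A|Q. (\<Prod>j=i..<2^n. w j (\<omega> (grid n j)) (\<omega> (grid n (Suc j)))) - U i (\<omega> (grid n i))\<bar>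
    \<le> real k * \<beta> ^ k * (\<eta> + 8 * (\<beta> * B) * C\<^sup>2 * (1 / 2 ^ n)\<^sup>2) * measure Q A"
  using assms(6-8)
proof (induction k arbitrary: i A)
  case 0
  then show ?case by (simp add: U1 set_lebesgue_integral_def)
next
  case (Suc k)
  define X where "X = \<eta> + 8 * (\<beta> * B) * C\<^sup>2 * (1 / 2 ^ n)\<^sup>2"
  define P where "P = (\<lambda>i \<omega>. \<Prod>j=i..<2^n. w j (\<omega> (grid n j)) (\<omega> (grid n (Suc j))))"
  let ?s = "grid n i" and ?t = "grid n (Suc i)"
  let ?T = "mean_step ?s ?t (\<lambda>a b. w i a b * U (Suc i) b)"
  have i: "i < 2 ^ n" "Suc i + k = 2 ^ n" using Suc.prems(1) by auto
  have st: "0 \<le> ?s" "?s \<le> ?t" "?t \<le> 1"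
    using grid_bounds[of i n] grid_bounds[of "Suc i" n] grid_mono[of i "Suc i" n] i by auto
  have B: "0 \<le> B" using U[of 0 undefined] by simp
  have \<eta>: "0 \<le> \<eta>" using defect[OF i(1), of undefined] by simp
  have X: "0 \<le> X" unfolding X_def using \<eta> \<beta> B by simp
  note A = Suc.prems(2,3)
  have AQ: "A \<in> sets Q" using past_sets A st by simp
  have Pm [measurable]: "P j \<in> borel_measurable Q" for j
    unfolding P_def by (intro borel_measurable_prod measurable_X2)
  have Pb: "\<bar>P j \<omega>\<bar> \<le> \<beta> ^ (2 ^ n - j)" for j \<omega>
  proof -
    have "\<bar>P j \<omega>\<bar> \<le> (\<Prod>j=j..<2^n. \<beta>)"
      unfolding P_def abs_prod by (intro prod_mono) (simp add: w)
    then show ?thesis by simp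
  qed
  have wU: "\<bar>w i a b * U (Suc i) b\<bar> \<le> \<beta> * B" for a b
    unfolding abs_mult using w[OF i(1)] U \<beta> by (intro mult_mono) auto
  \<comment> \<open>The difference at index \<open>i\<close> splits into three: the later error
    times the current weight, the error of the one-step mean, and the defect of the recursion for
    \<open>U\<close>.\<close>
  let ?f1 = "\<lambda>\<omega>. w i (\<omega> ?s) (\<omega> ?t) * (P (Suc i) \<omega> - U (Suc i) (\<omega> ?t))"
  let ?f2 = "\<lambda>\<omega>. w i (\<omega> ?s) (\<omega> ?t) * U (Suc i) (\<omega> ?t) - ?T (\<omega> ?s)"
  let ?f3 = "\<lambda>\<omega>. ?T (\<omega> ?s) - U i (\<omega> ?s)"
  let ?K = "real k * \<beta> ^ k * X"
  have m1: "?f1 \<in> borel_measurable Q"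
    by (intro borel_measurable_times borel_measurable_diff measurable_X2 Pm) measurable
  have b1: "\<bar>?f1 \<omega>\<bar> \<le> \<beta> * (\<beta> ^ (2 ^ n - Suc i) + B)" for \<omega>
  proof -
    have "\<bar>P (Suc i) \<omega> - U (Suc i) (\<omega> ?t)\<bar> \<le> \<beta> ^ (2 ^ n - Suc i) + B"
      using Pb[of "Suc i" \<omega>] U[of "Suc i" "\<omega> ?t"] by linarith
    then show ?thesis unfolding abs_mult using w[OF i(1)] \<beta> by (intro mult_mono) auto
  qed
  have i1: "set_integrable Q A ?f1"
    by (rule set_integrable_bounded[OF AQ A(2) m1 b1])
  have mT: "(\<lambda>\<omega>. ?T (\<omega> ?s)) \<in> borel_measurable Q" by measurable
  have iT: "set_integrable Q A (\<lambda>\<omega>. ?T (\<omega> ?s))"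
    by (rule set_integrable_bounded[OF AQ A(2) mT mean_step_bound[OF st wU]])
  have i2: "set_integrable Q A ?f2"
    by (intro set_integral_diff iT set_integrable_bounded[OF AQ A(2) _ wU] measurable_X2)
  have i3: "set_integrable Q A ?f3"
    by (intro set_integral_diff iT set_integrable_bounded[OF AQ A(2) _ U]) measurable
  \<comment> \<open>Fixing the states at both ends of the step turns the current weight into a
    constant, and the fixed event belongs to the past of the later time, so the induction hypothesis
    applies to it.\<close>
  have "\<bar>LINT \<omega>:A|Q. ?f1 \<omega>\<bar> \<le> (LINT \<omega>:A|Q. \<beta> * ?K)"
  proof (rule set_integral_partition_le[OF AQ _ i1])
    show "(\<lambda>\<omega>. (\<omega> ?s, \<omega> ?t)) \<in> measurable Q (count_space UNIV)"
      by (rule measurable_compose_countable[OF _ measurable_X[of ?s]]) measurable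
    show "set_integrable Q A (\<lambda>_. \<beta> * ?K)"
      by (intro set_integrable_bounded[where K = "\<bar>\<beta> * ?K\<bar>"] AQ A) auto
    fix c :: "'a \<times> 'a"
    obtain a b where c: "c = (a, b)" by (cases c)
    let ?A = "A \<inter> {\<omega> \<in> space Q. (\<omega> ?s, \<omega> ?t) = c}"
    have Aa: "A \<inter> {\<omega> \<in> space Q. \<omega> ?s = a} \<in> sets (path_field E {0..?t})"
      using A(1) st by (intro past_Int) auto
    have "A \<inter> {\<omega> \<in> space Q. \<omega> ?s = a} \<inter> {\<omega> \<in> space Q. \<omega> ?t = b} \<in> sets (path_field E {0..?t})"
      using st by (intro past_Int[OF Aa]) auto
    also have "A \<inter> {\<omega> \<in> space Q. \<omega> ?s = a} \<inter> {\<omega> \<in> space Q. \<omega> ?t = b} = ?A"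
      using c by auto
    finally have A': "?A \<in> sets (path_field E {0..?t})" .
    then have A'Q: "?A \<in> sets Q" using past_sets st by simp
    have A'f: "emeasure Q ?A < \<infinity>"
      using emeasure_mono[of ?A A Q] AQ A(2) by (auto simp: less_top[symmetric] top_unique)
    have "(LINT \<omega>:?A|Q. ?f1 \<omega>) = (LINT \<omega>:?A|Q. w i a b * (P (Suc i) \<omega> - U (Suc i) (\<omega> ?t)))"
      using A'Q c by (intro set_lebesgue_integral_cong) auto
    also have "\<dots> = w i a b * (LINT \<omega>:?A|Q. P (Suc i) \<omega> - U (Suc i) (\<omega> ?t))"
      by simp
    also have "\<bar>\<dots>\<bar> \<le> \<beta> * (?K * measure Q ?A)"
      unfolding abs_mult P_def X_def using w[OF i(1)] \<beta>
      by (intro mult_mono Suc.IH[OF i(2) A' A'f]) auto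
    also have "\<dots> = (LINT \<omega>:?A|Q. \<beta> * ?K)"
      by (simp only: set_integral_const_finite[OF A'Q A'f] mult.assoc)
    finally show "\<bar>LINT \<omega>:?A|Q. ?f1 \<omega>\<bar> \<le> (LINT \<omega>:?A|Q. \<beta> * ?K)" .
  qed
  also have "\<dots> = \<beta> * ?K * measure Q A" by (rule set_integral_const_finite[OF AQ A(2)])
  finally have l1: "\<bar>LINT \<omega>:A|Q. ?f1 \<omega>\<bar> \<le> \<beta> * ?K * measure Q A" .
  have l2: "\<bar>LINT \<omega>:A|Q. ?f2 \<omega>\<bar> \<le> 8 * (\<beta> * B) * C\<^sup>2 * (?t - ?s)\<^sup>2 * measure Q A"
    by (rule one_step[OF A st wU])
  have l3: "\<bar>LINT \<omega>:A|Q. ?f3 \<omega>\<bar> \<le> \<eta> * measure Q A"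
    by (rule set_integral_bound[OF AQ A(2) defect[OF i(1)]])
  have "(LINT \<omega>:A|Q. P i \<omega> - U i (\<omega> ?s)) = (LINT \<omega>:A|Q. (?f1 \<omega> + ?f2 \<omega>) + ?f3 \<omega>)"
    using AQ i(1) by (intro set_lebesgue_integral_cong)
      (auto simp: P_def prod.atLeast_Suc_lessThan algebra_simps)
  also have "\<dots> = (LINT \<omega>:A|Q. ?f1 \<omega>) + (LINT \<omega>:A|Q. ?f2 \<omega>) + (LINT \<omega>:A|Q. ?f3 \<omega>)"
    by (subst set_integral_add(2) | intro set_integral_add(1) i1 i2 i3 refl)+
  finally have "\<bar>LINT \<omega>:A|Q. P i \<omega> - U i (\<omega> ?s)\<bar> \<le> (\<beta> * ?K + X) * measure Q A"
    using l1 l2 l3 by (simp add: X_def grid_Suc distrib_right)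
  \<comment> \<open>\<open>\<beta> \<ge> 1\<close> lets the fresh error \<open>X\<close> be absorbed
    as one more copy of \<open>\<beta> ^ Suc k * X\<close>.\<close>
  also have "\<dots> \<le> (real (Suc k) * \<beta> ^ Suc k * X) * measure Q A"
  proof (rule mult_right_mono)
    have "1 * X \<le> \<beta> ^ Suc k * X" by (intro mult_right_mono one_le_power \<beta> X)
    then show "\<beta> * ?K + X \<le> real (Suc k) * \<beta> ^ Suc k * X" by (simp add: algebra_simps)
  qed simp
  finally show ?case unfolding P_def X_def .
qed

section \<open>Lower bounds for staying at a state and for jumping\<close>

lemma finite_Int:
  assumes "A \<in> sets Q" "emeasure Q A < \<infinity>"
  shows "emeasure Q (A \<inter> S) < \<infinity>"
  using emeasure_mono[of "A \<inter> S" A Q] assms by (auto simp: less_top[symmetric] top_unique)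

text \<open>By \<open>leave_bound\<close> at most half of the mass leaves within time
  \<open>1 / (4 * C + 1)\<close>, and \<open>nat \<lceil>4 * C + 1\<rceil>\<close> such times cover
  \<open>[0,1]\<close>. The summand 1 keeps the step length finite when
  \<open>C = 0\<close>.\<close>

definition stay_const :: real where
  "stay_const = (1/2) ^ nat \<lceil>4 * C + 1\<rceil>"

lemma stay_const_pos: "0 < stay_const"
  by (simp add: stay_const_def)

text \<open>At least half of the mass survives each short step, and the losses are chained. Only the
  states at the ends of the steps are controlled: excursions from \<open>a\<close> in between are
  allowed.\<close>

lemma stay_bound:
  assumes A: "A \<in> sets (path_field E {0..s})" "emeasure Q A < \<infinity>" "\<And>\<omega>. \<omega> \<in> A \<Longrightarrow> \<omega> s = a"
    and st: "0 \<le> s" "s \<le> t" "t \<le> 1"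
  shows "stay_const * measure Q A \<le> measure Q (A \<inter> {\<omega> \<in> space Q. \<omega> t = a})"
proof -
  let ?h = "1 / (4 * C + 1)"
  have h: "0 < ?h" using C_nonneg by simp
  have "(1/2) ^ j * measure Q A \<le> measure Q (A \<inter> {\<omega> \<in> space Q. \<omega> t = a})"
    if "t - s \<le> real j * ?h" "s \<le> t" "t \<le> 1" for j t
    using that
  proof (induction j arbitrary: t)
    case 0
    then have "t = s" by simp
    moreover have "A \<subseteq> space Q" using past_sets[OF A(1)] st sets.sets_into_space by auto
    ultimately have "A \<inter> {\<omega> \<in> space Q. \<omega> t = a} = A" using A(3) by auto
    then show ?case by simp
  next
    case (Suc j)
    \<comment> \<open>The last step goes back by the step length or, if that would pass
      \<open>s\<close>, stops at \<open>s\<close>; either way \<open>j\<close> steps remain for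
      \<open>{s..r}\<close>.\<close>
    define r where "r = max s (t - ?h)"
    have r: "s \<le> r" "r \<le> t" "t - r \<le> ?h" "r - s \<le> real j * ?h"
      using Suc.prems h by (auto simp: r_def max_def algebra_simps add_divide_distrib)
    let ?A = "A \<inter> {\<omega> \<in> space Q. \<omega> r = a}"
    have A': "?A \<in> sets (path_field E {0..r})"
      using past_Int[of A r r r a] A(1) sets_path_field_mono[of "{0..s}" "{0..r}" E] r st by auto
    have A'Q: "?A \<in> sets Q" using past_sets[OF A'] r Suc.prems by simp
    have A'f: "emeasure Q ?A < \<infinity>" using past_sets[OF A(1)] st A(2) by (intro finite_Int) auto
    have AQ: "A \<in> sets Q" using past_sets A st by simp
    have fin: "?A \<in> fmeasurable Q" using A'Q A'f by (simp add: fmeasurable_def)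
    have finA: "A \<in> fmeasurable Q" using AQ A(2) by (simp add: fmeasurable_def)
    have "measure Q ?A = measure Q (?A \<inter> {\<omega> \<in> space Q. \<omega> t = a}) + measure Q (?A \<inter> {\<omega> \<in> space Q. \<omega> t \<noteq> a})"
    proof -
      have [measurable]: "?A \<in> sets Q" by (rule A'Q)
      have "?A = (?A \<inter> {\<omega> \<in> space Q. \<omega> t = a}) \<union> (?A \<inter> {\<omega> \<in> space Q. \<omega> t \<noteq> a})" by auto
      then have "measure Q ?A = measure Q ((?A \<inter> {\<omega> \<in> space Q. \<omega> t = a}) \<union> (?A \<inter> {\<omega> \<in> space Q. \<omega> t \<noteq> a}))"
        by (rule arg_cong)
      also have "\<dots> = measure Q (?A \<inter> {\<omega> \<in> space Q. \<omega> t = a}) + measure Q (?A \<inter> {\<omega> \<in> space Q. \<omega> t \<noteq> a})"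
        using fin by (intro measure_Un_AE)
          (auto intro!: fmeasurable_Int_fmeasurable sets.sets_Collect AE_I2)
      finally show ?thesis .
    qed
    moreover have "measure Q (?A \<inter> {\<omega> \<in> space Q. \<omega> t \<noteq> a}) \<le> 2 * C * (t - r) * measure Q ?A"
      using r st Suc.prems by (intro leave_bound A' A'f) auto
    moreover have "2 * C * (t - r) * measure Q ?A \<le> 1/2 * measure Q ?A"
    proof (rule mult_right_mono)
      have "2 * C * (t - r) \<le> 2 * C * ?h" using r C_nonneg by (intro mult_left_mono) auto
      also have "\<dots> \<le> 1/2" using C_nonneg by (simp add: field_simps)
      finally show "2 * C * (t - r) \<le> 1/2" .
    qed simp
    ultimately have "1/2 * measure Q ?A \<le> measure Q (?A \<inter> {\<omega> \<in> space Q. \<omega> t = a})" by linarith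
    also have "\<dots> \<le> measure Q (A \<inter> {\<omega> \<in> space Q. \<omega> t = a})"
    proof (rule measure_mono_fmeasurable)
      show "?A \<inter> {\<omega> \<in> space Q. \<omega> t = a} \<in> sets Q" using A'Q by measurable
      show "A \<inter> {\<omega> \<in> space Q. \<omega> t = a} \<in> fmeasurable Q"
        using finA by (rule fmeasurable_Int_fmeasurable) measurable
    qed auto
    finally have "1/2 * measure Q ?A \<le> measure Q (A \<inter> {\<omega> \<in> space Q. \<omega> t = a})" .
    moreover have "(1/2) ^ j * measure Q A \<le> measure Q ?A"
      using Suc.IH[of r] r Suc.prems by simp
    ultimately show ?case by simp
  qed
  moreover have "t - s \<le> real (nat \<lceil>4 * C + 1\<rceil>) * ?h"
  proof -
    have "t - s \<le> 1" using st by simp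
    also have "1 = (4 * C + 1) * ?h" using C_nonneg by simp
    also have "\<dots> \<le> real (nat \<lceil>4 * C + 1\<rceil>) * ?h"
      using h by (intro mult_right_mono real_nat_ceiling_ge) auto
    finally show ?thesis .
  qed
  ultimately show ?thesis using st by (simp add: stay_const_def)
qed

text \<open>Let \<open>p\<close> be the mass of \<open>A\<close> found at \<open>b\<close> at time
  \<open>t\<close>. The martingale identity for the indicator of \<open>b\<close> bounds
  \<open>p\<close> below by gain minus loss. At each time \<open>r\<close> the gain is at least
  \<open>J r a b\<close> times the mass still at \<open>a\<close>, which \<open>stay_bound\<close>
  controls. The loss is at most \<open>C\<close> times the mass at \<open>b\<close>, which is at
  most \<open>p / stay_const\<close>, as a fraction \<open>stay_const\<close> of it is again at
  \<open>b\<close> at time \<open>t\<close>. Moving the loss to the side of \<open>p\<close> gives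
  \<open>1 + C / stay_const\<close>. Linearity in the kernel lets the slowing factor pass through
  unchanged.\<close>

lemma jump_bound:
  assumes A: "A \<in> sets (path_field E {0..s})" "emeasure Q A < \<infinity>" "\<And>\<omega>. \<omega> \<in> A \<Longrightarrow> \<omega> s = a"
    and st: "0 \<le> s" "s \<le> t" "t \<le> 1" and ab: "E a b" "a \<noteq> b"
  shows "stay_const * measure Q A * (LINT r:{s..t}|lborel. J r a b) \<le>
    (1 + C / stay_const) * measure Q (A \<inter> {\<omega> \<in> space Q. \<omega> t = b})"
proof (cases "measure Q A = 0")
  \<comment> \<open>Null events are set aside because the constant \<open>c\<close> below divides by
    \<open>measure Q A\<close>.\<close>
  case True
  then show ?thesis using C_nonneg stay_const_pos by simp
next
  case False
  then have pos: "0 < measure Q A" by (simp add: less_le)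
  let ?u = "indicat_real {b}"
  have u: "\<bar>?u c\<bar> \<le> 1" for c by (simp add: indicator_def)
  define p where "p = measure Q (A \<inter> {\<omega> \<in> space Q. \<omega> t = b})"
  \<comment> \<open>Chosen so that \<open>c * measure Q A = C * p / stay_const\<close>, the bound
    for the loss rate; adding \<open>c\<close> to the integrand makes its mean nonnegative at every
    time.\<close>
  define c where "c = C * p / (stay_const * measure Q A)"
  define H where "H = (\<lambda>(\<omega> :: real \<Rightarrow> 'a) r. indicator {0..1} r * generator E J r ?u (\<omega> r) -
      stay_const * (indicator {0..1} r * J r a b) + c)"
  have p: "0 \<le> p" by (simp add: p_def)
  have c: "0 \<le> c" unfolding c_def using C_nonneg stay_const_pos p by simp
  have AQ: "A \<in> sets Q" using past_sets A st by simp
  have finA: "A \<in> fmeasurable Q" using AQ A(2) by (simp add: fmeasurable_def)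
  have sp: "\<omega> \<in> space Q" if "\<omega> \<in> A" for \<omega> using sets.sets_into_space[OF AQ] that by blast
  have in01: "r \<in> {0..1}" if "r \<in> {s..t}" for r using that st by simp
  have gb: "\<bar>generator E J r ?u b'\<bar> \<le> 2 * C" if "r \<in> {0..1}" for r b'
    using generator_bound[OF that u] by simp
  have genu: "J r a b * indicator {a} z - C * indicator {b} z \<le> generator E J r ?u z" if r: "r \<in> {0..1}" for r z
  proof -
    have eq: "generator E J r ?u z = (\<Sum>y\<in>{y. E z y}. J r z y * ?u y) - total_rate E J r z * ?u z"
      by (rule generator_eq)
    have nn: "0 \<le> (\<Sum>y\<in>{y. E z y}. J r z y * ?u y)"
      using r by (intro sum_nonneg mult_nonneg_nonneg) (auto intro: kernel_nonneg)
    consider "z = b" | "z = a" | "z \<noteq> a" "z \<noteq> b" by blast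
    then show ?thesis
    proof cases
      case 1 then show ?thesis using eq nn rate_le[OF r, of z] ab by simp
    next
      case 2
      have "(\<Sum>y\<in>{y. E a y}. J r a y * ?u y) = (\<Sum>y\<in>{b}. J r a y * ?u y)"
        using ab by (intro sum.mono_neutral_right finite_nbrs) (auto simp: indicator_def)
      then show ?thesis using eq 2 ab by simp
    next
      case 3 then show ?thesis using eq nn by simp
    qed
  qed
  \<comment> \<open>Proved at each fixed \<open>r\<close>: \<open>stay_bound\<close> is used once
    from \<open>s\<close> to \<open>r\<close> at the state \<open>a\<close>, and once from
    \<open>r\<close> to \<open>t\<close> at the state \<open>b\<close>.\<close>
  have key: "0 \<le> (LINT \<omega>:A|Q. H \<omega> r)" if r: "r \<in> {s..t}" for r
  proof -
    let ?Ab = "A \<inter> {\<omega> \<in> space Q. \<omega> r = b}"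
    have Jn: "0 \<le> J r a b" using kernel_nonneg in01[OF r] ab by simp
    have Ab: "?Ab \<in> sets (path_field E {0..r})"
      using past_Int[of A r r r b] A(1) sets_path_field_mono[of "{0..s}" "{0..r}" E] r st by auto
    have "stay_const * measure Q ?Ab \<le> measure Q (?Ab \<inter> {\<omega> \<in> space Q. \<omega> t = b})"
      using r st by (intro stay_bound[OF Ab] finite_Int AQ A(2)) auto
    also have "\<dots> \<le> p" unfolding p_def
    proof (rule measure_mono_fmeasurable)
      show "?Ab \<inter> {\<omega> \<in> space Q. \<omega> t = b} \<in> sets Q" using AQ by measurable
      show "A \<inter> {\<omega> \<in> space Q. \<omega> t = b} \<in> fmeasurable Q"
        using finA by (rule fmeasurable_Int_fmeasurable) measurable
    qed auto
    finally have "C * (stay_const * measure Q ?Ab) \<le> C * p" using C_nonneg by (rule mult_left_mono)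
    then have 1: "C * measure Q ?Ab \<le> c * measure Q A"
      unfolding c_def using stay_const_pos pos by (simp add: field_simps)
    have "stay_const * measure Q A \<le> measure Q (A \<inter> {\<omega> \<in> space Q. \<omega> r = a})"
      by (rule stay_bound[OF A(1,2)]) (use A(3) r st in auto)
    then have 2: "J r a b * (stay_const * measure Q A) \<le> J r a b * measure Q (A \<inter> {\<omega> \<in> space Q. \<omega> r = a})"
      using Jn by (rule mult_left_mono)
    let ?L = "\<lambda>\<omega>. J r a b * indicator {a} (\<omega> r) - C * indicator {b} (\<omega> r)"
    define \<kappa> where "\<kappa> = stay_const * J r a b - c"
    have m: "(\<lambda>\<omega>. f (\<omega> r) :: real) \<in> borel_measurable Q" for f by measurable
    have ind: "set_integrable Q A (\<lambda>\<omega>. k * indicator {z} (\<omega> r))" for k :: real and z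
      by (rule set_integrable_bounded[OF AQ A(2), where K = "\<bar>k\<bar>"]) (auto simp: indicator_def intro: m)
    have ik: "set_integrable Q A (\<lambda>_. \<kappa>)"
      by (rule set_integrable_bounded[OF AQ A(2), where K = "\<bar>\<kappa>\<bar>"]) auto
    have "0 \<le> J r a b * measure Q (A \<inter> {\<omega> \<in> space Q. \<omega> r = a}) - C * measure Q ?Ab - \<kappa> * measure Q A"
      using 1 2 by (simp add: \<kappa>_def algebra_simps)
    also have "\<dots> = (LINT \<omega>:A|Q. J r a b * indicator {a} (\<omega> r)) - (LINT \<omega>:A|Q. C * indicator {b} (\<omega> r)) -
        (LINT \<omega>:A|Q. \<kappa>)"
      using integral_indicator_X[OF AQ A(2), of "{a}" r] integral_indicator_X[OF AQ A(2), of "{b}" r]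
        set_integral_const_finite[OF AQ A(2), of \<kappa>] by simp
    also have "\<dots> = (LINT \<omega>:A|Q. ?L \<omega> - \<kappa>)"
      by (subst set_integral_diff(2) | intro set_integral_diff(1) ind ik refl)+
    also have "\<dots> \<le> (LINT \<omega>:A|Q. H \<omega> r)"
    proof (rule set_integral_mono)
      show "set_integrable Q A (\<lambda>\<omega>. ?L \<omega> - \<kappa>)" by (intro set_integral_diff(1) ind ik)
      show "set_integrable Q A (\<lambda>\<omega>. H \<omega> r)"
      proof (rule set_integrable_bounded[OF AQ A(2), where K = "2 * C + \<bar>\<kappa>\<bar>"])
        show "(\<lambda>\<omega>. H \<omega> r) \<in> borel_measurable Q" unfolding H_def by (rule m)
        show "\<bar>H \<omega> r\<bar> \<le> 2 * C + \<bar>\<kappa>\<bar>" for \<omega>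
          using gb[OF in01[OF r], of "\<omega> r"] in01[OF r] by (simp add: H_def \<kappa>_def)
      qed
      show "?L \<omega> - \<kappa> \<le> H \<omega> r" for \<omega>
        using genu[OF in01[OF r], of "\<omega> r"] in01[OF r] by (simp add: H_def \<kappa>_def)
    qed
    finally show ?thesis .
  qed
  have "0 \<le> (LINT r:{s..t}|lborel. LINT \<omega>:A|Q. H \<omega> r)"
    unfolding set_lebesgue_integral_def[of lborel]
    by (intro Bochner_Integration.integral_nonneg) (use key in \<open>auto simp: indicator_def\<close>)
  also have "\<dots> = (LINT \<omega>:A|Q. LINT r:{s..t}|lborel. H \<omega> r)"
  proof (rule set_integral_Fubini[OF AQ A(2), symmetric])
    have "(\<lambda>r. indicator {0..1} r * J r a b) \<in> borel_measurable borel"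
      by (intro kernel_measurable_on) auto
    from measurable_compose[OF measurable_snd this]
    show "(\<lambda>p. H (fst p) (snd p)) \<in> borel_measurable (Q \<Otimes>\<^sub>M borel)"
      unfolding H_def using measurable_generator[where u = ?u] by measurable
    show "\<bar>H \<omega> r\<bar> \<le> 2 * C + stay_const * C + c" if "s \<le> r" "r \<le> t" for \<omega> r
    proof -
      have r: "r \<in> {0..1}" using that st by simp
      have "0 \<le> stay_const * J r a b" "stay_const * J r a b \<le> stay_const * C"
        using kernel_nonneg[OF r ab(1)] kernel_le[OF r ab(1)] stay_const_pos by simp_all
      then show ?thesis using gb[OF r, of "\<omega> r"] r c by (simp add: H_def)
    qed
  qed
  also have "\<dots> = (LINT \<omega>:A|Q. (LINT r:{s..t}|lborel. generator E J r ?u (\<omega> r)) -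
      (stay_const * (LINT r:{s..t}|lborel. J r a b) - c * (t - s)))"
  proof (intro set_lebesgue_integral_cong AQ allI impI)
    fix \<omega> assume "\<omega> \<in> A"
    have ic: "set_integrable lborel {s..t} (\<lambda>_. c)"
      by (rule set_integrable_bounded[where K = "\<bar>c\<bar>"]) (auto simp: emeasure_lborel_Icc_eq)
    have ig: "set_integrable lborel {s..t} (\<lambda>r. generator E J r ?u (\<omega> r))"
      using st u by (intro generator_path_integrable sp[OF \<open>\<omega> \<in> A\<close>]) auto
    have iJ: "set_integrable lborel {s..t} (\<lambda>r. stay_const * J r a b)"
      using st ab by (intro set_integrable_mult_right kernel_integrable) auto
    have "(LINT r:{s..t}|lborel. H \<omega> r) =
       (LINT r:{s..t}|lborel. generator E J r ?u (\<omega> r) - stay_const * J r a b + c)"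
      using st by (intro set_lebesgue_integral_cong) (auto simp: H_def)
    also have "\<dots> = (LINT r:{s..t}|lborel. generator E J r ?u (\<omega> r)) -
       (LINT r:{s..t}|lborel. stay_const * J r a b) + (LINT r:{s..t}|lborel. c)"
      by (subst set_integral_add(2) set_integral_diff(2) | intro set_integral_diff(1) ic ig iJ refl)+
    also have "(LINT r:{s..t}|lborel. c) = c * (t - s)"
      using st by (subst set_integral_const_finite) (auto simp: emeasure_lborel_Icc_eq)
    finally show "(LINT r:{s..t}|lborel. H \<omega> r) = (LINT r:{s..t}|lborel. generator E J r ?u (\<omega> r)) -
      (stay_const * (LINT r:{s..t}|lborel. J r a b) - c * (t - s))" by simp
  qed
  also have "\<dots> = (LINT \<omega>:A|Q. LINT r:{s..t}|lborel. generator E J r ?u (\<omega> r)) -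
      (LINT \<omega>:A|Q. stay_const * (LINT r:{s..t}|lborel. J r a b) - c * (t - s))"
  proof (rule set_integral_diff(2))
    show "set_integrable Q A (\<lambda>\<omega>. LINT r:{s..t}|lborel. generator E J r ?u (\<omega> r))"
      using st by (intro set_integrable_bounded[where K = "2 * C * measure lborel {s..t}"] AQ A
        measurable_generator_integral set_integral_bound gb in01)
        (auto simp: emeasure_lborel_Icc_eq)
    show "set_integrable Q A (\<lambda>\<omega>. stay_const * (LINT r:{s..t}|lborel. J r a b) - c * (t - s))"
      by (rule set_integrable_bounded[OF AQ A(2) _ order_refl]) simp
  qed
  also have "(LINT \<omega>:A|Q. LINT r:{s..t}|lborel. generator E J r ?u (\<omega> r)) =
      (LINT \<omega>:A|Q. ?u (\<omega> t) - ?u (\<omega> s))"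
    by (rule generator_formula[OF A(1,2) st u, symmetric])
  also have "\<dots> = (LINT \<omega>:A|Q. ?u (\<omega> t))"
    using AQ A(3) ab by (intro set_lebesgue_integral_cong) (auto simp: indicator_def)
  also have "\<dots> = p" using integral_indicator_X[OF AQ A(2), of "{b}" t] by (simp add: p_def)
  also have "(LINT \<omega>:A|Q. stay_const * (LINT r:{s..t}|lborel. J r a b) - c * (t - s)) =
     (stay_const * (LINT r:{s..t}|lborel. J r a b) - c * (t - s)) * measure Q A"
    by (rule set_integral_const_finite[OF AQ A(2)])
  finally have "stay_const * measure Q A * (LINT r:{s..t}|lborel. J r a b) \<le> p + c * (t - s) * measure Q A"
    by (simp add: algebra_simps)
  also have "c * (t - s) * measure Q A = C / stay_const * p * (t - s)"
    unfolding c_def using pos by simp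
  also have "\<dots> \<le> C / stay_const * p * 1"
    using st C_nonneg stay_const_pos p by (intro mult_left_mono) auto
  finally show ?thesis unfolding p_def by (simp add: algebra_simps)
qed

end

section \<open>Girsanov's formula\<close>

lemma exp_minus_one_bounds:
  fixes x :: real
  assumes "0 \<le> x"
  shows "exp x - 1 \<le> x * exp x" "exp x - 1 - x \<le> x\<^sup>2 * exp x"
proof -
  have "(1 + - x) * exp x \<le> exp (- x) * exp x" by (intro mult_right_mono exp_ge_add_one_self) simp
  then show 1: "exp x - 1 \<le> x * exp x" by (simp add: exp_minus algebra_simps)
  then have "x * (exp x - 1) \<le> x * (x * exp x)" using assms by (rule mult_left_mono)
  then show "exp x - 1 - x \<le> x\<^sup>2 * exp x" using 1 by (simp add: power2_eq_square algebra_simps)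
qed

text \<open>Here \<open>j\<close> and \<open>j'\<close> are the integrated total rates of the two
  kernels over a step, \<open>v\<close> is the value for staying and \<open>S\<close> the
  contribution of the jumps. The factor \<open>exp (j - j')\<close> corrects \<open>1 - j\<close> to
  \<open>1 - j'\<close> to first order; on \<open>S\<close>, which is already of first order, it
  acts only at second order.\<close>

lemma one_step_weight_error:
  fixes j j' v S B H :: real
  assumes j: "0 \<le> j'" "j' \<le> j" "j \<le> H" and v: "\<bar>v\<bar> \<le> B" and S: "\<bar>S\<bar> \<le> B * j'"
  shows "\<bar>exp (j - j') * (v * (1 - j) + S) - (v * (1 - j') + S)\<bar> \<le> 3 * B * H\<^sup>2 * exp H"
proof -
  define x where "x = j - j'"
  have x: "0 \<le> x" "x \<le> H" using j by (auto simp: x_def)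
  have B: "0 \<le> B" using v by simp
  have e1: "exp x - 1 \<le> H * exp H"
    using exp_minus_one_bounds(1)[OF x(1)] mult_mono[OF x(2), of "exp x" "exp H"] x by simp
  have e2: "exp x - 1 - x \<le> H\<^sup>2 * exp H"
    using exp_minus_one_bounds(2)[OF x(1)] mult_mono[OF power_mono[OF x(2,1), of 2], of "exp x" "exp H"] x by simp
  have p1: "0 \<le> exp x - 1" and p2: "0 \<le> exp x - 1 - x"
    using exp_ge_add_one_self[of x] x by linarith+
  have "\<bar>v * (exp x - 1 - x)\<bar> \<le> B * (H\<^sup>2 * exp H)"
    unfolding abs_mult using v p2 e2 by (intro mult_mono) auto
  moreover have "\<bar>v * (j * (exp x - 1))\<bar> \<le> B * (H * (H * exp H))"
    unfolding abs_mult using v p1 e1 j B x by (intro mult_mono) auto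
  moreover have "\<bar>S * (exp x - 1)\<bar> \<le> (B * H) * (H * exp H)"
  proof -
    have "B * j' \<le> B * H" using B j by (intro mult_left_mono) auto
    then show ?thesis unfolding abs_mult using S p1 e1 B x by (intro mult_mono) auto
  qed
  \<comment> \<open>In this regrouping every summand is visibly of second order in
    \<open>H\<close>.\<close>
  moreover have "exp x * (v * (1 - j) + S) - (v * (1 - j') + S) =
      v * (exp x - 1 - x) - v * (j * (exp x - 1)) + S * (exp x - 1)"
    by (simp add: x_def algebra_simps)
  ultimately show ?thesis unfolding x_def by (simp add: power2_eq_square)
qed

lemma slowed_rate_le:
  fixes E :: "'a::countable \<Rightarrow> 'a \<Rightarrow> bool"
  assumes "jump_kernel E J C" "\<And>a b. 0 \<le> d a b" "1 \<le> k" "t \<in> {0..1}"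
  shows "total_rate E (slowed_kernel d J k) t a \<le> total_rate E J t a"
proof -
  interpret jump_kernel E J C by fact
  have "real k powr (- d a b) \<le> 1" for b
    using powr_mono[of "- d a b" 0 "real k"] assms(2)[of a b] assms(3) by simp
  then show ?thesis
    unfolding total_rate_def slowed_kernel_def using kernel_nonneg[OF assms(4)]
    by (intro sum_mono) (auto intro: mult_left_le_one_le)
qed

lemma jump_kernel_slowed:
  fixes E :: "'a::countable \<Rightarrow> 'a \<Rightarrow> bool"
  assumes "jump_kernel E J C" "\<And>a b. 0 \<le> d a b" "1 \<le> k"
  shows "jump_kernel E (slowed_kernel d J k) C"
proof -
  interpret jump_kernel E J C by fact
  show ?thesis
  proof
    fix a b t
    show "finite {b. E a b}" by (rule finite_nbrs)
    have "(\<lambda>t. real k powr (- d a b) * (indicat_real {0..1} t * J t a b)) \<in> borel_measurable borel"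
      by (intro borel_measurable_times borel_measurable_const kernel_measurable_on) auto
    then show "set_borel_measurable borel {0..1} (\<lambda>t. slowed_kernel d J k t a b)"
      by (simp add: set_borel_measurable_def slowed_kernel_def mult_ac)
    show "0 \<le> slowed_kernel d J k t a b" if "t \<in> {0..1}" "E a b"
      using kernel_nonneg[OF that] by (simp add: slowed_kernel_def)
    show "total_rate E (slowed_kernel d J k) t a \<le> C" if "t \<in> {0..1}"
      using slowed_rate_le[where d = d and a = a, OF assms that] rate_le[OF that, of a] by linarith
  qed
qed

section \<open>Comparison of a process with its slowed version on the grid\<close>

locale slowed_process =
  R: jump_process E J C R + S: jump_process E "slowed_kernel d J k" C S
  for E :: "'a::countable \<Rightarrow> 'a \<Rightarrow> bool" and J C R d k S +
  assumes d_refl: "\<And>a. d a a = 0" and d_nonneg: "\<And>a b. 0 \<le> d a b" and k: "1 \<le> k"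
begin

definition saved_rate :: "real \<Rightarrow> 'a \<Rightarrow> real" where
  "saved_rate r a = total_rate E J r a - total_rate E (slowed_kernel d J k) r a"

lemma saved_rate_bounds:
  assumes "r \<in> {0..1}"
  shows "0 \<le> saved_rate r a" "saved_rate r a \<le> C"
  using slowed_rate_le[where d = d and a = a, OF R.jump_kernel_axioms d_nonneg k assms] R.rate_le[OF assms, of a]
    S.rate_nonneg[OF assms, of a]
  by (auto simp: saved_rate_def)

lemma saved_rate_measurable:
  "(\<lambda>r. indicator {0..1} r * saved_rate r a) \<in> borel_measurable borel"
  unfolding saved_rate_def right_diff_distrib
  by (intro borel_measurable_diff R.rate_measurable S.rate_measurable)

text \<open>Equals \<open>real k powr (- d a b)\<close> for \<open>k \<ge> 1\<close>; in exponential
  form the products along a path become sums of distances.\<close>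

definition slow :: "'a \<Rightarrow> 'a \<Rightarrow> real" where
  "slow a b = exp (- ln (real k) * d a b)"

lemma slow_bounds: "0 \<le> slow a b" "slow a b \<le> 1" and slow_refl: "slow a a = 1"
  using k d_nonneg[of a b] by (auto simp: slow_def d_refl)

lemma slowed_kernel_eq: "slowed_kernel d J k r a b = slow a b * J r a b"
  using k by (simp add: slowed_kernel_def slow_def powr_def mult_ac)

definition saved :: "real \<Rightarrow> real \<Rightarrow> 'a \<Rightarrow> real" where
  "saved s t a = (LINT r:{s..t}|lborel. saved_rate r a)"

lemma saved_eq:
  assumes "0 \<le> s" "t \<le> 1"
  shows "saved s t a = (LINT r:{s..t}|lborel. total_rate E J r a) -
    (LINT r:{s..t}|lborel. total_rate E (slowed_kernel d J k) r a)"
  unfolding saved_def saved_rate_def using assms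
  by (intro set_integral_diff R.rate_integrable S.rate_integrable)

lemma saved_bounds:
  assumes "0 \<le> s" "s \<le> t" "t \<le> 1"
  shows "0 \<le> saved s t a" "saved s t a \<le> C * (t - s)"
proof -
  have "(LINT r:{s..t}|lborel. total_rate E (slowed_kernel d J k) r a) \<le>
     (LINT r:{s..t}|lborel. total_rate E J r a)"
    using assms slowed_rate_le[where d = d and a = a, OF R.jump_kernel_axioms d_nonneg k]
    by (intro set_integral_mono R.rate_integrable S.rate_integrable) auto
  then show "0 \<le> saved s t a" using saved_eq assms by simp
  show "saved s t a \<le> C * (t - s)"
    using saved_eq[of s t a] R.rate_integral_bounds[OF assms, of a] S.rate_integral_bounds[OF assms, of a] assms
    by simp
qed

text \<open>The factor \<open>slow\<close> turns the jump terms of \<open>J\<close> into those of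
  the slowed kernel exactly. The factor \<open>exp (saved s t a)\<close> repairs the staying term to
  first order, and what remains is \<open>one_step_weight_error\<close>.\<close>

lemma mean_step_defect:
  assumes st: "0 \<le> s" "s \<le> t" "t \<le> 1" and v: "\<And>b. \<bar>v a b\<bar> \<le> B"
  shows "\<bar>R.mean_step s t (\<lambda>a b. slow a b * exp (saved s t a) * v a b) a - S.mean_step s t v a\<bar>
    \<le> 3 * B * (C * (t - s))\<^sup>2 * exp (C * (t - s))"
proof -
  define j where "j = (LINT r:{s..t}|lborel. total_rate E J r a)"
  define j' where "j' = (LINT r:{s..t}|lborel. total_rate E (slowed_kernel d J k) r a)"
  define T where "T = (\<Sum>b\<in>{b. E a b}. (LINT r:{s..t}|lborel. slowed_kernel d J k r a b) * v a b)"
  have sv: "saved s t a = j - j'" unfolding j_def j'_def using saved_eq st by simp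
  have st': "0 \<le> s" "t \<le> 1" using st by auto
  have "R.mean_step s t (\<lambda>a b. slow a b * exp (saved s t a) * v a b) a =
     exp (j - j') * v a a * (1 - j) +
     (\<Sum>b\<in>{b. E a b}. (LINT r:{s..t}|lborel. J r a b) * (slow a b * exp (j - j') * v a b))"
    unfolding R.mean_step_eq[OF st'] by (simp add: slow_refl sv j_def)
  also have "(\<Sum>b\<in>{b. E a b}. (LINT r:{s..t}|lborel. J r a b) * (slow a b * exp (j - j') * v a b)) = exp (j - j') * T"
    unfolding T_def sum_distrib_left by (intro sum.cong refl) (simp add: slowed_kernel_eq)
  finally have 1: "R.mean_step s t (\<lambda>a b. slow a b * exp (saved s t a) * v a b) a =
    exp (j - j') * (v a a * (1 - j) + T)" by (simp add: algebra_simps)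
  have 2: "S.mean_step s t v a = v a a * (1 - j') + T"
    unfolding S.mean_step_eq[OF st'] by (simp add: T_def j'_def)
  have "\<bar>T\<bar> \<le> (\<Sum>b\<in>{b. E a b}. \<bar>(LINT r:{s..t}|lborel. slowed_kernel d J k r a b) * v a b\<bar>)"
    unfolding T_def by (rule sum_abs)
  also have "\<dots> \<le> (\<Sum>b\<in>{b. E a b}. (LINT r:{s..t}|lborel. slowed_kernel d J k r a b) * B)"
  proof (rule sum_mono)
    fix b assume "b \<in> {b. E a b}"
    then have "0 \<le> (LINT r:{s..t}|lborel. slowed_kernel d J k r a b)"
      using st by (intro S.kernel_integral_nonneg) auto
    then show "\<bar>(LINT r:{s..t}|lborel. slowed_kernel d J k r a b) * v a b\<bar> \<le>
        (LINT r:{s..t}|lborel. slowed_kernel d J k r a b) * B"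
      using v[of b] by (simp add: abs_mult mult_left_mono)
  qed
  also have "\<dots> = B * j'"
    unfolding j'_def S.rate_integral_eq[OF st'] by (simp add: sum_distrib_left mult.commute)
  finally have T: "\<bar>T\<bar> \<le> B * j'" .
  show ?thesis unfolding 1 2
    using saved_bounds(1)[OF st, of a] R.rate_integral_bounds[OF st, of a] S.rate_integral_bounds[OF st, of a] v T
    by (intro one_step_weight_error) (auto simp: sv j_def j'_def)
qed

text \<open>The argument \<open>m\<close> counts the steps left, which makes the recursion
  structural. The function satisfies the recursion of \<open>grid_expansion\<close> without defect
  for the slowed process, and serves for the original one with a defect of second order.\<close>

fun backward :: "nat \<Rightarrow> (nat \<Rightarrow> 'a \<Rightarrow> 'a \<Rightarrow> real) \<Rightarrow> nat \<Rightarrow> 'a \<Rightarrow> real" where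
  "backward n \<psi> 0 a = 1"
| "backward n \<psi> (Suc m) a =
     S.mean_step (grid n (2 ^ n - Suc m)) (grid n (2 ^ n - m)) (\<lambda>a b. \<psi> (2 ^ n - Suc m) a b * backward n \<psi> m b) a"

text \<open>Each step multiplies the bound by at most \<open>1 + 2 * C / 2 ^ n\<close>, and at most
  \<open>2 ^ n\<close> such factors stay below \<open>exp (2 * C)\<close>, whatever the level
  \<open>n\<close>.\<close>

lemma backward_bound:
  assumes \<psi>: "\<And>i a b. \<bar>\<psi> i a b\<bar> \<le> 1" and "m \<le> 2 ^ n"
  shows "\<bar>backward n \<psi> m a\<bar> \<le> exp (2 * C)"
proof -
  have pos: "0 \<le> 2 * C * (1 / 2 ^ n)" using R.C_nonneg by simp
  have "\<bar>backward n \<psi> m a\<bar> \<le> (1 + 2 * C * (1 / 2 ^ n)) ^ m"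
    using assms(2)
  proof (induction m arbitrary: a)
    case (Suc m)
    have e: "2 ^ n - m = Suc (2 ^ n - Suc m)" using Suc.prems by simp
    have st: "0 \<le> grid n (2 ^ n - Suc m)" "grid n (2 ^ n - Suc m) \<le> grid n (2 ^ n - m)" "grid n (2 ^ n - m) \<le> 1"
      using grid_bounds[of "2 ^ n - Suc m" n] grid_bounds[of "2 ^ n - m" n] by (auto intro: grid_mono)
    have "\<bar>backward n \<psi> (Suc m) a\<bar> \<le> (1 + 2 * C * (1 / 2 ^ n)) ^ m *
        (1 + 2 * C * (grid n (2 ^ n - m) - grid n (2 ^ n - Suc m)))"
      unfolding backward.simps
    proof (rule S.mean_step_bound[OF st])
      fix b
      have "\<bar>\<psi> (2 ^ n - Suc m) a b * backward n \<psi> m b\<bar> \<le> 1 * (1 + 2 * C * (1 / 2 ^ n)) ^ m"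
        unfolding abs_mult using Suc.IH[of b] Suc.prems \<psi> pos by (intro mult_mono) auto
      then show "\<bar>\<psi> (2 ^ n - Suc m) a b * backward n \<psi> m b\<bar> \<le> (1 + 2 * C * (1 / 2 ^ n)) ^ m" by simp
    qed
    then show ?case unfolding e grid_Suc by (simp add: algebra_simps)
  qed simp
  also have "\<dots> \<le> exp (2 * C * (1 / 2 ^ n)) ^ m"
    using pos by (intro power_mono exp_ge_add_one_self) auto
  also have "\<dots> = exp (2 * C * (real m / 2 ^ n))" by (simp flip: exp_of_nat_mult)
  also have "\<dots> \<le> exp (2 * C * 1)"
  proof -
    have "real m \<le> 2 ^ n" using assms(2) by (metis of_nat_le_iff of_nat_numeral of_nat_power)
    then show ?thesis unfolding exp_le_cancel_iff using R.C_nonneg by (intro mult_left_mono) auto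
  qed
  finally show ?thesis by simp
qed

text \<open>Both integrals are compared with the same number \<open>U 0 x * measure R A\<close>;
  fixing the initial state on \<open>A\<close> makes the starting value of \<open>U\<close> a
  constant. That \<open>K\<close> depends neither on \<open>n\<close> nor on \<open>\<psi>\<close>
  matters, since \<open>\<psi>\<close> will vary with the level.\<close>

lemma grid_comparison:
  assumes AR: "A \<in> sets (path_field E {0..0})" "emeasure R A < \<infinity>" "emeasure S A < \<infinity>"
    and Ax: "A \<subseteq> {\<omega>. \<omega> 0 = x}" and eq: "measure R A = measure S A"
  shows "\<exists>K. \<forall>n \<psi>. (\<forall>i a b. \<bar>\<psi> i a b\<bar> \<le> 1) \<longrightarrow>
    \<bar>(LINT \<omega>:A|S. (\<Prod>j=0..<2^n. \<psi> j (\<omega> (grid n j)) (\<omega> (grid n (Suc j))))) -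
     (LINT \<omega>:A|R. (\<Prod>j=0..<2^n. slow (\<omega> (grid n j)) (\<omega> (grid n (Suc j))) *
        exp (saved (grid n j) (grid n (Suc j)) (\<omega> (grid n j))) * \<psi> j (\<omega> (grid n j)) (\<omega> (grid n (Suc j)))))\<bar>
    \<le> K * (1 / 2 ^ n)"
proof -
  define B where "B = exp (2 * C)"
  define M where "M = measure R A"
  define K where "K = 8 * B * C\<^sup>2 * M + exp C * (3 * B * C\<^sup>2 * exp C + 8 * (exp C * B) * C\<^sup>2) * M"
  have "\<bar>(LINT \<omega>:A|S. (\<Prod>j=0..<2^n. \<psi> j (\<omega> (grid n j)) (\<omega> (grid n (Suc j))))) -
     (LINT \<omega>:A|R. (\<Prod>j=0..<2^n. slow (\<omega> (grid n j)) (\<omega> (grid n (Suc j))) *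
        exp (saved (grid n j) (grid n (Suc j)) (\<omega> (grid n j))) * \<psi> j (\<omega> (grid n j)) (\<omega> (grid n (Suc j)))))\<bar>
    \<le> K * (1 / 2 ^ n)" if \<psi>: "\<And>i a b. \<bar>\<psi> i a b\<bar> \<le> 1" for n \<psi>
  proof -
    let ?h = "1 / 2 ^ n :: real"
    have h: "0 \<le> ?h" "?h \<le> 1" by simp_all
    have B: "0 \<le> B" by (simp add: B_def)
    have CC: "0 \<le> C" by (rule R.C_nonneg)
    define U where "U = (\<lambda>i. backward n \<psi> (2 ^ n - i))"
    have Ub: "\<bar>U i a\<bar> \<le> B" for i a
      unfolding U_def B_def by (rule backward_bound[OF \<psi>]) simp
    have U1: "U (2 ^ n) a = 1" for a by (simp add: U_def)
    have Ustep: "S.mean_step (grid n i) (grid n (Suc i)) (\<lambda>a b. \<psi> i a b * U (Suc i) b) a = U i a"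
      if "i < 2 ^ n" for i a
    proof -
      define N :: nat where "N = 2 ^ n"
      have "i < N" using that by (simp add: N_def)
      then obtain m where m: "N - i = Suc m" "N - Suc i = m" "N - Suc m = i" "N - m = Suc i"
        by (intro that[of "N - Suc i"]) auto
      show ?thesis unfolding U_def m[unfolded N_def] backward.simps ..
    qed
    let ?P = "\<lambda>\<omega>. \<Prod>j=0..<2^n. \<psi> j (\<omega> (grid n j)) (\<omega> (grid n (Suc j)))"
    let ?w = "\<lambda>j a b. slow a b * exp (saved (grid n j) (grid n (Suc j)) a) * \<psi> j a b"
    let ?P' = "\<lambda>\<omega>. \<Prod>j=0..<2^n. ?w j (\<omega> (grid n j)) (\<omega> (grid n (Suc j)))"
    have A': "A \<in> sets (path_field E {0..grid n 0})" using AR by simp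
    \<comment> \<open>Under \<open>S\<close> the weights are at most 1 and \<open>U\<close> solves
      the recursion exactly, so only the one-step errors remain.\<close>
    have l1: "\<bar>LINT \<omega>:A|S. ?P \<omega> - U 0 (\<omega> (grid n 0))\<bar>
      \<le> real (2 ^ n) * 1 ^ (2 ^ n) * (0 + 8 * (1 * B) * C\<^sup>2 * (1 / 2 ^ n)\<^sup>2) * measure S A"
      by (rule S.grid_expansion[where w = \<psi> and \<beta> = 1 and U = U and B = B and n = n and \<eta> = 0 and i = 0
          and k = "2 ^ n" and A = A]) (use A' AR in \<open>simp_all add: Ustep \<psi> Ub U1\<close>)
    have wb: "\<bar>?w i a b\<bar> \<le> exp (C * ?h)" if "i < 2 ^ n" for i a b
    proof -
      have st: "0 \<le> grid n i" "grid n i \<le> grid n (Suc i)" "grid n (Suc i) \<le> 1"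
        using grid_bounds[of i n] grid_bounds[of "Suc i" n] grid_mono[of i "Suc i" n] that by auto
      have "\<bar>?w i a b\<bar> = slow a b * exp (saved (grid n i) (grid n (Suc i)) a) * \<bar>\<psi> i a b\<bar>"
        using slow_bounds[of a b] by (simp add: abs_mult)
      also have "\<dots> \<le> 1 * exp (C * ?h) * 1"
        using slow_bounds[of a b] \<psi>[of i a b] saved_bounds[OF st, of a] by (intro mult_mono) (auto simp: grid_Suc)
      finally show ?thesis by simp
    qed
    have e1: "1 \<le> exp (C * ?h)" using CC by simp
    have ehC: "exp (C * ?h) \<le> exp C" using mult_left_mono[OF h(2) CC] by simp
    have defect: "\<bar>R.mean_step (grid n i) (grid n (Suc i)) (\<lambda>a b. ?w i a b * U (Suc i) b) a - U i a\<bar>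
        \<le> 3 * B * C\<^sup>2 * exp C * ?h\<^sup>2" if i: "i < 2 ^ n" for i a
    proof -
      have st: "0 \<le> grid n i" "grid n i \<le> grid n (Suc i)" "grid n (Suc i) \<le> 1"
        using grid_bounds[of i n] grid_bounds[of "Suc i" n] grid_mono[of i "Suc i" n] i by auto
      have v: "\<bar>\<psi> i a b * U (Suc i) b\<bar> \<le> B" for b
        using mult_mono[OF \<psi>[of i a b] Ub[of "Suc i" b]] by (simp add: abs_mult)
      have "\<bar>R.mean_step (grid n i) (grid n (Suc i)) (\<lambda>a b. ?w i a b * U (Suc i) b) a - U i a\<bar> \<le>
        3 * B * (C * (grid n (Suc i) - grid n i))\<^sup>2 * exp (C * (grid n (Suc i) - grid n i))"
        using mean_step_defect[where v = "\<lambda>a b. \<psi> i a b * U (Suc i) b" and a = a, OF st v]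
        by (simp add: mult.assoc Ustep[OF i])
      also have "\<dots> = 3 * B * C\<^sup>2 * ?h\<^sup>2 * exp (C * ?h)" by (simp add: grid_Suc power_mult_distrib power_divide)
      also have "\<dots> \<le> 3 * B * C\<^sup>2 * ?h\<^sup>2 * exp C" using ehC B by (intro mult_left_mono) auto
      finally show ?thesis by (simp add: mult_ac)
    qed
    have l2: "\<bar>LINT \<omega>:A|R. ?P' \<omega> - U 0 (\<omega> (grid n 0))\<bar>
      \<le> real (2 ^ n) * exp (C * ?h) ^ (2 ^ n) * (3 * B * C\<^sup>2 * exp C * ?h\<^sup>2 +
          8 * (exp (C * ?h) * B) * C\<^sup>2 * (1 / 2 ^ n)\<^sup>2) * measure R A"
      by (rule R.grid_expansion[where w = ?w and \<beta> = "exp (C * ?h)" and U = U and B = B and n = n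
          and \<eta> = "3 * B * C\<^sup>2 * exp C * ?h\<^sup>2" and i = 0 and k = "2 ^ n" and A = A,
          OF wb e1 Ub U1 defect _ A' AR(2)]) simp_all
    also have "\<dots> \<le> real (2 ^ n) * exp C * (3 * B * C\<^sup>2 * exp C * ?h\<^sup>2 +
          8 * (exp C * B) * C\<^sup>2 * (1 / 2 ^ n)\<^sup>2) * measure R A"
    proof -
      \<comment> \<open>The weight bound is tied to the mesh, so that its product over all steps
        does not grow with \<open>n\<close>.\<close>
      have "exp (C * ?h) ^ (2 ^ n) = exp C" by (simp flip: exp_of_nat_mult)
      then show ?thesis using ehC B by (intro mult_right_mono mult_mono add_mono) auto
    qed
    also have "\<dots> = exp C * (3 * B * C\<^sup>2 * exp C + 8 * (exp C * B) * C\<^sup>2) * M * ?h"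
      unfolding M_def by (simp add: power2_eq_square field_simps)
    finally have l2: "\<bar>LINT \<omega>:A|R. ?P' \<omega> - U 0 (\<omega> (grid n 0))\<bar> \<le>
        exp C * (3 * B * C\<^sup>2 * exp C + 8 * (exp C * B) * C\<^sup>2) * M * ?h" .
    have l1: "\<bar>LINT \<omega>:A|S. ?P \<omega> - U 0 (\<omega> (grid n 0))\<bar> \<le> 8 * B * C\<^sup>2 * M * ?h"
      using l1 by (simp add: M_def eq power2_eq_square field_simps)
    have AQ: "A \<in> sets R" "A \<in> sets S" using R.past_sets[OF AR(1)] S.past_sets[OF AR(1)] by simp_all
    have Pm: "?P \<in> borel_measurable S" "?P' \<in> borel_measurable R"
      by (intro borel_measurable_prod S.measurable_X2 R.measurable_X2)+
    have Pb: "\<bar>?P \<omega>\<bar> \<le> 1" for \<omega>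
      unfolding abs_prod by (intro prod_le_1) (simp add: \<psi>)
    have P'b: "\<bar>?P' \<omega>\<bar> \<le> (\<Prod>j=0..<(2::nat)^n. exp (C * ?h))" for \<omega>
      unfolding abs_prod by (intro prod_mono) (use wb in auto)
    have iS: "set_integrable S A ?P"
      by (rule set_integrable_bounded[OF AQ(2) AR(3) Pm(1) Pb])
    have iR: "set_integrable R A ?P'"
      by (rule set_integrable_bounded[OF AQ(1) AR(2) Pm(2) P'b])
    have US: "(LINT \<omega>:A|S. ?P \<omega> - U 0 (\<omega> (grid n 0))) = (LINT \<omega>:A|S. ?P \<omega>) - U 0 x * measure S A"
    proof -
      have "(LINT \<omega>:A|S. ?P \<omega> - U 0 (\<omega> (grid n 0))) = (LINT \<omega>:A|S. ?P \<omega> - U 0 x)"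
        using AQ Ax by (intro set_lebesgue_integral_cong) auto
      also have "\<dots> = (LINT \<omega>:A|S. ?P \<omega>) - (LINT \<omega>:A|S. U 0 x)"
        by (intro set_integral_diff iS set_integrable_bounded[OF AQ(2) AR(3) _ order_refl]) simp
      finally show ?thesis using set_integral_const_finite[OF AQ(2) AR(3), of "U 0 x"] by simp
    qed
    have UR: "(LINT \<omega>:A|R. ?P' \<omega> - U 0 (\<omega> (grid n 0))) = (LINT \<omega>:A|R. ?P' \<omega>) - U 0 x * measure R A"
    proof -
      have "(LINT \<omega>:A|R. ?P' \<omega> - U 0 (\<omega> (grid n 0))) = (LINT \<omega>:A|R. ?P' \<omega> - U 0 x)"
        using AQ Ax by (intro set_lebesgue_integral_cong) auto
      also have "\<dots> = (LINT \<omega>:A|R. ?P' \<omega>) - (LINT \<omega>:A|R. U 0 x)"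
        by (intro set_integral_diff iR set_integrable_bounded[OF AQ(1) AR(2) _ order_refl]) simp
      finally show ?thesis using set_integral_const_finite[OF AQ(1) AR(2), of "U 0 x"] by simp
    qed
    have "\<bar>(LINT \<omega>:A|S. ?P \<omega>) - (LINT \<omega>:A|R. ?P' \<omega>)\<bar> \<le> 8 * B * C\<^sup>2 * M * ?h +
        exp C * (3 * B * C\<^sup>2 * exp C + 8 * (exp C * B) * C\<^sup>2) * M * ?h"
      using l1 l2 unfolding US UR eq by linarith
    then show ?thesis by (simp only: K_def distrib_right)
  qed
  then show ?thesis by blast
qed

end

section \<open>From grid weights to the density along a path\<close>

lemma set_integral_Icc_split:
  fixes f :: "real \<Rightarrow> real"
  assumes "a \<le> b" "b \<le> c" "set_integrable lborel {a..c} f"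
  shows "(LINT r:{a..c}|lborel. f r) = (LINT r:{a..b}|lborel. f r) + (LINT r:{b..c}|lborel. f r)"
proof -
  have i: "set_integrable lborel {a..b} f" "set_integrable lborel {b<..c} f"
    using assms by (auto intro: set_integrable_subset[OF assms(3)])
  have "{a..c} = {a..b} \<union> {b<..c}" using assms by auto
  then have "(LINT r:{a..c}|lborel. f r) = (LINT r:{a..b}|lborel. f r) + (LINT r:{b<..c}|lborel. f r)"
    using i by (simp add: set_integral_Un disjoint_iff)
  also have "(LINT r:{b<..c}|lborel. f r) = (LINT r:{b..c}|lborel. f r)"
    by (rule set_integral_discrete_difference[where X = "{b}"]) auto
  finally show ?thesis .
qed

lemma set_integral_grid:
  fixes f :: "real \<Rightarrow> real"
  assumes "set_integrable lborel {0..1} f"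
  shows "(\<Sum>j<2^n. LINT r:{grid n j..grid n (Suc j)}|lborel. f r) = (LINT r:{0..1}|lborel. f r)"
proof -
  have "(\<Sum>j<m. LINT r:{grid n j..grid n (Suc j)}|lborel. f r) = (LINT r:{0..grid n m}|lborel. f r)"
    if "m \<le> 2 ^ n" for m
    using that
  proof (induction m)
    case 0
    have "(LINT r:{0..0}|lborel. f r) = (LINT r:{}|lborel. f r)"
      by (rule set_integral_discrete_difference[where X = "{0}"]) auto
    then show ?case by (simp add: set_lebesgue_integral_def)
  next
    case (Suc m)
    have "set_integrable lborel {0..grid n (Suc m)} f"
      by (rule set_integrable_subset[OF assms]) (use grid_bounds[OF Suc.prems] in auto)
    from set_integral_Icc_split[OF _ _ this, of "grid n m"] show ?case
      using Suc grid_bounds[of m n] grid_mono[of m "Suc m" n] by simp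
  qed
  from this[of "2 ^ n"] show ?thesis by simp
qed

context slowed_process
begin

definition weight :: "(real \<Rightarrow> 'a) \<Rightarrow> real" where
  "weight \<omega> = exp (- ln (real k) * path_length d \<omega>) * exp (LINT r:{0..1}|lborel. saved_rate r (\<omega> r))"

definition grid_weight :: "nat \<Rightarrow> (real \<Rightarrow> 'a) \<Rightarrow> real" where
  "grid_weight n \<omega> = (\<Prod>j=0..<2^n. slow (\<omega> (grid n j)) (\<omega> (grid n (Suc j))) *
     exp (saved (grid n j) (grid n (Suc j)) (\<omega> (grid n j))))"

lemma saved_rate_integrable:
  "\<omega> \<in> paths E \<Longrightarrow> 0 \<le> s \<Longrightarrow> t \<le> 1 \<Longrightarrow> set_integrable lborel {s..t} (\<lambda>r. saved_rate r (\<omega> r))"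
  using saved_rate_bounds
  by (intro R.integrable_along_path[where K = C] saved_rate_measurable)
    (auto simp: R.space_Q abs_le_iff intro: order_trans[of _ 0])

lemma saved_rate_integrable_const:
  "0 \<le> s \<Longrightarrow> t \<le> 1 \<Longrightarrow> set_integrable lborel {s..t} (\<lambda>r. saved_rate r a)"
  unfolding saved_rate_def by (intro set_integral_diff R.rate_integrable S.rate_integrable)

lemma saved_sum_error:
  assumes \<omega>: "\<omega> \<in> paths E"
  shows "\<bar>(\<Sum>j<2^n. saved (grid n j) (grid n (Suc j)) (\<omega> (grid n j))) - (LINT r:{0..1}|lborel. saved_rate r (\<omega> r))\<bar>
    \<le> C * card (jump_times \<omega>) * (1 / 2 ^ n)"
proof -
  let ?I = "\<lambda>j. {grid n j..grid n (Suc j)}"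
  \<comment> \<open>Counts the jumps in a cell as a sum of ones, the form in which
    \<open>sum_grid_cells\<close> adds the cells up.\<close>
  let ?c = "\<lambda>j. \<Sum>\<tau>\<in>{grid n j<..grid n (Suc j)} \<inter> jump_times \<omega>. 1 :: real"
  have cell: "\<bar>saved (grid n j) (grid n (Suc j)) (\<omega> (grid n j)) - (LINT r:?I j|lborel. saved_rate r (\<omega> r))\<bar>
      \<le> C * (1 / 2 ^ n) * ?c j" if j: "j < 2 ^ n" for j
  proof -
    have st: "0 \<le> grid n j" "grid n j \<le> grid n (Suc j)" "grid n (Suc j) \<le> 1"
      using grid_bounds[of j n] grid_bounds[of "Suc j" n] grid_mono[of j "Suc j" n] j by auto
    have eq: "saved (grid n j) (grid n (Suc j)) (\<omega> (grid n j)) - (LINT r:?I j|lborel. saved_rate r (\<omega> r)) =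
        (LINT r:?I j|lborel. saved_rate r (\<omega> (grid n j)) - saved_rate r (\<omega> r))"
      unfolding saved_def using st \<omega>
      by (intro set_integral_diff(2)[symmetric] saved_rate_integrable saved_rate_integrable_const) auto
    show ?thesis
    proof (cases "{grid n j<..grid n (Suc j)} \<inter> jump_times \<omega> = {}")
      case True
      have const: "\<omega> r = \<omega> (grid n j)" if "r \<in> ?I j" for r
      proof -
        have "{grid n j<..r} \<inter> jump_times \<omega> \<subseteq> {grid n j<..grid n (Suc j)} \<inter> jump_times \<omega>"
          using that by auto
        with True have "{grid n j<..r} \<inter> jump_times \<omega> = {}" by simp
        then show ?thesis using st that by (intro path_const[OF \<omega>]) auto
      qed
      have "(LINT r:?I j|lborel. saved_rate r (\<omega> (grid n j)) - saved_rate r (\<omega> r)) = (LINT r:?I j|lborel. 0)"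
      proof (intro set_lebesgue_integral_cong allI impI)
        fix r assume "r \<in> ?I j"
        from const[OF this] show "saved_rate r (\<omega> (grid n j)) - saved_rate r (\<omega> r) = 0" by simp
      qed simp
      also have "\<dots> = 0" by (simp add: set_lebesgue_integral_def)
      finally show ?thesis unfolding eq using True by (simp only: abs_zero sum.empty mult_zero_right)
    next
      case False
      then obtain \<tau> where "\<tau> \<in> {grid n j<..grid n (Suc j)} \<inter> jump_times \<omega>" by blast
      then have c1: "1 \<le> ?c j"
        using path_jump_times(1)[OF \<omega>] member_le_sum[of \<tau> "{grid n j<..grid n (Suc j)} \<inter> jump_times \<omega>" "\<lambda>_. 1 :: real"]
        by simp
      have "\<bar>LINT r:?I j|lborel. saved_rate r (\<omega> (grid n j)) - saved_rate r (\<omega> r)\<bar> \<le> C * measure lborel (?I j)"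
      proof (rule set_integral_bound)
        fix r assume "r \<in> ?I j"
        then have "r \<in> {0..1}" using st by auto
        then show "\<bar>saved_rate r (\<omega> (grid n j)) - saved_rate r (\<omega> r)\<bar> \<le> C"
          using saved_rate_bounds[of r "\<omega> (grid n j)"] saved_rate_bounds[of r "\<omega> r"] by simp
      qed (auto simp: emeasure_lborel_Icc_eq)
      also have "\<dots> = C * (1 / 2 ^ n) * 1" using st by (simp add: grid_Suc)
      also have "\<dots> \<le> C * (1 / 2 ^ n) * ?c j"
        using R.C_nonneg by (intro mult_left_mono c1) auto
      finally show ?thesis unfolding eq .
    qed
  qed
  have total: "(\<Sum>j<2^n. saved (grid n j) (grid n (Suc j)) (\<omega> (grid n j))) - (LINT r:{0..1}|lborel. saved_rate r (\<omega> r)) =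
    (\<Sum>j<2^n. saved (grid n j) (grid n (Suc j)) (\<omega> (grid n j)) - (LINT r:?I j|lborel. saved_rate r (\<omega> r)))"
    using set_integral_grid[where f = "\<lambda>r. saved_rate r (\<omega> r)" and n = n, OF saved_rate_integrable[OF \<omega>]]
    by (simp add: sum_subtractf)
  have "\<bar>\<Sum>j<2^n. saved (grid n j) (grid n (Suc j)) (\<omega> (grid n j)) - (LINT r:?I j|lborel. saved_rate r (\<omega> r))\<bar>
      \<le> (\<Sum>j<2^n. C * (1 / 2 ^ n) * ?c j)"
    by (rule order_trans[OF sum_abs]) (intro sum_mono cell, simp)
  moreover have "(\<Sum>j<2^n. C * (1 / 2 ^ n) * ?c j) = C * (1 / 2 ^ n) * (\<Sum>j<2^n. ?c j)"
    by (rule sum_distrib_left[symmetric])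
  moreover have "(\<Sum>j<2^n. ?c j) = card (jump_times \<omega>)"
    using sum_grid_cells[OF path_jump_times(1)[OF \<omega>] jump_times_subset, where n = n and f = "\<lambda>_. 1"] by simp
  ultimately show ?thesis unfolding total by (simp only: mult_ac)
qed

lemma grid_weight_eq:
  "grid_weight n \<omega> = exp (- ln (real k) * (\<Sum>j<2^n. d (\<omega> (grid n j)) (\<omega> (grid n (Suc j))))) *
     exp (\<Sum>j<2^n. saved (grid n j) (grid n (Suc j)) (\<omega> (grid n j)))"
  unfolding grid_weight_def slow_def prod.distrib exp_sum[OF finite_lessThan] sum_distrib_left
  by (simp add: atLeast0LessThan)

lemma grid_weight_tendsto:
  assumes \<omega>: "\<omega> \<in> paths E"
  shows "(\<lambda>n. grid_weight n \<omega>) \<longlonglongrightarrow> weight \<omega>"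
proof -
  have "(\<lambda>n. \<Sum>j<2^n. d (\<omega> (grid n j)) (\<omega> (grid n (Suc j)))) \<longlonglongrightarrow> path_length d \<omega>"
    by (intro tendsto_eventually eventually_path_length_grid[OF \<omega>] d_refl)
  moreover have "(\<lambda>n. \<Sum>j<2^n. saved (grid n j) (grid n (Suc j)) (\<omega> (grid n j))) \<longlonglongrightarrow>
      (LINT r:{0..1}|lborel. saved_rate r (\<omega> r))"
  proof (rule LIM_zero_cancel, rule tendsto_0_le[where K = 1])
    have "(\<lambda>n. C * card (jump_times \<omega>) * (1 / 2) ^ n) \<longlonglongrightarrow> C * card (jump_times \<omega>) * 0"
      by (intro tendsto_intros LIMSEQ_realpow_zero) auto
    then show "(\<lambda>n. C * card (jump_times \<omega>) * (1 / 2 ^ n)) \<longlonglongrightarrow> 0"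
      by (simp add: power_one_over)
    show "\<forall>\<^sub>F n in sequentially. norm ((\<Sum>j<2^n. saved (grid n j) (grid n (Suc j)) (\<omega> (grid n j))) -
        (LINT r:{0..1}|lborel. saved_rate r (\<omega> r))) \<le> norm (C * card (jump_times \<omega>) * (1 / 2 ^ n)) * 1"
      unfolding real_norm_def mult_1_right
      by (intro always_eventually allI order_trans[OF saved_sum_error[OF \<omega>] abs_ge_self])
  qed
  ultimately show ?thesis
    unfolding grid_weight_eq weight_def by (intro tendsto_intros)
qed

text \<open>Provides the constant, independent of \<open>n\<close>, for dominated convergence of the
  grid weights.\<close>

lemma grid_weight_bounds: "0 \<le> grid_weight n \<omega>" "grid_weight n \<omega> \<le> exp C"
proof -
  have f: "0 \<le> slow a b * exp (saved (grid n j) (grid n (Suc j)) a)"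
    "slow a b * exp (saved (grid n j) (grid n (Suc j)) a) \<le> exp (C * (1 / 2 ^ n))" if "j < 2 ^ n" for j a b
  proof -
    have st: "0 \<le> grid n j" "grid n j \<le> grid n (Suc j)" "grid n (Suc j) \<le> 1"
      using grid_bounds[of j n] grid_bounds[of "Suc j" n] grid_mono[of j "Suc j" n] that by auto
    show "0 \<le> slow a b * exp (saved (grid n j) (grid n (Suc j)) a)" using slow_bounds by simp
    have "slow a b * exp (saved (grid n j) (grid n (Suc j)) a) \<le> 1 * exp (C * (1 / 2 ^ n))"
      using slow_bounds[of a b] saved_bounds[OF st, of a] by (intro mult_mono) (auto simp: grid_Suc)
    then show "slow a b * exp (saved (grid n j) (grid n (Suc j)) a) \<le> exp (C * (1 / 2 ^ n))" by simp
  qed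
  show "0 \<le> grid_weight n \<omega>" unfolding grid_weight_def using f by (intro prod_nonneg) auto
  have "grid_weight n \<omega> \<le> (\<Prod>j=0..<(2::nat)^n. exp (C * (1 / 2 ^ n)))"
    unfolding grid_weight_def using f by (intro prod_mono) auto
  also have "\<dots> = exp C" by (simp flip: exp_of_nat_mult)
  finally show "grid_weight n \<omega> \<le> exp C" .
qed

lemma grid_weight_measurable: "grid_weight n \<in> borel_measurable R"
  unfolding grid_weight_def by (intro borel_measurable_prod R.measurable_X2)

lemma weight_measurable: "weight \<in> borel_measurable R"
  by (rule borel_measurable_LIMSEQ_real[where u = grid_weight, OF _ grid_weight_measurable])
    (simp add: R.space_Q grid_weight_tendsto)

lemma weight_nonneg: "0 \<le> weight \<omega>"
  by (simp add: weight_def)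

lemma weight_le: "\<omega> \<in> paths E \<Longrightarrow> weight \<omega> \<le> exp C"
  by (rule LIMSEQ_le_const2[OF grid_weight_tendsto]) (auto intro: grid_weight_bounds)

text \<open>The left side does not involve the grid. From the level of the cylinder on it differs by
  at most \<open>K / 2 ^ n\<close> from the integral of the grid weight, whose limit follows by
  dominated convergence.\<close>

lemma measure_cylinder:
  assumes A: "A \<in> sets (path_field E {0..0})" "emeasure R A < \<infinity>" "emeasure S A < \<infinity>"
    and Ax: "A \<subseteq> {\<omega>. \<omega> 0 = x}" and eq: "measure R A = measure S A"
    and c: "c \<in> cylinders E"
  shows "measure S (A \<inter> c) = (LINT \<omega>:A|R. weight \<omega> * indicator c \<omega>)"
proof -
  obtain T F n0 where T: "c = {\<omega> \<in> paths E. \<forall>t\<in>T. \<omega> t \<in> F t}" "finite T" "T \<subseteq> grid n0 ` {..2 ^ n0}"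
    using cylindersE[OF c] .
  obtain K where K: "\<And>n \<psi>. (\<forall>i a b. \<bar>\<psi> i a b\<bar> \<le> 1) \<Longrightarrow>
    \<bar>(LINT \<omega>:A|S. (\<Prod>j=0..<2^n. \<psi> j (\<omega> (grid n j)) (\<omega> (grid n (Suc j))))) -
     (LINT \<omega>:A|R. (\<Prod>j=0..<2^n. slow (\<omega> (grid n j)) (\<omega> (grid n (Suc j))) *
        exp (saved (grid n j) (grid n (Suc j)) (\<omega> (grid n j))) * \<psi> j (\<omega> (grid n j)) (\<omega> (grid n (Suc j)))))\<bar>
    \<le> K * (1 / 2 ^ n)"
    using grid_comparison[OF A Ax eq] by blast
  have AR: "A \<in> sets R" and AS: "A \<in> sets S" using R.past_sets[OF A(1)] S.past_sets[OF A(1)] by simp_all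
  have cs: "c \<in> sets (path_field E {0..1})"
    unfolding sets_path_field_cylinders using c by (rule sigma_sets.Basic)
  then have cR [measurable]: "c \<in> sets R" and cS: "c \<in> sets S" by (simp_all add: R.sets_Q S.sets_Q)
  \<comment> \<open>The indicator of the cylinder is written as a product over grid steps. Both ends
    of a step are tested because the final time 1 occurs only as a right end; testing inner times
    twice is harmless.\<close>
  define \<psi> where "\<psi> = (\<lambda>n j a b. if (grid n j \<in> T \<longrightarrow> a \<in> F (grid n j)) \<and>
      (grid n (Suc j) \<in> T \<longrightarrow> b \<in> F (grid n (Suc j))) then 1 else 0 :: real)"
  have \<psi>: "\<forall>i a b. \<bar>\<psi> n i a b\<bar> \<le> 1" for n by (simp add: \<psi>_def)
  have prod\<psi>: "(\<Prod>j=0..<2^n. \<psi> n j (\<omega> (grid n j)) (\<omega> (grid n (Suc j)))) = indicator c \<omega>"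
    if n: "n0 \<le> n" and \<omega>: "\<omega> \<in> paths E" for n \<omega>
  proof (cases "\<forall>t\<in>T. \<omega> t \<in> F t")
    case True
    then show ?thesis using \<omega> by (simp add: T(1) \<psi>_def)
  next
    case False
    then obtain t where t: "t \<in> T" "\<omega> t \<notin> F t" by blast
    then obtain i where i: "t = grid n i" "i \<le> 2 ^ n" using T(3) grid_subset[OF n] by blast
    have "\<exists>j\<in>{0..<2^n}. \<psi> n j (\<omega> (grid n j)) (\<omega> (grid n (Suc j))) = 0"
    proof (cases "i < 2 ^ n")
      case True
      then show ?thesis using t i by (intro bexI[of _ i]) (auto simp: \<psi>_def)
    next
      case False
      obtain j where j: "i = Suc j" using False by (cases i) auto
      then show ?thesis using t i by (intro bexI[of _ j]) (auto simp: \<psi>_def)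
    qed
    then have "(\<Prod>j=0..<2^n. \<psi> n j (\<omega> (grid n j)) (\<omega> (grid n (Suc j)))) = 0"
      by (intro prod_zero) auto
    moreover have "\<omega> \<notin> c" using t T(1) by auto
    ultimately show ?thesis by simp
  qed
  have bound: "\<bar>measure S (A \<inter> c) - (LINT \<omega>:A|R. grid_weight n \<omega> * indicator c \<omega>)\<bar> \<le> K * (1 / 2 ^ n)"
    if n: "n0 \<le> n" for n
  proof -
    have 1: "(LINT \<omega>:A|S. (\<Prod>j=0..<2^n. \<psi> n j (\<omega> (grid n j)) (\<omega> (grid n (Suc j))))) = measure S (A \<inter> c)"
    proof -
      have "(LINT \<omega>:A|S. (\<Prod>j=0..<2^n. \<psi> n j (\<omega> (grid n j)) (\<omega> (grid n (Suc j))))) = (LINT \<omega>|S. indicator (A \<inter> c) \<omega>)"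
        unfolding set_lebesgue_integral_def
        by (intro Bochner_Integration.integral_cong) (auto simp: S.space_Q prod\<psi>[OF n] indicator_inter_arith)
      also have "\<dots> = measure S (A \<inter> c \<inter> space S)" by simp
      also have "A \<inter> c \<inter> space S = A \<inter> c" using sets.sets_into_space[OF AS] by auto
      finally show ?thesis .
    qed
    have 2: "(LINT \<omega>:A|R. (\<Prod>j=0..<2^n. slow (\<omega> (grid n j)) (\<omega> (grid n (Suc j))) *
        exp (saved (grid n j) (grid n (Suc j)) (\<omega> (grid n j))) * \<psi> n j (\<omega> (grid n j)) (\<omega> (grid n (Suc j))))) =
        (LINT \<omega>:A|R. grid_weight n \<omega> * indicator c \<omega>)"
      using AR sets.sets_into_space[OF AR] n
      by (intro set_lebesgue_integral_cong) (auto simp: R.space_Q grid_weight_def prod.distrib prod\<psi>[symmetric])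
    show ?thesis using K[OF \<psi>, of n n] unfolding 1 2 .
  qed
  have "(\<lambda>n. LINT \<omega>:A|R. grid_weight n \<omega> * indicator c \<omega>) \<longlonglongrightarrow> (LINT \<omega>:A|R. weight \<omega> * indicator c \<omega>)"
    unfolding set_lebesgue_integral_def
  proof (rule integral_dominated_convergence[where w = "\<lambda>\<omega>. indicator A \<omega> * exp C"])
    note [measurable] = weight_measurable grid_weight_measurable AR
    show "(\<lambda>\<omega>. indicat_real A \<omega> *\<^sub>R (weight \<omega> * indicat_real c \<omega>)) \<in> borel_measurable R" by measurable
    show "(\<lambda>\<omega>. indicat_real A \<omega> *\<^sub>R (grid_weight n \<omega> * indicat_real c \<omega>)) \<in> borel_measurable R" for n by measurable
    show "integrable R (\<lambda>\<omega>. indicat_real A \<omega> * exp C)"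
      using AR A(2) by (intro integrable_mult_left) (simp add: integrable_indicator_iff)
    show "AE \<omega> in R. (\<lambda>n. indicat_real A \<omega> *\<^sub>R (grid_weight n \<omega> * indicat_real c \<omega>)) \<longlonglongrightarrow>
        indicat_real A \<omega> *\<^sub>R (weight \<omega> * indicat_real c \<omega>)"
      by (intro AE_I2 tendsto_intros grid_weight_tendsto) (simp add: R.space_Q)
    show "AE \<omega> in R. norm (indicat_real A \<omega> *\<^sub>R (grid_weight n \<omega> * indicat_real c \<omega>)) \<le> indicat_real A \<omega> * exp C" for n
      using grid_weight_bounds by (intro AE_I2) (auto simp: indicator_def)
  qed
  moreover have "(\<lambda>n. LINT \<omega>:A|R. grid_weight n \<omega> * indicator c \<omega>) \<longlonglongrightarrow> measure S (A \<inter> c)"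
  proof (rule LIM_zero_cancel, rule tendsto_0_le[where K = 1])
    have "(\<lambda>n. K * (1 / 2) ^ n) \<longlonglongrightarrow> K * 0" by (intro tendsto_intros LIMSEQ_realpow_zero) auto
    then show "(\<lambda>n. K * (1 / 2 ^ n)) \<longlonglongrightarrow> 0" by (simp add: power_one_over)
    show "\<forall>\<^sub>F n in sequentially. norm ((LINT \<omega>:A|R. grid_weight n \<omega> * indicator c \<omega>) - measure S (A \<inter> c))
        \<le> norm (K * (1 / 2 ^ n)) * 1"
      unfolding eventually_sequentially
    proof (intro exI[of _ n0] allI impI)
      fix n assume "n0 \<le> n"
      from bound[OF this] show "norm ((LINT \<omega>:A|R. grid_weight n \<omega> * indicator c \<omega>) - measure S (A \<inter> c))
        \<le> norm (K * (1 / 2 ^ n)) * 1"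
        unfolding real_norm_def mult_1_right abs_minus_commute[of "measure S (A \<inter> c)"] by linarith
    qed
  qed
  ultimately show ?thesis by (rule LIMSEQ_unique[symmetric])
qed

text \<open>Cylinders form a generating pi-system. Restriction to \<open>A\<close> makes both
  measures finite, which the uniqueness theorem needs and which \<open>R\<close> and
  \<open>S\<close> themselves need not satisfy.\<close>

lemma density_eq:
  assumes A: "A \<in> sets (path_field E {0..0})" "emeasure R A < \<infinity>" "emeasure S A < \<infinity>"
    and Ax: "A \<subseteq> {\<omega>. \<omega> 0 = x}" and eq: "measure R A = measure S A"
  shows "density S (\<lambda>\<omega>. ennreal (indicator A \<omega>)) = density R (\<lambda>\<omega>. ennreal (indicator A \<omega> * weight \<omega>))"
proof (rule measure_eqI_generator_eq[where E = "cylinders E" and \<Omega> = "paths E" and A = "\<lambda>_. paths E"])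
  have AR [measurable]: "A \<in> sets R" and AS [measurable]: "A \<in> sets S"
    using R.past_sets[OF A(1)] S.past_sets[OF A(1)] by simp_all
  note [measurable] = weight_measurable
  have em: "emeasure (density S (\<lambda>\<omega>. ennreal (indicator A \<omega>))) c = ennreal (measure S (A \<inter> c))"
    if "c \<in> sets S" for c
  proof -
    have "emeasure (density S (\<lambda>\<omega>. ennreal (indicator A \<omega>))) c =
        (\<integral>\<^sup>+\<omega>. ennreal (indicator A \<omega>) * indicator c \<omega> \<partial>S)"
      using that by (intro emeasure_density) measurable
    also have "\<dots> = (\<integral>\<^sup>+\<omega>. indicator (A \<inter> c) \<omega> \<partial>S)"
      by (intro nn_integral_cong) (auto simp: indicator_def)
    also have "\<dots> = emeasure S (A \<inter> c)" using that AS by simp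
    also have "\<dots> = ennreal (measure S (A \<inter> c))"
      using S.finite_Int[OF AS A(3), of c] by (intro emeasure_eq_ennreal_measure) auto
    finally show ?thesis .
  qed
  show "emeasure (density S (\<lambda>\<omega>. ennreal (indicator A \<omega>))) c =
      emeasure (density R (\<lambda>\<omega>. ennreal (indicator A \<omega> * weight \<omega>))) c" if c: "c \<in> cylinders E" for c
  proof -
    have cs: "c \<in> sets (path_field E {0..1})"
      unfolding sets_path_field_cylinders using c by (rule sigma_sets.Basic)
    then have cR [measurable]: "c \<in> sets R" and cS: "c \<in> sets S" by (simp_all add: R.sets_Q S.sets_Q)
    have "emeasure (density R (\<lambda>\<omega>. ennreal (indicator A \<omega> * weight \<omega>))) c =
       (\<integral>\<^sup>+\<omega>. ennreal (indicator A \<omega> * weight \<omega>) * indicator c \<omega> \<partial>R)"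
      by (rule emeasure_density) measurable
    also have "\<dots> = (\<integral>\<^sup>+\<omega>. ennreal (indicator A \<omega> *\<^sub>R (weight \<omega> * indicator c \<omega>)) \<partial>R)"
      by (intro nn_integral_cong) (auto simp: indicator_def)
    also have "\<dots> = ennreal (LINT \<omega>:A|R. weight \<omega> * indicator c \<omega>)"
      unfolding set_lebesgue_integral_def
    proof (rule nn_integral_eq_integral)
      have "set_integrable R A (\<lambda>\<omega>. weight \<omega> * indicator c \<omega>)"
      proof (rule set_integrable_bounded[OF AR A(2), where K = "exp C"])
        fix \<omega> assume "\<omega> \<in> A"
        then have "\<omega> \<in> paths E" using sets.sets_into_space[OF AR] by (auto simp: R.space_Q)
        then show "\<bar>weight \<omega> * indicator c \<omega>\<bar> \<le> exp C"
          using weight_le[of \<omega>] weight_nonneg[of \<omega>] by (auto simp: indicator_def)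
      qed measurable
      then show "integrable R (\<lambda>\<omega>. indicat_real A \<omega> *\<^sub>R (weight \<omega> * indicat_real c \<omega>))"
        by (simp add: set_integrable_def)
    qed (use weight_nonneg in auto)
    also have "\<dots> = ennreal (measure S (A \<inter> c))"
      using measure_cylinder[OF A Ax eq c] by simp
    finally show ?thesis using em[OF cS] by simp
  qed
  show "emeasure (density S (\<lambda>\<omega>. ennreal (indicator A \<omega>))) (paths E) \<noteq> \<infinity>"
    using em[of "paths E"] sets.top[of S] by (simp add: S.space_Q)
  show "range (\<lambda>_. paths E) \<subseteq> cylinders E"
    using cylindersI[of "{}" 0 E] by auto
  show "cylinders E \<subseteq> Pow (paths E)" by (auto simp: cylinders_def)
qed (simp_all add: Int_stable_cylinders S.sets_Q R.sets_Q sets_path_field_cylinders)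

lemma girsanov_formula:
  fixes f :: "(real \<Rightarrow> 'a) \<Rightarrow> real"
  assumes A: "A \<in> sets (path_field E {0..0})" "emeasure R A < \<infinity>" "emeasure S A < \<infinity>"
    and Ax: "A \<subseteq> {\<omega>. \<omega> 0 = x}" and eq: "measure R A = measure S A"
    and f: "f \<in> borel_measurable (path_field E {0..1})"
  shows "(LINT \<omega>:A|S. f \<omega>) = (LINT \<omega>:A|R. weight \<omega> * f \<omega>)"
proof -
  have AR [measurable]: "A \<in> sets R" and AS [measurable]: "A \<in> sets S"
    using R.past_sets[OF A(1)] S.past_sets[OF A(1)] by simp_all
  note [measurable] = weight_measurable
  have fR [measurable]: "f \<in> borel_measurable R" and fS [measurable]: "f \<in> borel_measurable S"
    using f by (simp_all add: measurable_cong_sets[OF R.sets_Q refl] measurable_cong_sets[OF S.sets_Q refl])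
  have "(LINT \<omega>:A|S. f \<omega>) = integral\<^sup>L (density S (\<lambda>\<omega>. ennreal (indicator A \<omega>))) f"
    unfolding set_lebesgue_integral_def by (rule integral_density[symmetric]) auto
  also have "\<dots> = integral\<^sup>L (density R (\<lambda>\<omega>. ennreal (indicator A \<omega> * weight \<omega>))) f"
    by (simp only: density_eq[OF A Ax eq])
  also have "\<dots> = (LINT \<omega>|R. (indicator A \<omega> * weight \<omega>) *\<^sub>R f \<omega>)"
    by (rule integral_density) (auto simp: weight_nonneg)
  finally show ?thesis by (simp add: set_lebesgue_integral_def mult.assoc)
qed

end

section \<open>Walks, geodesics and bridges\<close>

text \<open>Positivity of \<open>J\<close> is only pointwise, without a uniform lower bound; a
  vanishing integral would make the interval \<open>{s..t}\<close> a null set.\<close>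

lemma (in jump_kernel) kernel_integral_pos:
  assumes st: "0 \<le> s" "s < t" "t \<le> 1" and ab: "E a b" and pos: "\<And>r. r \<in> {0..1} \<Longrightarrow> 0 < J r a b"
  shows "0 < (LINT r:{s..t}|lborel. J r a b)"
proof (rule ccontr)
  assume "\<not> ?thesis"
  then have "(LINT r:{s..t}|lborel. J r a b) = 0"
    using kernel_integral_nonneg[of s t a b] st ab by simp
  moreover have "integrable lborel (\<lambda>r. indicat_real {s..t} r *\<^sub>R J r a b)"
    using kernel_integrable[of s t a b] st ab by (simp add: set_integrable_def)
  moreover have "AE r in lborel. 0 \<le> indicat_real {s..t} r *\<^sub>R J r a b"
    using st pos by (intro AE_I2) (auto simp: indicator_def less_imp_le)
  ultimately have "AE r in lborel. indicat_real {s..t} r *\<^sub>R J r a b = 0"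
    by (simp add: set_lebesgue_integral_def integral_nonneg_eq_0_iff_AE)
  then have "AE r in lborel. r \<notin> {s..t}"
  proof eventually_elim
    case (elim r)
    show ?case
    proof
      assume "r \<in> {s..t}"
      then show False using elim pos[of r] st by simp
    qed
  qed
  then have "emeasure lborel {s..t} = 0"
    using AE_iff_null_sets[of "{s..t}" lborel] by (simp add: null_sets_def)
  then show False using st by (simp add: emeasure_lborel_Icc_eq)
qed

lemma integral_uniform_measure:
  fixes f :: "'b \<Rightarrow> real"
  assumes A: "A \<in> sets M" "emeasure M A \<noteq> 0" "emeasure M A \<noteq> \<infinity>" and f: "f \<in> borel_measurable M"
  shows "integral\<^sup>L (uniform_measure M A) f = (LINT x:A|M. f x) / measure M A"
proof -
  have em: "emeasure M A = ennreal (measure M A)" using A by (simp add: emeasure_eq_ennreal_measure)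
  then have pos: "0 < measure M A" using A(2) by (simp add: zero_less_measure_iff)
  have "indicator A x / emeasure M A = ennreal (indicator A x / measure M A)" for x
    unfolding em using pos divide_ennreal[of 1 "measure M A"] by (simp add: indicator_def)
  then have "uniform_measure M A = density M (\<lambda>x. ennreal (indicator A x / measure M A))"
    unfolding uniform_measure_def by (simp only:)
  also have "integral\<^sup>L \<dots> f = (LINT x|M. (indicator A x / measure M A) *\<^sub>R f x)"
    using A f by (intro integral_density) auto
  also have "\<dots> = (LINT x|M. (indicator A x *\<^sub>R f x) / measure M A)" by simp
  also have "\<dots> = (LINT x:A|M. f x) / measure M A"
    unfolding set_lebesgue_integral_def by (rule integral_divide_zero)
  finally show ?thesis .
qed

text \<open>Only endpoint and length are recorded, not the vertices: the existence of a minimal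
  length requires only finiteness of these pairs.\<close>

inductive walk :: "('a \<Rightarrow> 'a \<Rightarrow> bool) \<Rightarrow> ('a \<Rightarrow> 'a \<Rightarrow> real) \<Rightarrow> 'a \<Rightarrow> 'a \<Rightarrow> real \<Rightarrow> bool"
  for E d x where
  walk_refl: "walk E d x x 0"
| walk_step: "walk E d x a L \<Longrightarrow> E a b \<Longrightarrow> walk E d x b (L + d a b)"

lemma walk_exists:
  assumes "E\<^sup>*\<^sup>* x y"
  shows "\<exists>L. walk E d x y L"
  using assms by induction (auto intro: walk.intros)

text \<open>Every edge costs at least 1, so removing the last one lowers the bound from
  \<open>n + 1\<close> to \<open>n\<close>, and local finiteness leaves finitely many edges to put
  back. Below length 0 only the empty walk remains.\<close>

lemma finite_short_walks:
  assumes fin: "\<And>a. finite {b. E a b}" and d: "\<And>a b. E a b \<Longrightarrow> 1 \<le> d a b"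
  shows "finite {(b, L). walk E d x b L \<and> L \<le> real n}"
proof -
  have nonneg: "0 \<le> L" if "walk E d x b L" for b L
    using that
  proof induction
    case (walk_step a L b)
    then show ?case using d[of a b] by simp
  qed simp
  show ?thesis
  proof (induction n)
    case 0
    have "{(b, L). walk E d x b L \<and> L \<le> real 0} \<subseteq> {(x, 0)}"
    proof clarify
      fix b L assume "walk E d x b L" "L \<le> real 0"
      then show "b = x \<and> L = 0"
      proof cases
        case (walk_step a L')
        then show ?thesis using nonneg[of a L'] d[of a b] \<open>L \<le> real 0\<close> by simp
      qed simp
    qed
    then show ?case by (rule finite_subset) simp
  next
    case (Suc n)
    let ?W = "{(b, L). walk E d x b L \<and> L \<le> real n}"
    let ?V = "insert (x, 0) (\<Union>(a, L)\<in>?W. (\<lambda>b. (b, L + d a b)) ` {b. E a b})"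
    have "{(b, L). walk E d x b L \<and> L \<le> real (Suc n)} \<subseteq> ?V"
    proof clarify
      fix b L assume *: "walk E d x b L" "L \<le> real (Suc n)" "(b, L) \<notin> (\<Union>(a, L)\<in>?W. (\<lambda>b. (b, L + d a b)) ` {b. E a b})"
      from *(1) show "b = x \<and> L = 0"
      proof cases
        case (walk_step a L')
        then have "(a, L') \<in> ?W" using d[of a b] *(2) by simp
        with walk_step *(3) show ?thesis by force
      qed simp
    qed
    moreover have "finite ?V" using Suc fin by auto
    ultimately show ?case by (rule finite_subset)
  qed
qed

text \<open>On a fine enough grid the successive values stay or move along an edge, and their
  distances add up to the length; the nontrivial steps form the walk.\<close>

lemma path_walk:
  fixes \<omega> :: "real \<Rightarrow> 'a::countable"
  assumes \<omega>: "\<omega> \<in> paths E" and d: "\<And>a. d a a = 0"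
  shows "walk E d (\<omega> 0) (\<omega> 1) (path_length d \<omega>)"
proof -
  have "\<forall>\<^sub>F n in sequentially. walk E d (\<omega> 0) (\<omega> 1) (path_length d \<omega>)"
    using eventually_grid_step[where g = d, OF \<omega> d] eventually_path_length_grid[where d = d, OF \<omega> d]
  proof eventually_elim
    case (elim n)
    have "walk E d (\<omega> 0) (\<omega> (grid n m)) (\<Sum>i<m. d (\<omega> (grid n i)) (\<omega> (grid n (Suc i))))" if "m \<le> 2 ^ n" for m
      using that
    proof (induction m)
      case (Suc m)
      then have m: "m < 2 ^ n" by simp
      have IH: "walk E d (\<omega> 0) (\<omega> (grid n m)) (\<Sum>i<m. d (\<omega> (grid n i)) (\<omega> (grid n (Suc i))))"
        using Suc by simp
      show ?case
      proof (cases "\<omega> (grid n (Suc m)) = \<omega> (grid n m)")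
        case True
        then show ?thesis using IH d by simp
      next
        case False
        then have "E (\<omega> (grid n m)) (\<omega> (grid n (Suc m)))" using elim(1) m by blast
        from walk_step[where d = d, OF IH this] show ?thesis by simp
      qed
    qed (simp add: walk_refl)
    from this[of "2 ^ n"] elim(2) show ?case by simp
  qed
  \<comment> \<open>The statement does not mention the level, so holding eventually means
    holding.\<close>
  then show ?thesis by simp
qed

lemma (in jump_process) path_length_measurable:
  assumes "\<And>a. d a a = 0"
  shows "path_length d \<in> borel_measurable Q"
proof (rule borel_measurable_LIMSEQ_real)
  show "(\<lambda>\<omega>. \<Sum>i<2^n. d (\<omega> (grid n i)) (\<omega> (grid n (Suc i)))) \<in> borel_measurable Q" for n
    by (intro borel_measurable_sum measurable_X2)
  show "(\<lambda>n. \<Sum>i<2^n. d (\<omega> (grid n i)) (\<omega> (grid n (Suc i)))) \<longlonglongrightarrow> path_length d \<omega>"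
    if "\<omega> \<in> space Q" for \<omega>
    using that by (intro tendsto_eventually eventually_path_length_grid assms) (simp add: space_Q)
qed

section \<open>The family of slowed processes: mass along walks\<close>

locale slowed_family = R: jump_process E J C R
  for E :: "'a::countable \<Rightarrow> 'a \<Rightarrow> bool" and J C R +
  fixes d :: "'a \<Rightarrow> 'a \<Rightarrow> real" and Rk :: "nat \<Rightarrow> (real \<Rightarrow> 'a) measure" and x y :: 'a
  assumes slowed: "\<And>k. 1 \<le> k \<Longrightarrow> slowed_process E J C R d k (Rk k)"
    and irrefl: "\<And>a. \<not> E a a" and connected: "\<And>a b. E\<^sup>*\<^sup>* a b"
    and kernel_pos: "\<And>t a b. t \<in> {0..1} \<Longrightarrow> E a b \<Longrightarrow> 0 < J t a b"
    and d_refl: "\<And>a. d a a = 0" and d_ge_1: "\<And>a b. a \<noteq> b \<Longrightarrow> 1 \<le> d a b"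
    and d_INF: "\<And>a b. d a b = (INF \<omega>\<in>paths_between E a b. path_length d \<omega>)"
    and start: "\<And>k. 1 \<le> k \<Longrightarrow> emeasure (Rk k) {\<omega> \<in> paths E. \<omega> 0 = x} = emeasure R {\<omega> \<in> paths E. \<omega> 0 = x}"
    and start_finite: "emeasure R {\<omega> \<in> paths E. \<omega> 0 = x} < \<infinity>"
    and start_pos: "0 < emeasure R {\<omega> \<in> paths E. \<omega> 0 = x}"
begin

abbreviation start_set :: "(real \<Rightarrow> 'a) set" where
  "start_set \<equiv> {\<omega> \<in> paths E. \<omega> 0 = x}"

definition bridge_set :: "(real \<Rightarrow> 'a) set" where
  "bridge_set = {\<omega> \<in> paths E. \<omega> 0 = x \<and> \<omega> 1 = y}"

lemma start_set_past: "start_set \<in> sets (path_field E {0..0})"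
  by (rule path_field_coordinate) simp

lemma sets_Rk: "1 \<le> k \<Longrightarrow> sets (Rk k) = sets (path_field E {0..1})"
  using jump_process.sets_Q[OF slowed_process.axioms(2)[OF slowed]] .

lemma bridge_set_sets: "bridge_set \<in> sets (path_field E {0..1})"
proof -
  have "bridge_set = {\<omega> \<in> paths E. \<omega> 0 = x} \<inter> {\<omega> \<in> paths E. \<omega> 1 = y}" by (auto simp: bridge_set_def)
  then show ?thesis by (simp only:) (intro sets.Int path_field_coordinate; simp)
qed

lemma start_measure: "1 \<le> k \<Longrightarrow> measure (Rk k) start_set = measure R start_set"
  by (simp add: measure_def start)

lemma start_measure_pos: "0 < measure R start_set"
  using start_pos start_finite by (simp add: measure_def enn2real_positive_iff)

lemma bridge_finite: "1 \<le> k \<Longrightarrow> emeasure (Rk k) bridge_set < \<infinity>" "emeasure R bridge_set < \<infinity>"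
proof -
  have s: "start_set \<in> sets (path_field E {0..1})"
    using start_set_past sets_path_field_mono[of "{0..0}" "{0..1}" E] by auto
  have sub: "bridge_set \<subseteq> start_set" by (auto simp: bridge_set_def)
  show "emeasure (Rk k) bridge_set < \<infinity>" if "1 \<le> k"
    using emeasure_mono[OF sub, of "Rk k"] s sets_Rk[OF that] start[OF that] start_finite by simp
  show "emeasure R bridge_set < \<infinity>"
    using emeasure_mono[OF sub, of R] s R.sets_Q start_finite by simp
qed

text \<open>Induction along the walk, with half of the remaining time reserved for the last edge.
  There \<open>jump_bound\<close> contributes \<open>slow a b\<close> times an integral of the
  original kernel, so \<open>k\<close> enters only through the length of the walk. The constant may
  depend on the walk and on \<open>t\<close>.\<close>

lemma walk_mass:
  assumes "walk E d x b L" "0 < t" "t \<le> 1"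
  shows "\<exists>c>0. \<forall>k\<ge>1. c * exp (- ln (real k) * L) \<le> measure (Rk k) {\<omega> \<in> paths E. \<omega> 0 = x \<and> \<omega> t = b}"
  using assms
proof (induction arbitrary: t)
  case walk_refl
  show ?case
  proof (intro exI[of _ "R.stay_const * measure R start_set"] conjI allI impI)
    show "0 < R.stay_const * measure R start_set" using R.stay_const_pos start_measure_pos by simp
    fix k :: nat assume k: "1 \<le> k"
    interpret slowed_process E J C R d k "Rk k" by (rule slowed[OF k])
    have "R.stay_const * measure (Rk k) start_set \<le> measure (Rk k) (start_set \<inter> {\<omega> \<in> space (Rk k). \<omega> t = x})"
      using walk_refl start[OF k] start_finite start_set_past
      by (intro S.stay_bound[where s = 0]) auto
    also have "start_set \<inter> {\<omega> \<in> space (Rk k). \<omega> t = x} = {\<omega> \<in> paths E. \<omega> 0 = x \<and> \<omega> t = x}"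
      by (auto simp: S.space_Q)
    finally show "R.stay_const * measure R start_set * exp (- ln (real k) * 0) \<le>
        measure (Rk k) {\<omega> \<in> paths E. \<omega> 0 = x \<and> \<omega> t = x}"
      using start_measure[OF k] by simp
  qed
next
  case (walk_step a L b)
  \<comment> \<open>The induction hypothesis holds for every positive time. Stopping at
    \<open>t / 2\<close> leaves an interval of positive length, on which the integral of
    \<open>J\<close> is positive.\<close>
  let ?s = "t / 2"
  have ab: "a \<noteq> b" using walk_step irrefl by auto
  obtain c where c: "0 < c"
    "\<And>k. 1 \<le> k \<Longrightarrow> c * exp (- ln (real k) * L) \<le> measure (Rk k) {\<omega> \<in> paths E. \<omega> 0 = x \<and> \<omega> ?s = a}"
    using walk_step.IH[of ?s] walk_step.prems by auto
  define I where "I = (LINT r:{?s..t}|lborel. J r a b)"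
  have I: "0 < I" unfolding I_def
    using walk_step.prems walk_step.hyps by (intro R.kernel_integral_pos kernel_pos) auto
  have den: "0 < 1 + C / R.stay_const" using R.C_nonneg R.stay_const_pos by (simp add: add_pos_nonneg)
  show ?case
  proof (intro exI[of _ "R.stay_const * c * I / (1 + C / R.stay_const)"] conjI allI impI)
    show "0 < R.stay_const * c * I / (1 + C / R.stay_const)"
      using R.stay_const_pos c I den by simp
    fix k :: nat assume k: "1 \<le> k"
    interpret slowed_process E J C R d k "Rk k" by (rule slowed[OF k])
    let ?A = "{\<omega> \<in> paths E. \<omega> 0 = x \<and> \<omega> ?s = a}"
    let ?B = "{\<omega> \<in> paths E. \<omega> 0 = x \<and> \<omega> t = b}"
    have "start_set \<inter> {\<omega> \<in> space (Rk k). \<omega> ?s = a} \<in> sets (path_field E {0..?s})"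
    proof (rule S.past_Int)
      show "start_set \<in> sets (path_field E {0..?s})"
        using walk_step.prems by (intro path_field_coordinate) simp
    qed (use walk_step.prems in auto)
    also have "start_set \<inter> {\<omega> \<in> space (Rk k). \<omega> ?s = a} = ?A" by (auto simp: S.space_Q)
    finally have A: "?A \<in> sets (path_field E {0..?s})" .
    have SQ: "start_set \<in> sets (Rk k)" using S.past_sets[OF start_set_past] by simp
    have fin: "emeasure (Rk k) M < \<infinity>" if "M \<subseteq> start_set" for M
      using emeasure_mono[OF that SQ] start[OF k] start_finite by simp
    have "R.stay_const * measure (Rk k) ?A * (LINT r:{?s..t}|lborel. slowed_kernel d J k r a b) \<le>
      (1 + C / R.stay_const) * measure (Rk k) (?A \<inter> {\<omega> \<in> space (Rk k). \<omega> t = b})"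
      using walk_step.prems walk_step.hyps ab by (intro S.jump_bound A fin) auto
    also have "(LINT r:{?s..t}|lborel. slowed_kernel d J k r a b) = slow a b * I"
      unfolding slowed_kernel_eq I_def by simp
    also have "(1 + C / R.stay_const) * measure (Rk k) (?A \<inter> {\<omega> \<in> space (Rk k). \<omega> t = b}) \<le>
        (1 + C / R.stay_const) * measure (Rk k) ?B"
    proof (intro mult_left_mono measure_mono_fmeasurable)
      show "?A \<inter> {\<omega> \<in> space (Rk k). \<omega> t = b} \<in> sets (Rk k)"
        using S.past_sets[OF A] walk_step.prems by (intro sets.Int) auto
      have "?B = start_set \<inter> {\<omega> \<in> space (Rk k). \<omega> t = b}" by (auto simp: S.space_Q)
      moreover have "start_set \<inter> {\<omega> \<in> space (Rk k). \<omega> t = b} \<in> sets (Rk k)"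
        using SQ by (intro sets.Int) auto
      ultimately have "?B \<in> sets (Rk k)" by simp
      then show "?B \<in> fmeasurable (Rk k)" using fin[of ?B] by (auto simp: fmeasurable_def)
    qed (use den in auto)
    finally have *: "R.stay_const * measure (Rk k) ?A * (slow a b * I) \<le> (1 + C / R.stay_const) * measure (Rk k) ?B" .
    have "R.stay_const * (c * exp (- ln (real k) * L)) * (slow a b * I) \<le> R.stay_const * measure (Rk k) ?A * (slow a b * I)"
      using c(2)[OF k] R.stay_const_pos slow_bounds[of a b] I
      by (intro mult_right_mono mult_left_mono) auto
    also note *
    finally have "R.stay_const * c * I * (exp (- ln (real k) * L) * slow a b) \<le> (1 + C / R.stay_const) * measure (Rk k) ?B"
      by (simp add: mult_ac)
    also have "exp (- ln (real k) * L) * slow a b = exp (- ln (real k) * (L + d a b))"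
      by (simp add: slow_def exp_add[symmetric] algebra_simps)
    finally show "R.stay_const * c * I / (1 + C / R.stay_const) * exp (- ln (real k) * (L + d a b)) \<le> measure (Rk k) ?B"
      using den by (simp add: pos_divide_le_eq mult_ac)
  qed
qed

lemma path_length_nonneg: "0 \<le> path_length d \<omega>"
proof -
  have "0 \<le> d a b" for a b using d_ge_1[of a b] d_refl[of a] by (cases "a = b") auto
  then show ?thesis unfolding path_length_def by (intro sum_nonneg)
qed

lemma distance_le_path_length:
  assumes "\<omega> \<in> bridge_set"
  shows "d x y \<le> path_length d \<omega>"
  unfolding d_INF[of x y] using assms path_length_nonneg
  by (intro cINF_lower bdd_belowI[of _ 0]) (auto simp: bridge_set_def paths_between_def)

lemma geodesic_walk: "walk E d x y (d x y)"
proof -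
  have pb: "paths_between E x y = bridge_set" by (auto simp: paths_between_def bridge_set_def)
  obtain L where "walk E d x y L" using walk_exists[OF connected] by blast
  from walk_mass[OF this, of 1] obtain c where c: "0 < c"
    "\<forall>k\<ge>1. c * exp (- ln (real k) * L) \<le> measure (Rk k) {\<omega> \<in> paths E. \<omega> 0 = x \<and> \<omega> 1 = y}" by auto
  have "c * exp (- ln (real 1) * L) \<le> measure (Rk 1) bridge_set"
    using c(2)[rule_format, of 1] by (simp add: bridge_set_def)
  then have "0 < measure (Rk 1) bridge_set" using c(1) by simp
  \<comment> \<open>Existence of a path from \<open>x\<close> to \<open>y\<close> is read off from
    positive mass for \<open>k = 1\<close>, so no path has to be constructed from the walk.\<close>
  then have "bridge_set \<noteq> {}" by auto
  then obtain \<omega>0 where \<omega>0: "\<omega>0 \<in> bridge_set" by blast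
  have w: "walk E d x y (path_length d \<omega>)" if "\<omega> \<in> bridge_set" for \<omega>
    using path_walk[where d = d, OF _ d_refl, of \<omega> E] that by (auto simp: bridge_set_def)
  define n where "n = nat \<lceil>path_length d \<omega>0\<rceil>"
  have n: "path_length d \<omega>0 \<le> real n" by (simp add: n_def real_nat_ceiling_ge)
  \<comment> \<open>Lengths beyond that of the reference path \<open>\<omega>0\<close> cannot matter
    for the infimum. The remaining ones are walk lengths below a bound, hence finitely many, and the
    infimum is attained.\<close>
  define V where "V = path_length d ` bridge_set \<inter> {..real n}"
  have "V \<subseteq> snd ` {(b, L). walk E d x b L \<and> L \<le> real n}"
  proof
    fix L assume "L \<in> V"
    then have "(y, L) \<in> {(b, L). walk E d x b L \<and> L \<le> real n}" using w by (auto simp: V_def)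
    then show "L \<in> snd ` {(b, L). walk E d x b L \<and> L \<le> real n}" by force
  qed
  moreover have "finite {(b, L). walk E d x b L \<and> L \<le> real n}"
    using irrefl by (intro finite_short_walks R.finite_nbrs d_ge_1) auto
  ultimately have V: "finite V" using finite_surj by blast
  have V0: "path_length d \<omega>0 \<in> V" using \<omega>0 n by (simp add: V_def)
  have min: "Min V \<in> V" using V V0 by (intro Min_in) auto
  have "d x y = Min V"
    unfolding d_INF[of x y] pb
  proof (rule cInf_eq_minimum)
    show "Min V \<in> path_length d ` bridge_set" using min by (simp add: V_def)
    fix L assume L: "L \<in> path_length d ` bridge_set"
    show "Min V \<le> L"
    proof (cases "L \<le> real n")
      case True
      then show ?thesis using L V by (intro Min_le) (auto simp: V_def)
    next
      case False
      have "Min V \<le> path_length d \<omega>0" using V V0 by (rule Min_le)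
      then show ?thesis using False n by simp
    qed
  qed
  moreover obtain \<omega> where "\<omega> \<in> bridge_set" "path_length d \<omega> = Min V" using min by (auto simp: V_def)
  ultimately show ?thesis using w[of \<omega>] by simp
qed

text \<open>For a walk of length exactly \<open>d x y\<close> the power of \<open>k\<close> in
  \<open>walk_mass\<close> cancels the scaling; a longer walk would leave a bound tending to
  zero.\<close>

lemma bridge_mass:
  "\<exists>c>0. \<forall>k\<ge>1. c \<le> exp (ln (real k) * d x y) * measure (Rk k) bridge_set"
proof -
  obtain c where c: "0 < c" "\<forall>k\<ge>1. c * exp (- ln (real k) * d x y) \<le> measure (Rk k) bridge_set"
    using walk_mass[OF geodesic_walk, of 1] by (auto simp: bridge_set_def)
  have "c \<le> exp (ln (real k) * d x y) * measure (Rk k) bridge_set" if "1 \<le> k" for k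
  proof -
    have "exp (ln (real k) * d x y) * (c * exp (- ln (real k) * d x y)) \<le>
      exp (ln (real k) * d x y) * measure (Rk k) bridge_set"
      using c(2) that by (intro mult_left_mono) auto
    moreover have "exp (ln (real k) * d x y) * exp (- ln (real k) * d x y) = 1"
      by (simp add: exp_add[symmetric])
    ultimately show ?thesis by (simp only: mult.left_commute[of _ c] mult_1_right)
  qed
  with c(1) show ?thesis by blast
qed

section \<open>Limit of the rescaled weights and integrals\<close>

definition geodesic_weight :: "(real \<Rightarrow> 'a) \<Rightarrow> real" where
  "geodesic_weight \<omega> = indicator (geodesics E d) \<omega> * exp (LINT t:{0..1}|lborel. total_rate E J t (\<omega> t))"

lemma geodesic_weight_nonneg: "0 \<le> geodesic_weight \<omega>"
  by (simp add: geodesic_weight_def)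

lemma geodesic_weight_measurable: "geodesic_weight \<in> borel_measurable R"
proof -
  note [measurable] = R.path_length_measurable[where d = d, OF d_refl] R.measurable_X2[of d 0 1]
    R.measurable_integral_along_path[where g = "total_rate E J" and s = 0 and t = 1, OF R.rate_measurable]
  \<comment> \<open>The union over all pairs of endpoints becomes one equation between measurable
    functions of the path.\<close>
  have "geodesics E d = {\<omega> \<in> space R. path_length d \<omega> = d (\<omega> 0) (\<omega> 1)}"
    by (auto simp: geodesics_def geodesics_between_def paths_between_def R.space_Q)
  also have "\<dots> \<in> sets R" by measurable
  finally have [measurable]: "geodesics E d \<in> sets R" .
  have "(\<lambda>\<omega>. LINT t:{0..1}|lborel. total_rate E J t (\<omega> t)) \<in> borel_measurable R"
    by (rule R.measurable_integral_along_path[OF R.rate_measurable]) auto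
  then show ?thesis unfolding geodesic_weight_def by measurable
qed

lemma geodesic_weight_le:
  "geodesic_weight \<omega> \<le> exp C"
proof -
  have "\<bar>LINT t:{0..1}|lborel. total_rate E J t (\<omega> t)\<bar> \<le> C * measure lborel {0..1 :: real}"
    using R.rate_nonneg R.rate_le by (intro set_integral_bound) (auto simp: emeasure_lborel_Icc_eq)
  then have "exp (LINT t:{0..1}|lborel. total_rate E J t (\<omega> t)) \<le> exp C" by simp
  then show ?thesis by (simp add: geodesic_weight_def indicator_def)
qed

text \<open>With \<open>e\<close> the excess of the length over \<open>d x y\<close>, the scaling
  leaves \<open>k powr (- e)\<close>, which tends to 1 on geodesics and to 0 elsewhere. The saved
  rate tends to the full rate because the slowed total rate is at most \<open>C / k\<close>.\<close>

lemma scaled_weight_tendsto: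
  assumes \<omega>: "\<omega> \<in> bridge_set"
  shows "(\<lambda>k. exp (ln (real k) * d x y) * slowed_process.weight E J d k \<omega>) \<longlonglongrightarrow> geodesic_weight \<omega>"
proof -
  have p: "\<omega> \<in> paths E" "\<omega> 0 = x" "\<omega> 1 = y" using \<omega> by (auto simp: bridge_set_def)
  define e where "e = path_length d \<omega> - d x y"
  have e: "0 \<le> e" using distance_le_path_length[OF \<omega>] by (simp add: e_def)
  define I where "I = (LINT r:{0..1}|lborel. total_rate E J r (\<omega> r))"
  define Ik where "Ik = (\<lambda>k. LINT r:{0..1}|lborel. slowed_process.saved_rate E J d k r (\<omega> r))"
  have eq: "exp (ln (real k) * d x y) * slowed_process.weight E J d k \<omega> = exp (- e * ln (real k)) * exp (Ik k)"
    if "1 \<le> k" for k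
    unfolding slowed_process.weight_def[OF slowed[OF that]] Ik_def e_def
    by (simp add: exp_add[symmetric] algebra_simps)
  have err: "\<bar>Ik k - I\<bar> \<le> C * (1 / real k)" if k: "1 \<le> k" for k
  proof -
    interpret slowed_process E J C R d k "Rk k" by (rule slowed[OF k])
    \<comment> \<open>Edges join distinct states, hence have length at least 1, and every jump rate
      is slowed by at least the factor \<open>k\<close>.\<close>
    have s1: "slow a b \<le> 1 / real k" if "E a b" for a b
    proof -
      have "1 \<le> d a b" using that irrefl by (intro d_ge_1) auto
      then have "ln (real k) * 1 \<le> ln (real k) * d a b" using k by (intro mult_left_mono) auto
      then have "slow a b \<le> exp (- ln (real k))" unfolding slow_def by simp
      also have "\<dots> = 1 / real k" using k by (simp add: exp_minus inverse_eq_divide)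
      finally show ?thesis .
    qed
    have tr: "0 \<le> total_rate E (slowed_kernel d J k) r a" "total_rate E (slowed_kernel d J k) r a \<le> C * (1 / real k)"
      if r: "r \<in> {0..1}" for r a
    proof -
      show "0 \<le> total_rate E (slowed_kernel d J k) r a" by (rule S.rate_nonneg[OF r])
      have "total_rate E (slowed_kernel d J k) r a \<le> (\<Sum>b\<in>{b. E a b}. 1 / real k * J r a b)"
        unfolding total_rate_def slowed_kernel_eq
        using s1 R.kernel_nonneg[OF r] by (intro sum_mono mult_right_mono) auto
      also have "\<dots> = 1 / real k * total_rate E J r a" by (simp add: total_rate_def sum_distrib_left)
      also have "\<dots> \<le> 1 / real k * C" by (intro mult_left_mono R.rate_le[OF r]) simp
      finally show "total_rate E (slowed_kernel d J k) r a \<le> C * (1 / real k)" by simp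
    qed
    have "Ik k - I = (LINT r:{0..1}|lborel. saved_rate r (\<omega> r) - total_rate E J r (\<omega> r))"
      unfolding Ik_def I_def
    proof (rule set_integral_diff(2)[symmetric])
      show "set_integrable lborel {0..1} (\<lambda>r. saved_rate r (\<omega> r))" using p by (intro saved_rate_integrable) auto
      show "set_integrable lborel {0..1} (\<lambda>r. total_rate E J r (\<omega> r))"
        using p R.rate_nonneg R.rate_le
        by (intro R.integrable_along_path[where K = C] R.rate_measurable) (auto simp: R.space_Q)
    qed
    also have "\<bar>\<dots>\<bar> \<le> C * (1 / real k) * measure lborel {0..1 :: real}"
      using tr by (intro set_integral_bound) (auto simp: saved_rate_def emeasure_lborel_Icc_eq)
    finally show ?thesis by simp
  qed
  have Ik: "Ik \<longlonglongrightarrow> I"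
  proof (rule LIM_zero_cancel, rule tendsto_0_le[where K = 1])
    have "(\<lambda>k. C * (1 / real k)) \<longlonglongrightarrow> C * 0" by (intro tendsto_intros lim_1_over_n)
    then show "(\<lambda>k. C * (1 / real k)) \<longlonglongrightarrow> 0" by simp
    show "\<forall>\<^sub>F k in sequentially. norm (Ik k - I) \<le> norm (C * (1 / real k)) * 1"
      using eventually_ge_at_top[of 1]
      by eventually_elim (use order_trans[OF err abs_ge_self] in simp)
  qed
  have geo: "\<omega> \<in> geodesics E d \<longleftrightarrow> e = 0"
    using p by (auto simp: e_def geodesics_def geodesics_between_def paths_between_def)
  have "(\<lambda>k. exp (- e * ln (real k))) \<longlonglongrightarrow> indicator (geodesics E d) \<omega>"
  proof (cases "e = 0")
    case True
    then show ?thesis using geo by simp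
  next
    case False
    then have "0 < e" using e by simp
    have "filterlim (\<lambda>k. e * ln (real k)) at_top sequentially"
      by (intro filterlim_tendsto_pos_mult_at_top[OF tendsto_const \<open>0 < e\<close>]
        filterlim_compose[OF ln_at_top] filterlim_real_sequentially)
    then have "filterlim (\<lambda>k. - (e * ln (real k))) at_bot sequentially"
      by (simp add: filterlim_uminus_at_bot)
    then have "(\<lambda>k. exp (- (e * ln (real k)))) \<longlonglongrightarrow> 0"
      by (rule filterlim_compose[OF exp_at_bot])
    then show ?thesis using False geo by simp
  qed
  then have "(\<lambda>k. exp (- e * ln (real k)) * exp (Ik k)) \<longlonglongrightarrow> indicator (geodesics E d) \<omega> * exp I"
    by (intro tendsto_mult tendsto_exp Ik)
  then have "(\<lambda>k. exp (- e * ln (real k)) * exp (Ik k)) \<longlonglongrightarrow> geodesic_weight \<omega>"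
    by (simp add: geodesic_weight_def I_def)
  then show ?thesis
  proof (rule Lim_transform_eventually)
    show "\<forall>\<^sub>F k in sequentially. exp (- e * ln (real k)) * exp (Ik k) =
        exp (ln (real k) * d x y) * slowed_process.weight E J d k \<omega>"
      using eventually_ge_at_top[of 1] by eventually_elim (simp only: eq)
  qed
qed

lemma scaled_weight_bounds:
  assumes k: "1 \<le> k" and \<omega>: "\<omega> \<in> bridge_set"
  shows "0 \<le> exp (ln (real k) * d x y) * slowed_process.weight E J d k \<omega>"
    "exp (ln (real k) * d x y) * slowed_process.weight E J d k \<omega> \<le> exp C"
proof -
  interpret slowed_process E J C R d k "Rk k" by (rule slowed[OF k])
  have p: "\<omega> \<in> paths E" using \<omega> by (auto simp: bridge_set_def)
  show "0 \<le> exp (ln (real k) * d x y) * weight \<omega>" using weight_nonneg by simp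
  have "\<bar>LINT r:{0..1}|lborel. saved_rate r (\<omega> r)\<bar> \<le> C * measure lborel {0..1 :: real}"
    using saved_rate_bounds by (intro set_integral_bound) (auto simp: emeasure_lborel_Icc_eq)
  then have 1: "exp (LINT r:{0..1}|lborel. saved_rate r (\<omega> r)) \<le> exp C" by simp
  have "ln (real k) * d x y \<le> ln (real k) * path_length d \<omega>"
    using k distance_le_path_length[OF \<omega>] by (intro mult_left_mono) auto
  then have "exp (ln (real k) * d x y) * exp (- ln (real k) * path_length d \<omega>) \<le> 1"
    by (simp add: exp_add[symmetric])
  then have "exp (ln (real k) * d x y) * exp (- ln (real k) * path_length d \<omega>) *
      exp (LINT r:{0..1}|lborel. saved_rate r (\<omega> r)) \<le> 1 * exp C"
    using 1 by (intro mult_mono) auto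
  then show "exp (ln (real k) * d x y) * weight \<omega> \<le> exp C" by (simp add: weight_def mult.assoc)
qed

text \<open>\<open>bridge_set\<close> involves the final time, whereas
  \<open>girsanov_formula\<close> wants an event at time 0. It is therefore applied on
  \<open>start_set\<close>, with the indicator of the bridge event moved into the integrand.\<close>

lemma slowed_integral:
  fixes f :: "(real \<Rightarrow> 'a) \<Rightarrow> real"
  assumes k: "1 \<le> k" and f: "f \<in> borel_measurable (path_field E {0..1})"
  shows "(LINT \<omega>:bridge_set|Rk k. f \<omega>) = (LINT \<omega>:bridge_set|R. slowed_process.weight E J d k \<omega> * f \<omega>)"
proof -
  interpret slowed_process E J C R d k "Rk k" by (rule slowed[OF k])
  have m: "(\<lambda>\<omega>. indicator bridge_set \<omega> * f \<omega>) \<in> borel_measurable (path_field E {0..1})"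
    using f bridge_set_sets by measurable
  have ind: "indicat_real start_set \<omega> * indicator bridge_set \<omega> = indicator bridge_set \<omega>" for \<omega>
    by (auto simp: bridge_set_def indicator_def)
  have "(LINT \<omega>:start_set|Rk k. indicator bridge_set \<omega> * f \<omega>) =
      (LINT \<omega>:start_set|R. weight \<omega> * (indicator bridge_set \<omega> * f \<omega>))"
    by (rule girsanov_formula[where x = x, OF start_set_past start_finite _ _ _ m])
      (use start[OF k] start_finite start_measure[OF k] in auto)
  moreover have "(LINT \<omega>:start_set|Rk k. indicator bridge_set \<omega> * f \<omega>) = (LINT \<omega>:bridge_set|Rk k. f \<omega>)"
    unfolding set_lebesgue_integral_def real_scaleR_def mult.assoc[symmetric] ind ..
  moreover have "(LINT \<omega>:start_set|R. weight \<omega> * (indicator bridge_set \<omega> * f \<omega>)) = (LINT \<omega>:bridge_set|R. weight \<omega> * f \<omega>)"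
    unfolding set_lebesgue_integral_def real_scaleR_def
    by (intro Bochner_Integration.integral_cong refl) (auto simp: bridge_set_def indicator_def)
  ultimately show ?thesis by simp
qed

lemma scaled_integral_tendsto:
  fixes f :: "(real \<Rightarrow> 'a) \<Rightarrow> real"
  assumes f: "f \<in> borel_measurable (path_field E {0..1})" and K: "\<And>\<omega>. \<omega> \<in> paths E \<Longrightarrow> \<bar>f \<omega>\<bar> \<le> K"
  shows "(\<lambda>k. exp (ln (real k) * d x y) * (LINT \<omega>:bridge_set|Rk k. f \<omega>)) \<longlonglongrightarrow>
    (LINT \<omega>:bridge_set|R. geodesic_weight \<omega> * f \<omega>)"
proof -
  have fR [measurable]: "f \<in> borel_measurable R" using f by (simp add: measurable_cong_sets[OF R.sets_Q refl])
  have HR [measurable]: "bridge_set \<in> sets R" using bridge_set_sets by (simp add: R.sets_Q)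
  note [measurable] = geodesic_weight_measurable
  let ?g = "\<lambda>k \<omega>. (exp (ln (real k) * d x y) * slowed_process.weight E J d k \<omega>) * f \<omega>"
  \<comment> \<open>The index is shifted because the weights and their bounds are available only for
    \<open>k \<ge> 1\<close>.\<close>
  have "(\<lambda>k. LINT \<omega>:bridge_set|R. ?g (Suc k) \<omega>) \<longlonglongrightarrow> (LINT \<omega>:bridge_set|R. geodesic_weight \<omega> * f \<omega>)"
    unfolding set_lebesgue_integral_def
  proof (rule integral_dominated_convergence[where w = "\<lambda>\<omega>. indicator bridge_set \<omega> * (exp C * K)"])
    show "(\<lambda>\<omega>. indicat_real bridge_set \<omega> *\<^sub>R (geodesic_weight \<omega> * f \<omega>)) \<in> borel_measurable R" by measurable
    show "(\<lambda>\<omega>. indicat_real bridge_set \<omega> *\<^sub>R ?g (Suc k) \<omega>) \<in> borel_measurable R" for k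
    proof -
      interpret slowed_process E J C R d "Suc k" "Rk (Suc k)" by (rule slowed) simp
      note [measurable] = weight_measurable
      show ?thesis by measurable
    qed
    show "integrable R (\<lambda>\<omega>. indicat_real bridge_set \<omega> * (exp C * K))"
      using bridge_finite(2) HR by (intro integrable_mult_left) (simp add: integrable_indicator_iff)
    show "AE \<omega> in R. (\<lambda>k. indicat_real bridge_set \<omega> *\<^sub>R ?g (Suc k) \<omega>) \<longlonglongrightarrow>
        indicat_real bridge_set \<omega> *\<^sub>R (geodesic_weight \<omega> * f \<omega>)"
    proof (rule AE_I2)
      fix \<omega>
      show "(\<lambda>k. indicat_real bridge_set \<omega> *\<^sub>R ?g (Suc k) \<omega>) \<longlonglongrightarrow>
          indicat_real bridge_set \<omega> *\<^sub>R (geodesic_weight \<omega> * f \<omega>)"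
      proof (cases "\<omega> \<in> bridge_set")
        case True
        show ?thesis
          by (intro tendsto_intros LIMSEQ_Suc[OF scaled_weight_tendsto[OF True]])
      qed simp
    qed
    show "AE \<omega> in R. norm (indicat_real bridge_set \<omega> *\<^sub>R ?g (Suc k) \<omega>) \<le> indicat_real bridge_set \<omega> * (exp C * K)" for k
    proof (rule AE_I2)
      fix \<omega> assume "\<omega> \<in> space R"
      show "norm (indicat_real bridge_set \<omega> *\<^sub>R ?g (Suc k) \<omega>) \<le> indicat_real bridge_set \<omega> * (exp C * K)"
      proof (cases "\<omega> \<in> bridge_set")
        case True
        have "\<bar>exp (ln (real (Suc k)) * d x y) * slowed_process.weight E J d (Suc k) \<omega>\<bar> * \<bar>f \<omega>\<bar> \<le> exp C * K"
          using scaled_weight_bounds[of "Suc k", OF _ True] K[of \<omega>] True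
          by (intro mult_mono) (auto simp: bridge_set_def simp del: of_nat_Suc)
        then show ?thesis using True by (simp add: abs_mult del: of_nat_Suc)
      qed simp
    qed
  qed
  moreover have "(LINT \<omega>:bridge_set|R. ?g (Suc k) \<omega>) =
      exp (ln (real (Suc k)) * d x y) * (LINT \<omega>:bridge_set|Rk (Suc k). f \<omega>)" for k
    unfolding slowed_integral[of "Suc k", OF _ f, simplified] mult.assoc by simp
  ultimately have "(\<lambda>k. exp (ln (real (Suc k)) * d x y) * (LINT \<omega>:bridge_set|Rk (Suc k). f \<omega>)) \<longlonglongrightarrow>
    (LINT \<omega>:bridge_set|R. geodesic_weight \<omega> * f \<omega>)" by simp
  then show ?thesis by (rule LIMSEQ_imp_Suc)
qed

lemma bridge_integral_one: "1 \<le> k \<Longrightarrow> (LINT \<omega>:bridge_set|Rk k. 1) = measure (Rk k) bridge_set"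
  using set_integral_const_finite[of bridge_set "Rk k" 1] bridge_finite(1)[of k] bridge_set_sets sets_Rk[of k] by simp

definition geodesic_mass :: real where
  "geodesic_mass = (LINT \<omega>:bridge_set|R. geodesic_weight \<omega>)"

text \<open>The rescaled bridge masses converge to it and stay above the constant of
  \<open>bridge_mass\<close>. Geodesics therefore carry positive mass without being described
  explicitly.\<close>

lemma geodesic_mass_pos: "0 < geodesic_mass"
proof -
  obtain c where c: "0 < c" "\<And>k. 1 \<le> k \<Longrightarrow> c \<le> exp (ln (real k) * d x y) * measure (Rk k) bridge_set"
    using bridge_mass by blast
  have "(\<lambda>k. exp (ln (real k) * d x y) * (LINT \<omega>:bridge_set|Rk k. 1)) \<longlonglongrightarrow> geodesic_mass"
    using scaled_integral_tendsto[of "\<lambda>_. 1" 1] by (simp add: geodesic_mass_def)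
  then have "c \<le> geodesic_mass"
    by (rule LIMSEQ_le_const) (use c(2) bridge_integral_one in \<open>auto intro!: exI[of _ 1]\<close>)
  with c(1) show ?thesis by simp
qed

section \<open>Normalisation: convergence of the bridges\<close>

abbreviation G :: "(real \<Rightarrow> 'a) measure" where
  "G \<equiv> geodesic_measure E d J R"

lemma G_eq: "G = density R (\<lambda>\<omega>. ennreal (geodesic_weight \<omega>))"
  by (simp add: geodesic_measure_def geodesic_weight_def)

lemma sets_G: "sets G = sets (path_field E {0..1})"
  by (simp add: G_eq R.sets_Q)

lemma G_integral:
  fixes f :: "(real \<Rightarrow> 'a) \<Rightarrow> real"
  assumes f: "f \<in> borel_measurable (path_field E {0..1})"
  shows "(LINT \<omega>:bridge_set|G. f \<omega>) = (LINT \<omega>:bridge_set|R. geodesic_weight \<omega> * f \<omega>)"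
proof -
  have [measurable]: "f \<in> borel_measurable R" using f by (simp add: measurable_cong_sets[OF R.sets_Q refl])
  have [measurable]: "bridge_set \<in> sets R" using bridge_set_sets by (simp add: R.sets_Q)
  have "(LINT \<omega>:bridge_set|G. f \<omega>) = (LINT \<omega>|R. geodesic_weight \<omega> *\<^sub>R (indicator bridge_set \<omega> *\<^sub>R f \<omega>))"
    unfolding set_lebesgue_integral_def G_eq
    by (rule integral_density) (auto simp: geodesic_weight_nonneg geodesic_weight_measurable)
  then show ?thesis by (simp add: set_lebesgue_integral_def mult_ac)
qed

lemma G_bridge: "emeasure G bridge_set = ennreal geodesic_mass"
proof -
  have [measurable]: "bridge_set \<in> sets R" using bridge_set_sets by (simp add: R.sets_Q)
  note [measurable] = geodesic_weight_measurable
  have "emeasure G bridge_set = (\<integral>\<^sup>+\<omega>. ennreal (geodesic_weight \<omega>) * indicator bridge_set \<omega> \<partial>R)"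
    unfolding G_eq by (rule emeasure_density) measurable
  also have "\<dots> = (\<integral>\<^sup>+\<omega>. ennreal (indicator bridge_set \<omega> *\<^sub>R geodesic_weight \<omega>) \<partial>R)"
    by (intro nn_integral_cong) (auto simp: indicator_def)
  also have "\<dots> = ennreal geodesic_mass"
    unfolding geodesic_mass_def set_lebesgue_integral_def
  proof (rule nn_integral_eq_integral)
    have "set_integrable R bridge_set geodesic_weight"
      by (rule set_integrable_bounded[where K = "exp C"])
        (use bridge_finite(2) geodesic_weight_nonneg geodesic_weight_le in auto)
    then show "integrable R (\<lambda>\<omega>. indicat_real bridge_set \<omega> *\<^sub>R geodesic_weight \<omega>)"
      by (simp add: set_integrable_def)
  qed (simp add: geodesic_weight_nonneg)
  finally show ?thesis .
qed

lemma bridge_eq: "sets Q = sets (path_field E {0..1}) \<Longrightarrow> bridge Q x y = uniform_measure Q bridge_set"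
  using sets_eq_imp_space_eq[of Q "path_field E {0..1}"]
  by (simp add: bridge_def bridge_set_def space_path_field)

lemma Rk_bridge_pos: "1 \<le> k \<Longrightarrow> 0 < measure (Rk k) bridge_set"
  using bridge_mass exp_gt_zero[of "ln (real k) * d x y"]
  by (metis less_le_trans zero_less_mult_pos)

lemma path_measure_bridge: "path_measure E (bridge (Rk k) x y)" if "1 \<le> k"
  using sets_Rk[OF that] by (simp add: path_measure_def bridge_eq)

lemma path_measure_bridge_G: "path_measure E (bridge G x y)"
  using sets_G by (simp add: path_measure_def bridge_eq)

lemma prob_bridge: "prob_space (bridge (Rk k) x y)" if "1 \<le> k"
  unfolding bridge_eq[OF sets_Rk[OF that]]
  using Rk_bridge_pos[OF that] bridge_finite(1)[OF that]
  by (intro prob_space_uniform_measure) (auto simp: measure_def)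

lemma prob_bridge_G: "prob_space (bridge G x y)"
  unfolding bridge_eq[OF sets_G]
  using G_bridge geodesic_mass_pos by (intro prob_space_uniform_measure) auto

text \<open>A bridge integral is a quotient, so numerator and denominator may both be scaled by
  \<open>k powr (d x y)\<close>. Each then converges, and the limit of the denominator is the
  positive \<open>geodesic_mass\<close>.\<close>

lemma bridge_integral_tendsto:
  fixes f :: "(real \<Rightarrow> 'a) \<Rightarrow> real"
  assumes f: "f \<in> borel_measurable (path_field E {0..1})" and K: "\<And>\<omega>. \<omega> \<in> paths E \<Longrightarrow> \<bar>f \<omega>\<bar> \<le> K"
  shows "(\<lambda>k. integral\<^sup>L (bridge (Rk k) x y) f) \<longlonglongrightarrow> integral\<^sup>L (bridge G x y) f"
proof -
  have "integral\<^sup>L (bridge G x y) f = (LINT \<omega>:bridge_set|G. f \<omega>) / measure G bridge_set"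
    unfolding bridge_eq[OF sets_G]
    using f bridge_set_sets G_bridge geodesic_mass_pos sets_G
    by (intro integral_uniform_measure) (auto simp: measurable_cong_sets[OF sets_G refl])
  also have "measure G bridge_set = geodesic_mass"
    using G_bridge geodesic_mass_pos by (simp add: measure_def)
  finally have G: "integral\<^sup>L (bridge G x y) f = (LINT \<omega>:bridge_set|R. geodesic_weight \<omega> * f \<omega>) / geodesic_mass"
    using G_integral[OF f] by simp
  have Rk: "integral\<^sup>L (bridge (Rk k) x y) f =
      (exp (ln (real k) * d x y) * (LINT \<omega>:bridge_set|Rk k. f \<omega>)) /
      (exp (ln (real k) * d x y) * (LINT \<omega>:bridge_set|Rk k. 1))" if k: "1 \<le> k" for k
  proof -
    have "integral\<^sup>L (bridge (Rk k) x y) f = (LINT \<omega>:bridge_set|Rk k. f \<omega>) / measure (Rk k) bridge_set"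
      unfolding bridge_eq[OF sets_Rk[OF k]]
      using f bridge_set_sets Rk_bridge_pos[OF k] bridge_finite(1)[OF k] sets_Rk[OF k]
      by (intro integral_uniform_measure) (auto simp: measurable_cong_sets[OF sets_Rk[OF k] refl] measure_def)
    then show ?thesis using bridge_integral_one[OF k] by simp
  qed
  have "(\<lambda>k. (exp (ln (real k) * d x y) * (LINT \<omega>:bridge_set|Rk k. f \<omega>)) /
      (exp (ln (real k) * d x y) * (LINT \<omega>:bridge_set|Rk k. 1))) \<longlonglongrightarrow>
      (LINT \<omega>:bridge_set|R. geodesic_weight \<omega> * f \<omega>) / geodesic_mass"
    using scaled_integral_tendsto[OF f K] scaled_integral_tendsto[of "\<lambda>_. 1" 1] geodesic_mass_pos
    by (intro tendsto_divide) (simp_all add: geodesic_mass_def)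
  then show ?thesis unfolding G
    by (rule Lim_transform_eventually) (use eventually_ge_at_top[of 1] in \<open>eventually_elim, simp only: Rk\<close>)
qed

text \<open>A test function that is not measurable has Bochner integral \<open>0\<close> under all the bridges.\<close>

lemma narrow_limit: "narrowly_converges E (\<lambda>k. bridge (Rk k) x y) (bridge G x y)"
  unfolding narrowly_converges_def
proof (intro allI impI)
  fix f :: "(real \<Rightarrow> 'a) \<Rightarrow> real"
  assume f: "continuous_map (skorokhod_topology E) euclideanreal f \<and> bounded (f ` paths E)"
  show "(\<lambda>k. \<integral>\<omega>. f \<omega> \<partial>bridge (Rk k) x y) \<longlonglongrightarrow> (\<integral>\<omega>. f \<omega> \<partial>bridge G x y)"
  proof (cases "f \<in> borel_measurable (path_field E {0..1})")
    case True
    obtain K where "\<And>\<omega>. \<omega> \<in> paths E \<Longrightarrow> \<bar>f \<omega>\<bar> \<le> K"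
      using f by (auto simp: bounded_iff)
    with True show ?thesis by (rule bridge_integral_tendsto)
  next
    case False
    have zero: "integral\<^sup>L Q f = 0" if "path_measure E Q" for Q
    proof (rule not_integrable_integral_eq, rule notI)
      assume "integrable Q f"
      then have "f \<in> borel_measurable Q" by (rule borel_measurable_integrable)
      also have "borel_measurable Q = borel_measurable (path_field E {0..1})"
        by (rule measurable_cong_sets) (use that in \<open>simp_all add: path_measure_def\<close>)
      finally show False using False by contradiction
    qed
    have "\<forall>\<^sub>F k in sequentially. integral\<^sup>L (bridge (Rk k) x y) f = 0"
      using eventually_ge_at_top[of 1] by eventually_elim (intro zero path_measure_bridge)
    then show ?thesis using zero[OF path_measure_bridge_G] by (simp add: tendsto_eventually)
  qed
qed

end

theorem theorem2p9:
  fixes E :: "'a::countable \<Rightarrow> 'a \<Rightarrow> bool"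
    and d :: "'a \<Rightarrow> 'a \<Rightarrow> real"
    and J :: "real \<Rightarrow> 'a \<Rightarrow> 'a \<Rightarrow> real"
    and m :: "'a measure"
    and R :: "(real \<Rightarrow> 'a) measure"
    and Rk :: "nat \<Rightarrow> (real \<Rightarrow> 'a) measure"
    and x y :: 'a
  assumes "admissible_graph E"
    and "admissible_distance E d"
    and "admissible_kernel E J"
    and "sets m = UNIV" and "sigma_finite_measure m" and "\<And>z. emeasure m {z} > 0"
    and "markov_with_kernel E J m R"
    and "\<And>k. k \<ge> 1 \<Longrightarrow> markov_with_kernel E (slowed_kernel d J k) m (Rk k)"
    and "R = Rk 1"
    and "(\<integral>\<^sup>+\<omega>. ennreal (path_length d \<omega>) \<partial>bridge R x y) < \<infinity>"
  shows "(\<forall>k\<ge>1. path_measure E (bridge (Rk k) x y) \<and> prob_space (bridge (Rk k) x y)) \<and>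
    path_measure E (bridge (geodesic_measure E d J R) x y) \<and>
    prob_space (bridge (geodesic_measure E d J R) x y) \<and>
    narrowly_converges E (\<lambda>k. bridge (Rk k) x y) (bridge (geodesic_measure E d J R) x y)"
proof -
  interpret d: Metric_space UNIV d using assms(2) by (simp add: admissible_distance_def)
  have d_nonneg: "0 \<le> d a b" for a b by (rule d.nonneg)
  have d_refl: "d a a = 0" for a by simp
  obtain C where C: "\<And>t a. t \<in> {0..1} \<Longrightarrow> total_rate E J t a \<le> C"
    using assms(3) unfolding admissible_kernel_def by blast
  have pos: "0 < J t a b" if "t \<in> {0..1}" "E a b" for t a b
    using assms(3) that unfolding admissible_kernel_def by metis
  have kernel: "jump_kernel E J C"
  proof
    show "finite {b. E a b}" for a using assms(1) by (simp add: admissible_graph_def)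
    show "set_borel_measurable borel {0..1} (\<lambda>t. J t a b)" for a b
      using assms(3) unfolding admissible_kernel_def by blast
    show "0 \<le> J t a b" if "t \<in> {0..1}" "E a b" for t a b using pos[OF that] by simp
    show "total_rate E J t a \<le> C" if "t \<in> {0..1}" for t a by (rule C[OF that])
  qed
  have process: "jump_process E J' C Q" if "jump_kernel E J' C" "markov_with_kernel E J' m Q" for J' Q
    using that unfolding jump_process_def jump_process_axioms_def markov_with_kernel_def path_measure_def
    by blast
  have start: "emeasure Q {\<omega> \<in> paths E. \<omega> 0 = x} = emeasure m {x}" if Q: "markov_with_kernel E J' m Q" for J' Q
  proof -
    have s: "sets Q = sets (path_field E {0..1})" and m: "distr Q (count_space UNIV) (\<lambda>\<omega>. \<omega> 0) = m"
      using Q by (auto simp: markov_with_kernel_def path_measure_def)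
    have "(\<lambda>\<omega>. \<omega> 0) \<in> measurable Q (count_space UNIV)"
      using measurable_coordinate_any[of 0 E] by (simp add: measurable_cong_sets[OF s refl])
    then have "emeasure m {x} = emeasure Q ((\<lambda>\<omega>. \<omega> 0) -` {x} \<inter> space Q)"
      unfolding m[symmetric] by (rule emeasure_distr) simp
    also have "(\<lambda>\<omega>. \<omega> 0) -` {x} \<inter> space Q = {\<omega> \<in> paths E. \<omega> 0 = x}"
      using sets_eq_imp_space_eq[OF s] by (auto simp: space_path_field)
    finally show ?thesis by simp
  qed
  interpret m: sigma_finite_measure m by (rule assms(5))
  \<comment> \<open>Some member of a countable cover by sets of finite measure contains
    \<open>x\<close>, so the atom at \<open>x\<close> is finite. This makes the event of starting at
    \<open>x\<close> admissible for the estimates.\<close>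
  have mx: "emeasure m {x} < \<infinity>"
  proof -
    obtain M :: "nat \<Rightarrow> 'a set" where M: "range M \<subseteq> sets m" "(\<Union>i. M i) = space m" "\<And>i. emeasure m (M i) \<noteq> \<infinity>"
      using m.sigma_finite by metis
    have "x \<in> space m" using assms(4) sets.sets_into_space[of UNIV m] by auto
    then obtain i where "x \<in> M i" using M(2) by blast
    then have "emeasure m {x} \<le> emeasure m (M i)" using M(1) by (intro emeasure_mono) auto
    with M(3)[of i] show ?thesis by (auto simp: less_top[symmetric] top_unique)
  qed
  interpret R: jump_process E J C R by (rule process[OF kernel assms(7)])
  interpret slowed_family E J C R d Rk x y
  proof (intro slowed_family.intro slowed_family_axioms.intro)
    show "jump_process E J C R" ..
    show "slowed_process E J C R d k (Rk k)" if k: "1 \<le> k" for k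
    proof (intro slowed_process.intro slowed_process_axioms.intro)
      show "jump_process E J C R" ..
      show "jump_process E (slowed_kernel d J k) C (Rk k)"
        by (rule process[OF jump_kernel_slowed[where d = d, OF kernel d_nonneg k] assms(8)[OF k]])
    qed (use k d_nonneg in auto)
    show "\<not> E a a" for a using assms(1) by (auto simp: admissible_graph_def irreflp_def)
    show "E\<^sup>*\<^sup>* a b" for a b using assms(1) by (simp add: admissible_graph_def)
    show "0 < J t a b" if "t \<in> {0..1}" "E a b" for t a b by (rule pos[OF that])
    show "d a a = 0" for a by simp
    show "1 \<le> d a b" if "a \<noteq> b" for a b using assms(2) that unfolding admissible_distance_def by blast
    show "d a b = (INF \<omega>\<in>paths_between E a b. path_length d \<omega>)" for a b
      using assms(2) unfolding admissible_distance_def by blast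
    show "emeasure (Rk k) {\<omega> \<in> paths E. \<omega> 0 = x} = emeasure R {\<omega> \<in> paths E. \<omega> 0 = x}" if "1 \<le> k" for k
      using start[OF assms(7)] start[OF assms(8)[OF that]] by simp
    show "emeasure R {\<omega> \<in> paths E. \<omega> 0 = x} < \<infinity>" "0 < emeasure R {\<omega> \<in> paths E. \<omega> 0 = x}"
      using start[OF assms(7)] mx assms(6)[of x] by simp_all
  qed
  show ?thesis
    using path_measure_bridge prob_bridge path_measure_bridge_G prob_bridge_G narrow_limit by blast
qed

end
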